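(* Let $m\ge 3$ be an integer and let $G(m)$ be the dihedral Artin group with free product generating set $X=\{x,y\}$. Then the conjugacy growth series $C_{G(m),X}(z)=\sum_{n\ge 0} c_{G(m),X}(n)z^n$ is transcendental.
   Context: For $m\ge 3$, $G(m)=\langle a,b \mid {}_m(a,b)={}_m(b,a)\rangle$, where ${}_m(a,b)$ is the alternating word $abab\cdots$ of length $m$. Free product generating set $X=\{x,y\}$ (closed under inverses, i.e. words are over $\{x^{\pm1},y^{\pm 1}\}$): for $m$ odd, $x={}_m(a,b)$, $y=ab$, giving $G(m)\cong\langle x,y\mid x^2=y^m\rangle$; for $m=2p$ even, $x=ab$, $y=a$, giving $G(m)\cong\langle x,y\mid y^{-1}x^py=x^p\rangle=\mathrm{BS}(p,p)$. For a group $G$ with finite generating set $X$, $|g|$ is the word length of $g$; the length of a conjugacy class $[g]$ is $|[g]|=\min\{|h| : h\in[g]\}$; $c_{G,X}(n)$ is the number of conjugacy classes of length exactly $n$. A formal power series is algebraic if it is algebraic over $\mathbb{Q}(z)$, and transcendental otherwise. *)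

theory Defs
  imports
    "HOL-Algebra.Generated_Groups"
    "HOL-Algebra.Group_Action"
    "HOL-Algebra.Finite_Extensions"
    "HOL-Algebra.Algebraic_Closure_Type"
    "HOL-Computational_Algebra.Formal_Laurent_Series"
    "HOL-Computational_Algebra.Polynomial_FPS"
begin

section \<open>Groups given by a presentation\<close>

text \<open>
  A letter is a generator with a sign: \<open>(g, True)\<close> stands for \<open>g\<close> and \<open>(g, False)\<close> for its inverse.
  The generating set of a presentation is the whole type \<open>'g\<close>; a pair \<open>(u, v)\<close> in the set of
  relations stands for the relation \<open>u = v\<close>.
\<close>

type_synonym 'g word = "('g \<times> bool) list"

inductive word_eq :: "('g word \<times> 'g word) set \<Rightarrow> 'g word \<Rightarrow> 'g word \<Rightarrow> bool"
  for R :: "('g word \<times> 'g word) set" where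
  relation: "(u, v) \<in> R \<Longrightarrow> word_eq R u v"
| cancel: "word_eq R [(g, e), (g, \<not> e)] []"
| concat: "word_eq R u u' \<Longrightarrow> word_eq R v v' \<Longrightarrow> word_eq R (u @ v) (u' @ v')"
| refl: "word_eq R u u"
| sym: "word_eq R u v \<Longrightarrow> word_eq R v u"
| trans: "word_eq R u v \<Longrightarrow> word_eq R v w \<Longrightarrow> word_eq R u w"

definition word_class :: "('g word \<times> 'g word) set \<Rightarrow> 'g word \<Rightarrow> 'g word set" where
  "word_class R u = {v. word_eq R u v}"

definition presented_group :: "('g word \<times> 'g word) set \<Rightarrow> 'g word set monoid" where
  "presented_group R =
     \<lparr>carrier = range (word_class R),
      monoid.mult = (\<lambda>U V. \<Union>u\<in>U. \<Union>v\<in>V. word_class R (u @ v)),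
      one = word_class R []\<rparr>"

lemma word_class_eq_iff: "word_class R u = word_class R v \<longleftrightarrow> word_eq R u v"
  unfolding word_class_def set_eq_iff mem_Collect_eq
  by (metis word_eq.refl word_eq.sym word_eq.trans)

lemma mult_word_class:
  "word_class R u \<otimes>\<^bsub>presented_group R\<^esub> word_class R v = word_class R (u @ v)"
proof -
  let ?w = "word_class R (u @ v)"
  have "word_class R (u' @ v') = ?w"
    if "u' \<in> word_class R u" "v' \<in> word_class R v" for u' v'
    using that unfolding word_class_eq_iff
    by (intro word_eq.sym[OF word_eq.concat]) (simp_all add: word_class_def)
  then have "(\<Union>u'\<in>word_class R u. \<Union>v'\<in>word_class R v. word_class R (u' @ v')) =
      (\<Union>u'\<in>word_class R u. \<Union>v'\<in>word_class R v. ?w)"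
    by (intro SUP_cong HOL.refl)
  also have "u \<in> word_class R u" "v \<in> word_class R v"
    by (simp_all add: word_class_def word_eq.refl)
  then have "(\<Union>u'\<in>word_class R u. \<Union>v'\<in>word_class R v. ?w) = ?w"
    by blast
  finally show ?thesis
    by (simp add: presented_group_def)
qed

definition inverse_word :: "'g word \<Rightarrow> 'g word" where
  "inverse_word u = rev (map (\<lambda>(g, e). (g, \<not> e)) u)"

lemma word_eq_inverse_word: "word_eq R (inverse_word u @ u) []"
proof (induction u)
  case Nil
  show ?case by (simp add: inverse_word_def word_eq.refl)
next
  case (Cons l u)
  obtain g e where l: "l = (g, e)" by (cases l)
  have "word_eq R [(g, \<not> e), (g, e)] []"
    using word_eq.cancel[of R g "\<not> e"] by simp
  then have "word_eq R (inverse_word u @ ([(g, \<not> e), (g, e)] @ u)) (inverse_word u @ ([] @ u))"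
    by (intro word_eq.concat word_eq.refl)
  then have "word_eq R (inverse_word (l # u) @ l # u) (inverse_word u @ u)"
    by (simp add: l inverse_word_def)
  then show ?case
    using Cons.IH by (rule word_eq.trans)
qed

lemma group_presented_group: "group (presented_group R)"
proof (rule groupI)
  show "\<exists>y\<in>carrier (presented_group R). y \<otimes>\<^bsub>presented_group R\<^esub> x = \<one>\<^bsub>presented_group R\<^esub>"
    if "x \<in> carrier (presented_group R)" for x
  proof -
    from that obtain u where u: "x = word_class R u"
      by (auto simp: presented_group_def)
    have "word_class R (inverse_word u) \<otimes>\<^bsub>presented_group R\<^esub> x = \<one>\<^bsub>presented_group R\<^esub>"
      unfolding u mult_word_class
      by (simp add: presented_group_def word_class_eq_iff word_eq_inverse_word)
    then show ?thesis by (auto simp: presented_group_def)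
  qed
next
  fix x y assume "x \<in> carrier (presented_group R)" "y \<in> carrier (presented_group R)"
  then obtain u v where "x = word_class R u" "y = word_class R v"
    by (auto simp: presented_group_def)
  then show "x \<otimes>\<^bsub>presented_group R\<^esub> y \<in> carrier (presented_group R)"
    by (simp add: mult_word_class) (simp add: presented_group_def)
next
  show "\<one>\<^bsub>presented_group R\<^esub> \<in> carrier (presented_group R)"
    by (simp add: presented_group_def)
next
  fix x y z assume "x \<in> carrier (presented_group R)" "y \<in> carrier (presented_group R)"
    "z \<in> carrier (presented_group R)"
  then obtain u v w where "x = word_class R u" "y = word_class R v" "z = word_class R w"
    by (auto simp: presented_group_def)
  then show "x \<otimes>\<^bsub>presented_group R\<^esub> y \<otimes>\<^bsub>presented_group R\<^esub> z =
      x \<otimes>\<^bsub>presented_group R\<^esub> (y \<otimes>\<^bsub>presented_group R\<^esub> z)"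
    by (simp add: mult_word_class)
next
  fix x assume "x \<in> carrier (presented_group R)"
  then obtain u where "x = word_class R u"
    by (auto simp: presented_group_def)
  moreover have "\<one>\<^bsub>presented_group R\<^esub> = word_class R []"
    by (simp add: presented_group_def)
  ultimately show "\<one>\<^bsub>presented_group R\<^esub> \<otimes>\<^bsub>presented_group R\<^esub> x = x"
    by (simp add: mult_word_class)
qed


section \<open>Dihedral Artin groups\<close>

datatype artin_gen = A | B

primrec alternating :: "nat \<Rightarrow> 'l \<Rightarrow> 'l \<Rightarrow> 'l list" where
  "alternating 0 s t = []"
| "alternating (Suc n) s t = s # alternating n t s"

definition artin_relations :: "nat \<Rightarrow> (artin_gen word \<times> artin_gen word) set" where
  "artin_relations m =
     {(alternating m (A, True) (B, True), alternating m (B, True) (A, True))}"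

definition dihedral_artin :: "nat \<Rightarrow> artin_gen word set monoid" where
  "dihedral_artin m = presented_group (artin_relations m)"

definition artin_x :: "nat \<Rightarrow> artin_gen word set" where
  "artin_x m = word_class (artin_relations m)
     (if odd m then alternating m (A, True) (B, True) else [(A, True), (B, True)])"

definition artin_y :: "nat \<Rightarrow> artin_gen word set" where
  "artin_y m = word_class (artin_relations m)
     (if odd m then [(A, True), (B, True)] else [(A, True)])"

definition free_product_gens :: "nat \<Rightarrow> artin_gen word set set" where
  "free_product_gens m = {artin_x m, artin_y m}"

lemma free_product_gens_generate:
  "generate (dihedral_artin m) (free_product_gens m) = carrier (dihedral_artin m)"
proof -
  let ?G = "dihedral_artin m" and ?R = "artin_relations m"
  let ?a = "word_class ?R [(A, True)]" and ?b = "word_class ?R [(B, True)]"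
  define H where "H = generate ?G (free_product_gens m)"
  interpret group ?G
    unfolding dihedral_artin_def by (rule group_presented_group)
  have mult: "word_class ?R u \<otimes>\<^bsub>?G\<^esub> word_class ?R v = word_class ?R (u @ v)" for u v
    unfolding dihedral_artin_def by (rule mult_word_class)
  have one: "\<one>\<^bsub>?G\<^esub> = word_class ?R []"
    by (simp add: dihedral_artin_def presented_group_def)
  have carrier: "carrier ?G = range (word_class ?R)"
    by (simp add: dihedral_artin_def presented_group_def)
  have sub: "free_product_gens m \<subseteq> carrier ?G"
    by (auto simp: free_product_gens_def artin_x_def artin_y_def carrier)
  interpret H: subgroup H ?G
    unfolding H_def using sub by (rule generate_is_subgroup)
  have x: "artin_x m \<in> H" and y: "artin_y m \<in> H"
    by (auto simp: H_def free_product_gens_def intro: generate.incl)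
  have cancel_left: "q \<in> H"
    if "p \<in> H" "p \<otimes>\<^bsub>?G\<^esub> q \<in> H" "q \<in> carrier ?G" for p q
  proof -
    have "inv\<^bsub>?G\<^esub> p \<otimes>\<^bsub>?G\<^esub> (p \<otimes>\<^bsub>?G\<^esub> q) \<in> H"
      using that(1,2) by (rule H.m_closed[OF H.m_inv_closed])
    moreover have "p \<in> carrier ?G"
      using that H.subset by blast
    then have "inv\<^bsub>?G\<^esub> p \<otimes>\<^bsub>?G\<^esub> (p \<otimes>\<^bsub>?G\<^esub> q) = q"
      using that(3) by (metis m_assoc l_inv l_one inv_closed)
    ultimately show ?thesis by simp
  qed
  have ab: "word_class ?R [(A, True), (B, True)] \<in> H"
    using x y by (cases "odd m") (auto simp: artin_x_def artin_y_def)
  have a: "?a \<in> H"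
  proof (cases "odd m")
    case True
    then obtain k where k: "m = 2 * k + 1" by (elim oddE)
    have *: "?a \<in> H" if "word_class ?R (alternating (2 * k + 1) (A, True) (B, True)) \<in> H" for k
      using that
    proof (induction k)
      case (Suc k)
      have "word_class ?R [(A, True), (B, True)] \<otimes>\<^bsub>?G\<^esub>
          word_class ?R (alternating (2 * k + 1) (A, True) (B, True)) \<in> H"
        using Suc.prems by (simp add: mult)
      then have "word_class ?R (alternating (2 * k + 1) (A, True) (B, True)) \<in> H"
        by (rule cancel_left[OF ab]) (simp add: carrier)
      then show ?case by (rule Suc.IH)
    qed simp
    show ?thesis
      using x True by (intro *[of k]) (simp add: artin_x_def k)
  next
    case False
    then show ?thesis using y by (simp add: artin_y_def)
  qed
  have b: "?b \<in> H"
    using cancel_left[OF a, of ?b] ab by (simp add: mult carrier)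
  have letter: "word_class ?R [(g, e)] \<in> H" for g e
  proof -
    have pos: "word_class ?R [(g, True)] \<in> H"
      using a b by (cases g) auto
    have "word_class ?R [(g, True)] \<otimes>\<^bsub>?G\<^esub> word_class ?R [(g, False)] = \<one>\<^bsub>?G\<^esub>"
      using word_eq.cancel[of ?R g True] by (simp add: mult one word_class_eq_iff)
    then have "word_class ?R [(g, False)] \<in> H"
      using cancel_left[OF pos] H.one_closed by (simp add: carrier)
    with pos show ?thesis by (cases e) auto
  qed
  have "word_class ?R u \<in> H" for u
  proof (induction u)
    case Nil
    show ?case using H.one_closed by (simp add: one)
  next
    case (Cons l u)
    have "word_class ?R [l] \<otimes>\<^bsub>?G\<^esub> word_class ?R u \<in> H"
      using Cons.IH letter[of "fst l" "snd l"] by (intro H.m_closed) auto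
    then show ?case by (simp add: mult)
  qed
  then show ?thesis
    using H.subset unfolding H_def carrier by blast
qed


section \<open>Conjugacy growth\<close>

text \<open>Only meaningful if \<open>S\<close> generates \<open>G\<close> and \<open>g\<close> is an element of \<open>G\<close>.\<close>

definition word_length :: "('a, 'b) monoid_scheme \<Rightarrow> 'a set \<Rightarrow> 'a \<Rightarrow> nat" where
  "word_length G S g =
     (LEAST n. \<exists>w. length w = n \<and> set w \<subseteq> S \<union> (\<lambda>x. inv\<^bsub>G\<^esub> x) ` S \<and>
        foldr (\<lambda>h k. h \<otimes>\<^bsub>G\<^esub> k) w \<one>\<^bsub>G\<^esub> = g)"

definition conjugacy_classes :: "('a, 'b) monoid_scheme \<Rightarrow> 'a set set" where
  "conjugacy_classes G =
     orbits G (carrier G) (\<lambda>g. \<lambda>h \<in> carrier G. g \<otimes>\<^bsub>G\<^esub> h \<otimes>\<^bsub>G\<^esub> inv\<^bsub>G\<^esub> g)"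

text \<open>\<open>Inf\<close> rather than \<open>Min\<close>, since a conjugacy class may be infinite; on nonempty sets of natural
  numbers it is the minimum.\<close>

definition conjugacy_length :: "('a, 'b) monoid_scheme \<Rightarrow> 'a set \<Rightarrow> 'a set \<Rightarrow> nat" where
  "conjugacy_length G S c = (INF h\<in>c. word_length G S h)"

definition conjugacy_growth :: "('a, 'b) monoid_scheme \<Rightarrow> 'a set \<Rightarrow> nat \<Rightarrow> nat" where
  "conjugacy_growth G S n = card {c \<in> conjugacy_classes G. conjugacy_length G S c = n}"

definition conjugacy_growth_series :: "('a, 'b) monoid_scheme \<Rightarrow> 'a set \<Rightarrow> rat fps" where
  "conjugacy_growth_series G S = Abs_fps (\<lambda>n. of_nat (conjugacy_growth G S n))"


section \<open>Algebraic and transcendental power series\<close>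

text \<open>The field \<open>\<rat>(z)\<close>, as a subfield of the field \<open>\<rat>((z))\<close> of formal Laurent series.\<close>

definition rational_functions :: "rat fls set" where
  "rational_functions =
     {fps_to_fls (fps_of_poly p) / fps_to_fls (fps_of_poly q) | p q. q \<noteq> 0}"

lemma subfield_rational_functions:
  "subfield rational_functions (ring_of_type_algebra :: rat fls ring)"
proof -
  let ?L = "ring_of_type_algebra :: rat fls ring"
  let ?e = "\<lambda>p :: rat poly. fps_to_fls (fps_of_poly p)"
  interpret L: field ?L by (rule field_from_type_algebra)
  have e_add: "?e (p + q) = ?e p + ?e q" and e_mult: "?e (p * q) = ?e p * ?e q"
    and e_uminus: "?e (- p) = - ?e p" and e_0: "?e p = 0 \<longleftrightarrow> p = 0" for p q
    by (simp_all add: fps_of_poly_add fps_of_poly_mult fps_of_poly_uminus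
        fps_to_fls_plus fps_to_fls_uminus fls_times_fps_to_fls)
  have I: "?e p / ?e q \<in> rational_functions" if "q \<noteq> 0" for p q
    using that unfolding rational_functions_def by blast
  have one: "1 \<in> rational_functions"
    using I[of 1 1] by simp
  have uminus: "- u \<in> rational_functions" if "u \<in> rational_functions" for u
  proof -
    obtain p q where u: "u = ?e p / ?e q" and "q \<noteq> 0"
      using \<open>u \<in> rational_functions\<close> unfolding rational_functions_def by blast
    moreover have "- u = ?e (- p) / ?e q"
      by (simp only: u e_uminus minus_divide_left)
    ultimately show ?thesis using I by simp
  qed
  have add: "u + v \<in> rational_functions" and mult: "u * v \<in> rational_functions"
    if u: "u \<in> rational_functions" and v: "v \<in> rational_functions" for u v
  proof -
    obtain p q r s where uv: "u = ?e p / ?e q" "v = ?e r / ?e s" and nz: "q \<noteq> 0" "s \<noteq> 0"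
      using u v unfolding rational_functions_def by blast
    have "u + v = ?e (p * s + r * q) / ?e (q * s)"
      using nz by (simp only: uv e_add e_mult e_0 add_frac_eq)
        (simp add: add_frac_eq e_0)
    with I[of "q * s"] nz show "u + v \<in> rational_functions" by simp
    have "u * v = ?e (p * r) / ?e (q * s)"
      by (simp only: uv e_mult times_divide_times_eq)
    with I[of "q * s"] nz show "u * v \<in> rational_functions" by simp
  qed
  have inverse: "inverse u \<in> rational_functions" if "u \<in> rational_functions" "u \<noteq> 0" for u
  proof -
    obtain p q where u: "u = ?e p / ?e q"
      using \<open>u \<in> rational_functions\<close> unfolding rational_functions_def by blast
    with \<open>u \<noteq> 0\<close> have "p \<noteq> 0" by auto
    then show ?thesis using I[of p q] by (simp add: u)
  qed
  have minv: "\<ominus>\<^bsub>?L\<^esub> u = - u" for u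
    by (rule L.minus_equality) (auto simp: ring_of_type_algebra_def)
  have inv: "inv\<^bsub>?L\<^esub> u = inverse u" if "u \<noteq> 0" for u
    using that by (intro L.comm_inv_char) (auto simp: ring_of_type_algebra_def)
  have subring: "subring rational_functions ?L"
    by (rule L.subringI)
      (use one uminus add mult minv in \<open>auto simp: ring_of_type_algebra_def\<close>)
  show ?thesis
  proof (rule L.subfieldI')
    show "subring rational_functions ?L" by fact
    show "inv\<^bsub>?L\<^esub> k \<in> rational_functions" if "k \<in> rational_functions - {\<zero>\<^bsub>?L\<^esub>}" for k
      using that inverse[of k] inv[of k] by (auto simp: ring_of_type_algebra_def)
  qed
qed

definition transcendental_series :: "rat fps \<Rightarrow> bool" where
  "transcendental_series f \<longleftrightarrow>
     ring.transcendental (ring_of_type_algebra :: rat fls ring) rational_functions (fps_to_fls f)"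

end

theory Submission
  imports Defs "HOL-Analysis.FPS_Convergence"
begin

text \<open>
  Write \<open>G = G(m)\<close> as generated by \<open>u\<close>, \<open>v\<close> with a central element \<open>\<Delta>\<close> such that \<open>G / \<langle>\<Delta>\<rangle>\<close> is the free product
  of the cyclic groups generated by \<open>u\<close> and \<open>v\<close>: for odd \<open>m\<close> take \<open>u = x\<close>, \<open>v = y\<close>, \<open>\<Delta> = x\<^sup>2 = y\<^sup>m\<close>, and for
  even \<open>m = 2p\<close> take \<open>u = y\<close>, \<open>v = x\<close>, \<open>\<Delta> = x\<^sup>p\<close>. Apart from polynomially many exceptions per length, the
  conjugacy classes are parametrised by a cyclic word \<open>w\<close> over the blocks \<open>u\<^sup>a v\<^sup>b\<close> and an exponent \<open>c\<close> of
  \<open>\<Delta>\<close>. The length of the class is the cost of \<open>w\<close> (each block written with minimal exponents) if \<open>c\<close> lies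
  in a window of \<open>h(w) + 1\<close> consecutive integers, where \<open>h(w)\<close> counts the ties between exponents of
  opposite sign, and it grows at least by one with every step outside the window.

  Subtracting the rational series that counts linear words marked at a tie in the first block leaves a
  series \<open>g\<close> with coefficients \<open>0 \<le> g\<^sub>n\<close>, \<open>n g\<^sub>n \<rho>\<^sup>n\<close> bounded and \<open>\<Sum> g\<^sub>n \<rho>\<^sup>n = \<infinity>\<close>. Hence \<open>g(x)\<close> tends to
  infinity for \<open>x \<rightarrow> \<rho>\<close>, but only logarithmically, which is impossible for an algebraic function: in a
  polynomial relation, stripped of common factors \<open>x - \<rho>\<close>, the highest power of \<open>g\<close> with a coefficient
  not vanishing at \<open>\<rho>\<close> dominates all other terms.
\<close>

section \<open>Series with a logarithmic singularity\<close>

text \<open>The logarithm comes from dividing by the number of rotations. Let \<open>F\<close> count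
  blocks by cost, with \<open>F(\<rho>) = 1\<close>. Linear words have the series
  \<open>1 / (1 - F)\<close>, and weighting each by \<open>1 / length\<close> gives
  \<open>- ln (1 - F)\<close>. Cyclic words deviate from this only at proper powers, of which there
  are \<open>O(n \<rho>^(-n/2))\<close>. The factor \<open>h(w) + 1\<close> is the obstacle:
  \<open>h(w)\<close> can grow linearly with the length, which undoes the division and brings back a
  pole. That part is rational, because averaging additive marks over all rotations is the same as
  marking the first letter; hence the subtraction. The bound on \<open>n g_n \<rho>^n\<close> comes
  from the mean block cost, the divergence from the renewal identity for random blocks drawn with
  probability \<open>\<rho>^cost\<close>. On the group side, normal forms are unique because
  \<open>G\<close> acts on them (van der Waerden's method). The window is an interval because each
  syllable allows one or two consecutive central exponents at minimal cost and integer intervals add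
  up to intervals.\<close>

text \<open>Divide the relation by \<open>G x ^ j\<close>, where \<open>j\<close> is the largest
  index with \<open>poly (q j) \<rho> \<noteq> 0\<close>: lower powers vanish in the limit because
  \<open>G\<close> tends to infinity, higher ones carry a factor \<open>x - \<rho>\<close> that wins
  by \<open>slow\<close>.\<close>

lemma no_polynomial_relation_of_slow_blowup_aux:
  fixes q :: "nat \<Rightarrow> real poly" and G :: "real \<Rightarrow> real"
  assumes G: "filterlim G at_top (at_left \<rho>)"
    and slow: "\<And>k. ((\<lambda>x. (\<rho> - x) * G x ^ k) \<longlongrightarrow> 0) (at_left \<rho>)"
    and rel: "\<And>x. 0 < x \<Longrightarrow> x < \<rho> \<Longrightarrow> (\<Sum>i\<le>d. poly (q i) x * G x ^ i) = 0"
    and "0 < \<rho>" and "r \<le> d" and "poly (q r) \<rho> \<noteq> 0"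
  shows False
proof -
  define j where "j = Max {i. i \<le> d \<and> poly (q i) \<rho> \<noteq> 0}"
  have "j \<in> {i. i \<le> d \<and> poly (q i) \<rho> \<noteq> 0}"
    unfolding j_def by (rule Max_in) (use assms(5,6) in auto)
  then have j: "j \<le> d" "poly (q j) \<rho> \<noteq> 0" by auto
  have j_max: "i \<le> j" if "i \<le> d" "poly (q i) \<rho> \<noteq> 0" for i
    unfolding j_def by (rule Max_ge) (use that in auto)
  have poly_lim: "((\<lambda>x. poly r x) \<longlongrightarrow> poly r \<rho>) (at_left \<rho>)" for r :: "real poly"
    by (intro tendsto_intros)
  have inv_lim: "((\<lambda>x. inverse (G x)) \<longlongrightarrow> 0) (at_left \<rho>)"
    using G by (rule tendsto_inverse_0_at_top)
  have term_lim: "((\<lambda>x. poly (q i) x * G x ^ i * inverse (G x) ^ j) \<longlongrightarrow>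
      (if i = j then poly (q j) \<rho> else 0)) (at_left \<rho>)" if "i \<le> d" for i
  proof -
    have pos: "eventually (\<lambda>x. G x > 0) (at_left \<rho>)"
      using G filterlim_at_top_dense by blast
    consider "i < j" | "i = j" | "i > j" by linarith
    then show ?thesis
    proof cases
      case 1
      have "((\<lambda>x. poly (q i) x * inverse (G x) ^ (j - i)) \<longlongrightarrow> poly (q i) \<rho> * 0 ^ (j - i)) (at_left \<rho>)"
        by (intro tendsto_intros poly_lim inv_lim)
      moreover have "eventually (\<lambda>x. poly (q i) x * inverse (G x) ^ (j - i)
          = poly (q i) x * G x ^ i * inverse (G x) ^ j) (at_left \<rho>)"
        using pos
      proof eventually_elim
        case (elim x)
        have "inverse (G x) ^ j = inverse (G x) ^ i * inverse (G x) ^ (j - i)"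
          using 1 by (simp add: power_add [symmetric])
        then show ?case using elim by (simp add: field_simps)
      qed
      ultimately show ?thesis using 1 by (simp add: power_0_left tendsto_cong)
    next
      case 2
      have "eventually (\<lambda>x. poly (q j) x = poly (q i) x * G x ^ i * inverse (G x) ^ j) (at_left \<rho>)"
        using pos by eventually_elim (simp add: 2 power_inverse)
      with poly_lim[of "q j"] show ?thesis
        unfolding 2 by (auto intro: Lim_transform_eventually)
    next
      case 3
      then have "poly (q i) \<rho> = 0" using j_max[OF that] by force
      then obtain s where s: "q i = [:-\<rho>, 1:] * s"
        by (auto simp: poly_eq_0_iff_dvd elim: dvdE)
      have "((\<lambda>x. - (poly s x * ((\<rho> - x) * G x ^ (i - j)))) \<longlongrightarrow> - (poly s \<rho> * 0)) (at_left \<rho>)"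
        by (intro tendsto_intros poly_lim slow)
      moreover have "eventually (\<lambda>x. - (poly s x * ((\<rho> - x) * G x ^ (i - j)))
          = poly (q i) x * G x ^ i * inverse (G x) ^ j) (at_left \<rho>)"
        using pos
      proof eventually_elim
        case (elim x)
        have 1: "G x ^ i = G x ^ j * G x ^ (i - j)"
          using 3 by (simp add: power_add [symmetric])
        have 2: "poly (q i) x = (x - \<rho>) * poly s x"
          by (simp add: s algebra_simps)
        show ?case unfolding 1 2 using elim by (simp add: field_simps)
      qed
      ultimately show ?thesis using 3 by (simp add: tendsto_cong)
    qed
  qed
  have "((\<lambda>x. \<Sum>i\<le>d. poly (q i) x * G x ^ i * inverse (G x) ^ j) \<longlongrightarrow>
      (\<Sum>i\<le>d. if i = j then poly (q j) \<rho> else 0)) (at_left \<rho>)"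
    by (intro tendsto_sum term_lim) auto
  also have "(\<Sum>i\<le>d. if i = j then poly (q j) \<rho> else 0) = poly (q j) \<rho>"
    using j by simp
  finally have lim: "((\<lambda>x. \<Sum>i\<le>d. poly (q i) x * G x ^ i * inverse (G x) ^ j) \<longlongrightarrow> poly (q j) \<rho>) (at_left \<rho>)" .
  have "eventually (\<lambda>x. x \<in> {0<..<\<rho>}) (at_left \<rho>)"
    using \<open>0 < \<rho>\<close> by (rule eventually_at_left_real)
  then have ev: "eventually (\<lambda>x. (\<Sum>i\<le>d. poly (q i) x * G x ^ i * inverse (G x) ^ j) = 0) (at_left \<rho>)"
    by eventually_elim (use rel in \<open>simp add: sum_distrib_right [symmetric]\<close>)
  have "((\<lambda>x. 0) \<longlongrightarrow> poly (q j) \<rho>) (at_left \<rho>)"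
    by (rule Lim_transform_eventually[OF lim ev])
  then have "poly (q j) \<rho> = 0"
    by (intro tendsto_unique[OF trivial_limit_at_left_real]) auto
  with j show False by simp
qed

text \<open>Dividing all coefficients by \<open>x - \<rho>\<close> keeps the relation for
  \<open>x < \<rho>\<close> and lowers the total degree, so after finitely many divisions some
  coefficient does not vanish at \<open>\<rho>\<close>.\<close>

lemma no_polynomial_relation_of_slow_blowup:
  fixes p :: "nat \<Rightarrow> real poly" and G :: "real \<Rightarrow> real"
  assumes G: "filterlim G at_top (at_left \<rho>)"
    and slow: "\<And>k. ((\<lambda>x. (\<rho> - x) * G x ^ k) \<longlongrightarrow> 0) (at_left \<rho>)"
    and rel: "\<And>x. 0 < x \<Longrightarrow> x < \<rho> \<Longrightarrow> (\<Sum>i\<le>d. poly (p i) x * G x ^ i) = 0"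
    and "0 < \<rho>" and "r \<le> d" and "p r \<noteq> 0"
  shows False
  using rel assms(5,6)
proof (induction "\<Sum>i\<le>d. degree (p i)" arbitrary: p r rule: less_induct)
  case less
  show False
  proof (cases "\<exists>i\<le>d. poly (p i) \<rho> \<noteq> 0")
    case True
    then show False
      using no_polynomial_relation_of_slow_blowup_aux[OF G slow less.prems(1) \<open>0 < \<rho>\<close>] by blast
  next
    case False
    define q where "q i = p i div [:-\<rho>, 1:]" for i
    have q: "p i = [:-\<rho>, 1:] * q i" if "i \<le> d" for i
    proof -
      have "[:-\<rho>, 1:] dvd p i" using False that by (simp add: poly_eq_0_iff_dvd)
      then show ?thesis unfolding q_def by (rule dvd_mult_div_cancel [symmetric])
    qed
    have deg: "degree (p i) = (if p i = 0 then 0 else Suc (degree (q i)))" if "i \<le> d" for i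
    proof (cases "p i = 0")
      case nz: False
      then have "q i \<noteq> 0" using q[OF that] by auto
      then show ?thesis using nz
        by (subst q[OF that], subst degree_mult_eq) auto
    qed simp
    have q0: "q i = 0" if "p i = 0" for i
      using that by (simp add: q_def)
    have "(\<Sum>i\<le>d. degree (q i)) < (\<Sum>i\<le>d. degree (p i))"
    proof (rule sum_strict_mono_ex1)
      show "\<forall>i\<in>{..d}. degree (q i) \<le> degree (p i)"
        using deg q0 by auto
      show "\<exists>i\<in>{..d}. degree (q i) < degree (p i)"
        using deg[of r] less.prems by (intro bexI[of _ r]) auto
    qed simp
    moreover have "(\<Sum>i\<le>d. poly (q i) x * G x ^ i) = 0" if "0 < x" "x < \<rho>" for x
    proof -
      have "0 = (\<Sum>i\<le>d. poly (p i) x * G x ^ i)" using less.prems(1)[OF that] by simp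
      also have "\<dots> = (\<Sum>i\<le>d. (x - \<rho>) * (poly (q i) x * G x ^ i))"
        by (rule sum.cong) (simp_all add: q algebra_simps)
      finally show ?thesis using that by (simp add: sum_distrib_left [symmetric])
    qed
    moreover have "q r \<noteq> 0" using q[OF less.prems(2)] less.prems(3) by auto
    ultimately show False
      using less.hyps[of q r] less.prems(2) by blast
  qed
qed

section \<open>From algebraicity over the rational functions to a relation with polynomial
  coefficients\<close>

abbreviation poly_series :: "rat poly \<Rightarrow> rat fls" where
  "poly_series p \<equiv> fps_to_fls (fps_of_poly p)"

lemma rational_functions_add: "u \<in> rational_functions \<Longrightarrow> v \<in> rational_functions \<Longrightarrow> u + v \<in> rational_functions"
  and rational_functions_mult: "u \<in> rational_functions \<Longrightarrow> v \<in> rational_functions \<Longrightarrow> u * v \<in> rational_functions"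
  and rational_functions_0: "0 \<in> rational_functions"
proof -
  interpret F: field "ring_of_type_algebra :: rat fls ring"
    by (rule field_from_type_algebra)
  have sr: "subring rational_functions (ring_of_type_algebra :: rat fls ring)"
    using subfieldE(1)[OF subfield_rational_functions] .
  show "u \<in> rational_functions \<Longrightarrow> v \<in> rational_functions \<Longrightarrow> u + v \<in> rational_functions"
    using subringE(7)[OF sr, of u v] by (simp add: ring_of_type_algebra_def)
  show "u \<in> rational_functions \<Longrightarrow> v \<in> rational_functions \<Longrightarrow> u * v \<in> rational_functions"
    using subringE(6)[OF sr, of u v] by (simp add: ring_of_type_algebra_def)
  show "0 \<in> rational_functions"
    using subringE(2)[OF sr] by (simp add: ring_of_type_algebra_def)
qed

text \<open>HOL-Algebra represents a polynomial by its coefficient list with the leading coefficient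
  first; \<open>Poly (rev p)\<close> carries it over to the type of polynomials.\<close>

lemma algebraic_over_rational_functionsE:
  fixes x :: "rat fls"
  assumes "\<not> ring.transcendental (ring_of_type_algebra :: rat fls ring) rational_functions x"
  obtains P where "P \<noteq> 0" "poly P x = 0" "\<And>i. coeff P i \<in> rational_functions"
proof -
  let ?L = "ring_of_type_algebra :: rat fls ring"
  interpret F: field ?L by (rule field_from_type_algebra)
  have sr: "subring rational_functions ?L"
    using subfieldE(1)[OF subfield_rational_functions] .
  have pow: "x [^]\<^bsub>?L\<^esub> n = x ^ n" for n :: nat
    by (induction n) (simp_all add: ring_of_type_algebra_def)
  have ev: "F.eval p x = poly (Poly (rev p)) x" for p
  proof (induction p)
    case Nil
    have "F.eval [] x = \<zero>\<^bsub>?L\<^esub>" by simp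
    then show ?case by (simp add: ring_of_type_algebra_def)
  next
    case (Cons a p)
    then show ?case
      using pow[of "length p"]
      by (simp add: Poly_append poly_monom) (simp add: ring_of_type_algebra_def)
  qed
  have "x \<in> carrier ?L" by (simp add: ring_of_type_algebra_def)
  moreover have "(F.algebraic over rational_functions) x"
    using assms by (simp add: over_def)
  ultimately obtain p where p: "p \<in> carrier (rational_functions [X]\<^bsub>?L\<^esub>)" "p \<noteq> []" "F.eval p x = \<zero>\<^bsub>?L\<^esub>"
    by (rule F.algebraicE[OF sr])
  have pK: "set p \<subseteq> rational_functions" and lc: "hd p \<noteq> 0"
    using p(1,2) by (auto simp: univ_poly_def polynomial_def ring_of_type_algebra_def)
  have co: "coeff (Poly (rev p)) i = nth_default 0 (rev p) i" for i by simp
  show ?thesis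
  proof
    show "poly (Poly (rev p)) x = 0"
      using p(3) ev by (simp add: ring_of_type_algebra_def)
    have "nth_default 0 (rev p) (length p - 1) = hd p"
      using p(2) by (simp add: nth_default_def rev_nth hd_conv_nth)
    then show "Poly (rev p) \<noteq> 0" using lc co by (metis coeff_0)
    show "coeff (Poly (rev p)) i \<in> rational_functions" for i
      using pK rational_functions_0 unfolding co nth_default_def
      by (metis nth_mem set_rev subsetD)
  qed
qed

text \<open>Composition with \<open>[:R, 1:]\<close> substitutes \<open>R + X\<close>, so an
  algebraic equation for \<open>R + g\<close> becomes one for \<open>g\<close> over the same
  field.\<close>

lemma coeff_pcompose_in_rational_functions:
  assumes "\<And>i. coeff P i \<in> rational_functions" and "R \<in> rational_functions"
  shows "coeff (pcompose P [:R, 1:]) i \<in> rational_functions"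
  using assms(1)
proof (induction P arbitrary: i)
  case 0
  then show ?case by simp
next
  case (pCons a P)
  have P: "coeff P i \<in> rational_functions" for i
    using pCons.prems[of "Suc i"] by simp
  have a: "a \<in> rational_functions"
    using pCons.prems[of 0] by simp
  have "coeff ([:a:] + [:R, 1:] * Q) i \<in> rational_functions"
    if "\<And>i. coeff Q i \<in> rational_functions" for Q
    using a that assms(2) rational_functions_0
    by (cases i) (auto intro!: rational_functions_add rational_functions_mult)
  then show ?case
    using pCons.IH[OF P] by (simp only: pcompose_pCons)
qed

lemma clear_denominators:
  assumes "\<And>i. coeff P i \<in> rational_functions"
  shows "\<exists>q p. q \<noteq> 0 \<and> (\<forall>i. coeff P i * poly_series q = poly_series (p i))"
  using assms
proof (induction P)
  case 0
  show ?case by (rule exI[of _ 1], rule exI[of _ "\<lambda>_. 0"]) simp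
next
  case (pCons a P)
  have P: "coeff P i \<in> rational_functions" for i
    using pCons.prems[of "Suc i"] by simp
  from pCons.IH[OF P] obtain q p where q: "q \<noteq> 0" and qp: "\<And>i. coeff P i * poly_series q = poly_series (p i)"
    by blast
  obtain r s where a: "a = poly_series r / poly_series s" and s: "s \<noteq> 0"
    using pCons.prems[of 0] by (auto simp: rational_functions_def)
  have mult: "poly_series (u * v) = poly_series u * poly_series v" for u v
    by (simp add: fps_of_poly_mult fls_times_fps_to_fls)
  have "coeff (pCons a P) i * poly_series (q * s) =
      poly_series (case i of 0 \<Rightarrow> r * q | Suc j \<Rightarrow> p j * s)" for i
  proof (cases i)
    case 0
    then show ?thesis using s by (simp add: a mult)
  next
    case (Suc j)
    then show ?thesis by (simp add: mult qp [symmetric] mult_ac)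
  qed
  then show ?case using q s by (intro exI[of _ "q * s"]) auto
qed

section \<open>Power series near the right end of the interval of convergence\<close>

lemma fps_conv_radius_ge_of_bound:
  fixes a :: "nat \<Rightarrow> real"
  assumes "\<And>n. 0 \<le> a n" "\<And>n. a n * \<rho> ^ n \<le> C" "0 < \<rho>"
  shows "fps_conv_radius (Abs_fps a) \<ge> ereal \<rho>"
  unfolding fps_conv_radius_def
proof (rule conv_radius_geI_ex)
  fix r :: real assume r: "0 < r" "ereal r < ereal \<rho>"
  have "summable (\<lambda>n. a n * r ^ n)"
  proof (rule summable_comparison_test_ev)
    show "summable (\<lambda>n. C * (r / \<rho>) ^ n)"
      using r assms(3) by (intro summable_mult summable_geometric) simp
    have "norm (a n * r ^ n) \<le> C * (r / \<rho>) ^ n" for n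
    proof -
      have "a n * r ^ n = (a n * \<rho> ^ n) * (r / \<rho>) ^ n"
        using assms(3) by (simp add: power_divide)
      also have "\<dots> \<le> C * (r / \<rho>) ^ n"
        using r assms by (intro mult_right_mono) auto
      finally show ?thesis using assms(1)[of n] r by simp
    qed
    then show "\<forall>\<^sub>F n in sequentially. norm (a n * r ^ n) \<le> C * (r / \<rho>) ^ n" by simp
  qed
  then show "\<exists>z. norm z = r \<and> summable (\<lambda>n. fps_nth (Abs_fps a) n * z ^ n)"
    using r by (intro exI[of _ r]) simp
qed

definition real_series :: "rat fps \<Rightarrow> real fps" where
  "real_series f = Abs_fps (\<lambda>n. of_rat (fps_nth f n))"

lemma real_series_nth [simp]: "fps_nth (real_series f) n = of_rat (fps_nth f n)"
  by (simp add: real_series_def)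

lemma real_series_0 [simp]: "real_series 0 = 0"
  and real_series_1 [simp]: "real_series 1 = 1"
  and real_series_add: "real_series (f + g) = real_series f + real_series g"
  and real_series_mult: "real_series (f * g) = real_series f * real_series g"
  by (auto simp: fps_eq_iff of_rat_add fps_mult_nth of_rat_sum of_rat_mult)

lemma real_series_power: "real_series (f ^ n) = real_series f ^ n"
  by (induction n) (simp_all add: real_series_mult)

lemma real_series_sum: "real_series (\<Sum>i\<in>I. f i) = (\<Sum>i\<in>I. real_series (f i))"
  by (induction I rule: infinite_finite_induct) (simp_all add: real_series_add)

lemma real_series_fps_of_poly:
  "real_series (fps_of_poly p) = fps_of_poly (map_poly of_rat p)"
  by (simp add: fps_eq_iff coeff_map_poly)

lemma eval_fps_polynomial_relation:
  fixes g :: "real fps" and x :: real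
  assumes "(\<Sum>i\<le>d. fps_of_poly (p i) * g ^ i) = 0" and "ereal (norm x) < fps_conv_radius g"
  shows "(\<Sum>i\<le>d. poly (p i) x * eval_fps g x ^ i) = 0"
proof -
  have pow: "ereal (norm x) < fps_conv_radius (g ^ i)" for i
    using assms(2) fps_conv_radius_power[of g i] by (rule less_le_trans)
  have term_rad: "ereal (norm x) < fps_conv_radius (fps_of_poly (p i) * g ^ i)" for i
    using pow[of i] fps_conv_radius_mult[of "fps_of_poly (p i)" "g ^ i"] by (auto intro: less_le_trans)
  have "ereal (norm x) < fps_conv_radius (\<Sum>i\<in>I. fps_of_poly (p i) * g ^ i) \<and>
      eval_fps (\<Sum>i\<in>I. fps_of_poly (p i) * g ^ i) x = (\<Sum>i\<in>I. poly (p i) x * eval_fps g x ^ i)"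
    if "finite I" for I
    using that
  proof (induction I)
    case empty
    then show ?case by simp
  next
    case (insert i I)
    have "eval_fps (fps_of_poly (p i) * g ^ i) x = poly (p i) x * eval_fps g x ^ i"
      using assms(2) pow[of i] by (subst eval_fps_mult) (simp_all add: eval_fps_power)
    moreover have "ereal (norm x) < fps_conv_radius
        (fps_of_poly (p i) * g ^ i + (\<Sum>i\<in>I. fps_of_poly (p i) * g ^ i))"
      using insert.IH term_rad[of i] by (intro less_le_trans[OF _ fps_conv_radius_add]) auto
    ultimately show ?case
      using insert term_rad[of i] by (simp add: eval_fps_add)
  qed
  from this[of "{..d}"] assms(1) show ?thesis by simp
qed

text \<open>The terms are nonnegative, so \<open>eval_fps\<close> dominates every partial sum. Some
  partial sum exceeds a given \<open>Z\<close> at \<open>\<rho>\<close>, and by continuity also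
  shortly before \<open>\<rho>\<close>.\<close>

lemma power_series_at_top_at_left:
  fixes a :: "nat \<Rightarrow> real"
  assumes nonneg: "\<And>n. 0 \<le> a n" and "0 < \<rho>"
    and rad: "ereal \<rho> \<le> fps_conv_radius (Abs_fps a)"
    and div: "\<not> summable (\<lambda>n. a n * \<rho> ^ n)"
  shows "filterlim (eval_fps (Abs_fps a)) at_top (at_left \<rho>)"
  unfolding filterlim_at_top_dense
proof
  fix Z :: real
  obtain N where N: "Z < (\<Sum>n<N. a n * \<rho> ^ n)"
  proof (rule ccontr)
    assume "\<not> thesis"
    then have "(\<Sum>n<N. a n * \<rho> ^ n) \<le> Z" for N
      using that by (meson not_le)
    then have "summable (\<lambda>n. a n * \<rho> ^ n)"
      using nonneg \<open>0 < \<rho>\<close> by (intro summableI_nonneg_bounded) auto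
    with div show False by simp
  qed
  have "((\<lambda>x. \<Sum>n<N. a n * x ^ n) \<longlongrightarrow> (\<Sum>n<N. a n * \<rho> ^ n)) (at_left \<rho>)"
    by (intro tendsto_intros)
  then have "eventually (\<lambda>x. Z < (\<Sum>n<N. a n * x ^ n)) (at_left \<rho>)"
    using N by (rule order_tendstoD)
  moreover have "eventually (\<lambda>x. x \<in> {0<..<\<rho>}) (at_left \<rho>)"
    using \<open>0 < \<rho>\<close> by (rule eventually_at_left_real)
  ultimately show "eventually (\<lambda>x. Z < eval_fps (Abs_fps a) x) (at_left \<rho>)"
  proof eventually_elim
    case (elim x)
    have "summable (\<lambda>n. a n * x ^ n)"
      using summable_fps[of x "Abs_fps a"] elim(2) rad less_le_trans[of "ereal x" "ereal \<rho>"] by auto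
    then have "(\<Sum>n<N. a n * x ^ n) \<le> (\<Sum>n. a n * x ^ n)"
      using elim(2) nonneg by (intro sum_le_suminf) auto
    then show ?case using elim(1) by (simp add: eval_fps_def)
  qed
qed

text \<open>The bound makes the series at most \<open>a 0 + C * L\<close> with
  \<open>L = - ln (1 - x / \<rho>)\<close>. Since \<open>\<rho> - x = \<rho> * exp (- L)\<close>,
  the factor \<open>\<rho> - x\<close> beats every power of \<open>L\<close>.\<close>

lemma power_series_slow_blowup:
  fixes a :: "nat \<Rightarrow> real"
  assumes nonneg: "\<And>n. 0 \<le> a n" and "0 < \<rho>"
    and rad: "ereal \<rho> \<le> fps_conv_radius (Abs_fps a)"
    and bound: "\<And>n. real n * (a n * \<rho> ^ n) \<le> C"
  shows "((\<lambda>x. (\<rho> - x) * eval_fps (Abs_fps a) x ^ k) \<longlongrightarrow> 0) (at_left \<rho>)"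
proof -
  let ?L = "\<lambda>x. - ln (1 - x / \<rho>)"
  have "C \<ge> 0" using bound[of 0] by simp
  have at0: "eventually (\<lambda>x. x \<in> {0<..<\<rho>}) (at_left \<rho>)"
    using \<open>0 < \<rho>\<close> by (rule eventually_at_left_real)
  have le: "0 \<le> eval_fps (Abs_fps a) x \<and> eval_fps (Abs_fps a) x \<le> a 0 + C * ?L x"
    if x: "0 < x" "x < \<rho>" for x
  proof -
    have S: "summable (\<lambda>n. a n * x ^ n)"
      using summable_fps[of x "Abs_fps a"] x rad less_le_trans[of "ereal x" "ereal \<rho>"] by auto
    have "(\<lambda>n. - ((- (- x / \<rho>)) ^ n) / of_nat n) sums ln (1 + (- x / \<rho>))"
      using x by (intro ln_series') simp
    then have "(\<lambda>n. C * ((x / \<rho>) ^ n / real n)) sums (C * ?L x)"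
      by (intro sums_mult) (auto dest: sums_minus)
    \<comment> \<open>The logarithmic series has the term \<open>1 / 0 = 0\<close> at index 0, so
      \<open>a 0\<close> is added separately.\<close>
    then have T: "(\<lambda>n. (if n = 0 then a 0 else 0) + C * ((x / \<rho>) ^ n / real n)) sums (a 0 + C * ?L x)"
      by (intro sums_add sums_single[of 0 "\<lambda>_. a 0"])
    have le_n: "a n * x ^ n \<le> (if n = 0 then a 0 else 0) + C * ((x / \<rho>) ^ n / real n)" for n
    proof (cases "n = 0")
      case False
      have "a n * x ^ n = real n * (a n * \<rho> ^ n) * ((x / \<rho>) ^ n / real n)"
        using False \<open>0 < \<rho>\<close> by (simp add: power_divide)
      also have "\<dots> \<le> C * ((x / \<rho>) ^ n / real n)"
        using bound[of n] x by (intro mult_right_mono) auto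
      finally show ?thesis using False by simp
    qed simp
    have "(\<Sum>n. a n * x ^ n) \<le> a 0 + C * ?L x"
      by (rule sums_le[OF le_n summable_sums[OF S] T])
    moreover have "0 \<le> (\<Sum>n. a n * x ^ n)"
      using S nonneg x by (intro suminf_nonneg) auto
    ultimately show ?thesis by (simp add: eval_fps_def)
  qed
  have "((\<lambda>x. 1 - x / \<rho>) \<longlongrightarrow> 1 - \<rho> / \<rho>) (at_left \<rho>)"
    using \<open>0 < \<rho>\<close> by (intro tendsto_intros) auto
  then have "filterlim (\<lambda>x. 1 - x / \<rho>) (at_right 0) (at_left \<rho>)"
    using \<open>0 < \<rho>\<close> unfolding filterlim_at
    by (auto intro!: eventually_mono[OF at0])
  then have Ltop: "filterlim ?L at_top (at_left \<rho>)"
    unfolding filterlim_uminus_at_top by (simp add: filterlim_compose[OF ln_at_0])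
  have "((\<lambda>x. \<rho> * (a 0 + C) ^ k * (?L x ^ k / exp (?L x))) \<longlongrightarrow> \<rho> * (a 0 + C) ^ k * 0) (at_left \<rho>)"
    by (intro tendsto_mult tendsto_const filterlim_compose[OF tendsto_power_div_exp_0 Ltop])
  then have upper: "((\<lambda>x. \<rho> * (a 0 + C) ^ k * (?L x ^ k / exp (?L x))) \<longlongrightarrow> 0) (at_left \<rho>)"
    by simp
  have ev1: "eventually (\<lambda>x. 1 \<le> ?L x) (at_left \<rho>)"
    using Ltop unfolding filterlim_at_top by blast
  show ?thesis
  proof (rule tendsto_sandwich[OF _ _ tendsto_const upper])
    show "eventually (\<lambda>x. 0 \<le> (\<rho> - x) * eval_fps (Abs_fps a) x ^ k) (at_left \<rho>)"
      using at0 by eventually_elim (use le in auto)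
    show "eventually (\<lambda>x. (\<rho> - x) * eval_fps (Abs_fps a) x ^ k
        \<le> \<rho> * (a 0 + C) ^ k * (?L x ^ k / exp (?L x))) (at_left \<rho>)"
      using at0 ev1
    proof eventually_elim
      case (elim x)
      have x: "0 < x" "x < \<rho>" using elim by auto
      have "a 0 * 1 \<le> a 0 * ?L x"
        using elim(2) nonneg by (intro mult_left_mono) auto
      then have "eval_fps (Abs_fps a) x \<le> (a 0 + C) * ?L x"
        using le[OF x] by (simp add: algebra_simps)
      then have "eval_fps (Abs_fps a) x ^ k \<le> ((a 0 + C) * ?L x) ^ k"
        using le[OF x] by (intro power_mono) auto
      then have "(\<rho> - x) * eval_fps (Abs_fps a) x ^ k \<le> (\<rho> - x) * ((a 0 + C) * ?L x) ^ k"
        using x by (intro mult_left_mono) auto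
      also have "\<dots> = \<rho> * (1 / exp (?L x)) * ((a 0 + C) * ?L x) ^ k"
        using x by (simp add: exp_minus field_simps)
      also have "\<dots> = \<rho> * (a 0 + C) ^ k * (?L x ^ k / exp (?L x))"
        by (simp only: power_mult_distrib) simp
      finally show ?case .
    qed
  qed
qed

theorem transcendental_series_rational_plus_logarithmic:
  fixes f g :: "rat fps" and \<rho> :: real
  assumes f: "fps_to_fls f = R + fps_to_fls g" and R: "R \<in> rational_functions"
    and "0 < \<rho>" and nonneg: "\<And>n. 0 \<le> fps_nth g n"
    and bound: "\<And>n. real n * (of_rat (fps_nth g n) * \<rho> ^ n) \<le> C"
    and div: "\<not> summable (\<lambda>n. of_rat (fps_nth g n) * \<rho> ^ n)"
  shows "transcendental_series f"
proof (rule ccontr)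
  define a :: "nat \<Rightarrow> real" where "a n = of_rat (fps_nth g n)" for n
  have a: "0 \<le> a n" for n using nonneg by (simp add: a_def)
  have rg: "real_series g = Abs_fps a" by (simp add: fps_eq_iff a_def)
  have "C \<ge> 0" using bound[of 0] by simp
  have "a n * \<rho> ^ n \<le> max (a 0) C" for n
  proof (cases "n = 0")
    case False
    then have "1 * (a n * \<rho> ^ n) \<le> real n * (a n * \<rho> ^ n)"
      using a \<open>0 < \<rho>\<close> by (intro mult_right_mono) auto
    then show ?thesis using bound[of n] by (simp add: a_def)
  qed simp
  then have rad: "ereal \<rho> \<le> fps_conv_radius (Abs_fps a)"
    using a \<open>0 < \<rho>\<close> by (intro fps_conv_radius_ge_of_bound) auto
  assume "\<not> transcendental_series f"
  then obtain P where P: "P \<noteq> 0" "poly P (fps_to_fls f) = 0" "\<And>i. coeff P i \<in> rational_functions"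
    unfolding transcendental_series_def by (elim algebraic_over_rational_functionsE) blast
  define Q where "Q = pcompose P [:R, 1:]"
  have "Q \<noteq> 0"
    using P(1) by (simp add: Q_def pcompose_eq_0_iff)
  moreover have Q0: "poly Q (fps_to_fls g) = 0"
    using P(2) f by (simp add: Q_def poly_pcompose)
  moreover have "coeff Q i \<in> rational_functions" for i
    unfolding Q_def by (rule coeff_pcompose_in_rational_functions[OF P(3) R])
  ultimately obtain q p where q: "q \<noteq> 0" and qp: "\<And>i. coeff Q i * poly_series q = poly_series (p i)"
    using clear_denominators[of Q] by blast
  let ?d = "degree Q"
  have "0 = (\<Sum>i\<le>?d. coeff Q i * fps_to_fls g ^ i) * poly_series q"
    using Q0 by (simp add: poly_altdef)
  also have "\<dots> = (\<Sum>i\<le>?d. poly_series (p i) * fps_to_fls (g ^ i))"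
    unfolding sum_distrib_right
    by (intro sum.cong) (simp_all add: qp [symmetric] fps_to_fls_power mult_ac)
  also have "\<dots> = fps_to_fls (\<Sum>i\<le>?d. fps_of_poly (p i) * g ^ i)"
  proof -
    have "fps_to_fls (\<Sum>i\<in>I. h i) = (\<Sum>i\<in>I. fps_to_fls (h i))" for I and h :: "nat \<Rightarrow> rat fps"
      by (induction I rule: infinite_finite_induct) simp_all
    then show ?thesis by (simp add: fls_times_fps_to_fls)
  qed
  finally have "(\<Sum>i\<le>?d. fps_of_poly (p i) * g ^ i) = 0" by simp
  then have "real_series (\<Sum>i\<le>?d. fps_of_poly (p i) * g ^ i) = 0" by simp
  then have rel: "(\<Sum>i\<le>?d. fps_of_poly (map_poly of_rat (p i)) * Abs_fps a ^ i) = 0"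
    by (simp add: real_series_sum real_series_mult real_series_power real_series_fps_of_poly rg)
  have "poly_series (p ?d) \<noteq> 0"
    using \<open>Q \<noteq> 0\<close> q by (simp add: qp [symmetric])
  then have "map_poly of_rat (p ?d) \<noteq> (0 :: real poly)"
    by (auto simp: poly_eq_iff coeff_map_poly)
  moreover have "(\<Sum>i\<le>?d. poly (map_poly of_rat (p i)) x * eval_fps (Abs_fps a) x ^ i) = 0"
    if "0 < x" "x < \<rho>" for x
    using that rad less_le_trans[of "ereal x" "ereal \<rho>"]
    by (intro eval_fps_polynomial_relation[OF rel]) simp
  moreover have "filterlim (eval_fps (Abs_fps a)) at_top (at_left \<rho>)"
    using a \<open>0 < \<rho>\<close> rad div by (intro power_series_at_top_at_left) (simp_all add: a_def)
  moreover have "((\<lambda>x. (\<rho> - x) * eval_fps (Abs_fps a) x ^ k) \<longlongrightarrow> 0) (at_left \<rho>)" for k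
    using a \<open>0 < \<rho>\<close> rad bound by (intro power_series_slow_blowup[where C = C]) (simp_all add: a_def)
  ultimately show False
    using no_polynomial_relation_of_slow_blowup
      [where G = "eval_fps (Abs_fps a)" and p = "\<lambda>i. map_poly of_rat (p i)" and d = ?d and r = ?d]
      \<open>0 < \<rho>\<close> by blast
qed

section \<open>Counting cyclic words\<close>

lemma rational_functions_inverse:
  assumes "v \<in> rational_functions"
  shows "inverse v \<in> rational_functions"
proof (cases "v = 0")
  case True
  then show ?thesis using rational_functions_0 by simp
next
  case False
  obtain p q where v: "v = poly_series p / poly_series q" "q \<noteq> 0"
    using assms by (auto simp: rational_functions_def)
  then have "p \<noteq> 0" "inverse v = poly_series q / poly_series p"
    using False by auto
  then show ?thesis by (auto simp: rational_functions_def)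
qed

text \<open>Induct on \<open>k\<close>, splitting \<open>x = sqrt x * sqrt x\<close>: one factor
  \<open>sqrt x ^ n\<close> absorbs a single \<open>n\<close>, the other one the remaining
  \<open>n ^ k\<close>.\<close>

lemma bounded_power_times_geometric:
  fixes x :: real
  assumes "0 \<le> x" "x < 1"
  obtains B where "0 \<le> B" "\<And>n. real n ^ k * x ^ n \<le> B"
proof -
  have "\<exists>B\<ge>0. \<forall>n. real n ^ k * x ^ n \<le> B"
    using assms
  proof (induction k arbitrary: x)
    case 0
    then show ?case by (intro exI[of _ 1]) (auto simp: power_le_one)
  next
    case (Suc k)
    define y where "y = sqrt x"
    have y: "0 \<le> y" "y < 1" "x = y * y"
      using Suc.prems by (auto simp: y_def)
    obtain B where B: "0 \<le> B" "\<And>n. real n ^ k * y ^ n \<le> B"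
      using Suc.IH[OF y(1,2)] by blast
    have "(\<lambda>n. real n * y ^ n) \<longlonglongrightarrow> 0"
      using y powser_times_n_limit_0[of y] by simp
    then have "Bseq (\<lambda>n. real n * y ^ n)"
      by (intro convergent_imp_Bseq convergentI)
    then obtain B' where B': "B' > 0" "\<And>n. norm (real n * y ^ n) \<le> B'"
      by (auto elim: BseqE)
    have "real n ^ Suc k * x ^ n \<le> B' * B" for n
    proof -
      have "real n ^ Suc k * x ^ n = (real n * y ^ n) * (real n ^ k * y ^ n)"
        by (simp add: y(3) power_mult_distrib)
      also have "\<dots> \<le> B' * B"
        using B(2)[of n] B'(2)[of n] B'(1) y by (intro mult_mono) auto
      finally show ?thesis .
    qed
    then show ?case using B B' by (intro exI[of _ "B' * B"]) auto
  qed
  with that show ?thesis by blast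
qed

definition rotations :: "'a list \<Rightarrow> 'a list set" where
  "rotations w = range (\<lambda>i. rotate i w)"

lemma rotations_eq: "w \<noteq> [] \<Longrightarrow> rotations w = (\<lambda>i. rotate i w) ` {..<length w}"
  unfolding rotations_def
  by (auto simp: image_iff) (metis rotate_conv_mod lessThan_iff length_greater_0_conv mod_less_divisor)

lemma finite_rotations [simp]: "finite (rotations w)"
  by (cases "w = []") (simp_all add: rotations_eq, simp add: rotations_def)

lemma self_in_rotations [simp]: "w \<in> rotations w"
  unfolding rotations_def by (metis rangeI rotate0 id_apply)

lemma card_rotations_pos: "0 < card (rotations w)"
  using self_in_rotations[of w] by (auto simp add: card_gt_0_iff simp del: self_in_rotations)

lemma card_rotations_le: "w \<noteq> [] \<Longrightarrow> card (rotations w) \<le> length w"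
  using card_image_le[of "{..<length w}"] by (simp add: rotations_eq)

text \<open>If a rotation fixes \<open>w\<close>, the two pieces of \<open>w\<close> commute, and
  commuting words are powers of one word.\<close>

lemma rotate_eq_imp_power:
  assumes "rotate d w = w" "0 < d" "d < length w"
  obtains r u where "2 \<le> r" "w = concat (replicate r u)"
proof -
  have "take d w @ drop d w = drop d w @ take d w"
    using assms by (simp add: rotate_drop_take)
  from comm_append_are_replicate[OF this]
  obtain m n zs where mn: "concat (replicate m zs) = take d w" "concat (replicate n zs) = drop d w"
    by blast
  have "m \<noteq> 0" "n \<noteq> 0"
    using mn assms by (auto intro!: gr0I)
  moreover have "w = concat (replicate (m + n) zs)"
    using mn by (simp add: replicate_add)
  ultimately show ?thesis
    using that[of "m + n" zs] by linarith
qed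

text \<open>Too few rotations force two equal ones, by \<open>i < j\<close>; undoing the first
  leaves a nontrivial rotation by \<open>j - i\<close> that fixes \<open>w\<close>.\<close>

lemma card_rotations_less_imp_power:
  assumes "w \<noteq> []" "card (rotations w) \<noteq> length w"
  obtains r u where "2 \<le> r" "w = concat (replicate r u)"
proof -
  have "\<not> inj_on (\<lambda>i. rotate i w) {..<length w}"
    using assms card_image[of "\<lambda>i. rotate i w" "{..<length w}"] by (auto simp: rotations_eq)
  then obtain i j where ij: "i < j" "j < length w" "rotate i w = rotate j w"
    unfolding inj_on_def by (metis lessThan_iff linorder_neqE_nat)
  have "rotate i w = rotate i (rotate (j - i) w)"
    using ij by (simp add: rotate_rotate)
  moreover have "inj (rotate i :: 'a list \<Rightarrow> 'a list)"
    unfolding rotate_def by (intro inj_fn inj_rotate1)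
  ultimately have "rotate (j - i) w = w"
    by (simp add: inj_eq)
  with ij that show ?thesis
    by (metis rotate_eq_imp_power zero_less_diff less_imp_diff_less)
qed

section \<open>Words over an alphabet with costs\<close>

locale weighted_alphabet =
  fixes A :: "'a set" and cost :: "'a \<Rightarrow> nat"
  assumes cost_pos: "a \<in> A \<Longrightarrow> 0 < cost a"
    and finite_cost: "finite {a \<in> A. cost a = j}"
begin

definition word_cost :: "'a list \<Rightarrow> nat" where
  "word_cost w = sum_list (map cost w)"

definition words :: "nat \<Rightarrow> 'a list set" where
  "words n = {w \<in> lists A. word_cost w = n}"

definition num_letters :: "nat \<Rightarrow> nat" where
  "num_letters j = card {a \<in> A. cost a = j}"

definition num_words :: "nat \<Rightarrow> nat" where
  "num_words n = card (words n)"

lemma word_cost_simps [simp]: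
  "word_cost [] = 0" "word_cost (a # w) = cost a + word_cost w"
  "word_cost (u @ v) = word_cost u + word_cost v"
  by (simp_all add: word_cost_def)

lemma word_cost_rotate [simp]: "word_cost (rotate i w) = word_cost w"
proof (induction i)
  case (Suc i)
  have "word_cost (rotate1 v) = word_cost v" for v by (cases v) simp_all
  with Suc show ?case by simp
qed simp

lemma word_cost_power: "word_cost (concat (replicate r u)) = r * word_cost u"
  by (induction r) simp_all

lemma length_le_word_cost: "w \<in> lists A \<Longrightarrow> length w \<le> word_cost w"
proof (induction w)
  case (Cons a w)
  then show ?case using cost_pos[of a] by simp
qed simp

lemma finite_words [simp]: "finite (words n)"
proof (rule finite_subset)
  let ?B = "\<Union>j\<le>n. {a \<in> A. cost a = j}"
  have "set w \<subseteq> ?B" if "w \<in> words n" for w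
  proof
    fix a assume "a \<in> set w"
    then have "cost a \<le> word_cost w" unfolding word_cost_def
      by (intro member_le_sum_list) auto
    with \<open>a \<in> set w\<close> that show "a \<in> ?B" by (auto simp: words_def)
  qed
  then show "words n \<subseteq> {w. set w \<subseteq> ?B \<and> length w \<le> n}"
    using length_le_word_cost by (auto simp: words_def)
  show "finite {w. set w \<subseteq> ?B \<and> length w \<le> n}"
    using finite_cost by (intro finite_lists_length_le) auto
qed

lemma words_0: "words 0 = {[]}"
proof -
  have "w = []" if "w \<in> words 0" for w
    using that length_le_word_cost[of w] by (auto simp: words_def)
  then show ?thesis by (auto simp: words_def)
qed

lemma num_words_0 [simp]: "num_words 0 = 1"
  by (simp add: num_words_def words_0)

lemma num_letters_0 [simp]: "num_letters 0 = 0"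
proof -
  have "{a \<in> A. cost a = 0} = {}" using cost_pos by fastforce
  then show ?thesis unfolding num_letters_def by (simp only: card.empty)
qed

text \<open>Splitting off the first letter turns the sum into a coefficient of a product of two
  series; \<open>\<phi>\<close> will be constant, the cost, or the number of marks of a
  letter.\<close>

lemma sum_over_first_letter:
  fixes \<phi> :: "'a \<Rightarrow> real"
  assumes "0 < n"
  shows "(\<Sum>w\<in>words n. \<phi> (hd w)) = (\<Sum>j\<le>n. (\<Sum>a | a \<in> A \<and> cost a = j. \<phi> a) * num_words (n - j))"
proof -
  let ?L = "\<lambda>j. {a \<in> A. cost a = j}"
  have "(\<Sum>w\<in>words n. \<phi> (hd w)) =
      (\<Sum>p\<in>Sigma {..n} (\<lambda>j. ?L j \<times> words (n - j)). \<phi> (fst (snd p)))"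
  proof (rule sum.reindex_bij_witness
      [where i = "\<lambda>p. fst (snd p) # snd (snd p)" and j = "\<lambda>w. (cost (hd w), hd w, tl w)"])
    fix w assume w: "w \<in> words n"
    with assms obtain a v where "w = a # v" by (cases w) (auto simp: words_def)
    with w show "fst (snd (cost (hd w), hd w, tl w)) # snd (snd (cost (hd w), hd w, tl w)) = w"
      "(cost (hd w), hd w, tl w) \<in> Sigma {..n} (\<lambda>j. ?L j \<times> words (n - j))"
      by (auto simp: words_def)
  qed (auto simp: words_def)
  also have "\<dots> = (\<Sum>j\<le>n. \<Sum>p\<in>?L j \<times> words (n - j). \<phi> (fst p))"
    by (subst sum.Sigma) (auto simp: finite_cost split_def intro!: sum.cong)
  also have "\<dots> = (\<Sum>j\<le>n. (\<Sum>a\<in>?L j. \<phi> a) * num_words (n - j))"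
  proof -
    have "(\<Sum>p\<in>P \<times> Q. \<phi> (fst p)) = (\<Sum>a\<in>P. \<phi> a) * card Q" for P and Q :: "'a list set"
      by (simp add: sum.cartesian_product' sum_distrib_right mult.commute)
    then show ?thesis by (simp add: num_words_def)
  qed
  finally show ?thesis .
qed

lemma num_words_rec:
  assumes "0 < n"
  shows "real (num_words n) = (\<Sum>j\<le>n. num_letters j * num_words (n - j))"
  using sum_over_first_letter[OF assms, of "\<lambda>_. 1"] by (simp add: num_letters_def num_words_def)

lemma bij_betw_rotate_words: "bij_betw (rotate i) (words n) (words n)"
proof -
  have "inj (rotate i :: 'a list \<Rightarrow> 'a list)"
    unfolding rotate_def by (intro inj_fn inj_rotate1)
  then have inj: "inj_on (rotate i) (words n)" by (rule inj_on_subset) simp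
  have "rotate i ` words n \<subseteq> words n"
    by (auto simp: words_def)
  then show ?thesis
    using inj endo_inj_surj[OF finite_words] by (simp add: bij_betw_def)
qed

text \<open>Rotating a word uniformly at random does not change the distribution of its first letter.\<close>

lemma sum_mean_over_letters:
  fixes \<phi> :: "'a \<Rightarrow> real"
  assumes "0 < n"
  shows "(\<Sum>w\<in>words n. sum_list (map \<phi> w) / length w) = (\<Sum>w\<in>words n. \<phi> (hd w))"
proof -
  have len: "0 < length w \<and> length w \<le> n" if "w \<in> words n" for w
    using that assms length_le_word_cost[of w] by (auto simp: words_def)
  \<comment> \<open>Words of cost \<open>n\<close> have different lengths, all at most
    \<open>n\<close>. Padding with zeros up to \<open>n\<close> makes the sum over positions
    interchangeable with the sum over words.\<close>
  have restrict: "(\<Sum>i<n. if i < length w then \<psi> i else 0) = (\<Sum>i<length w. \<psi> i)"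
    if "w \<in> words n" for w and \<psi> :: "nat \<Rightarrow> real"
  proof -
    have "{..<n} \<inter> {i. i < length w} = {..<length w}"
      using len[OF that] by auto
    then show ?thesis by (simp add: sum.If_cases)
  qed
  have "(\<Sum>w\<in>words n. sum_list (map \<phi> w) / length w) =
      (\<Sum>w\<in>words n. \<Sum>i<n. if i < length w then \<phi> (w ! i) / length w else 0)"
    by (intro sum.cong)
      (simp_all add: restrict sum_list_sum_nth atLeast0LessThan sum_divide_distrib)
  also have "\<dots> = (\<Sum>i<n. \<Sum>w\<in>words n. if i < length w then \<phi> (hd (rotate i w)) / length (rotate i w) else 0)"
  proof (subst sum.swap, intro sum.cong HOL.refl)
    fix i and w :: "'a list"
    have "hd (rotate i w) = w ! i" if "i < length w"
      using that by (subst hd_rotate_conv_nth) auto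
    then show "(if i < length w then \<phi> (w ! i) / length w else 0) =
        (if i < length w then \<phi> (hd (rotate i w)) / length (rotate i w) else 0)"
      by simp
  qed
  also have "\<dots> = (\<Sum>i<n. \<Sum>w\<in>words n. if i < length w then \<phi> (hd w) / length w else 0)"
  proof (rule sum.cong)
    fix i
    show "(\<Sum>w\<in>words n. if i < length w then \<phi> (hd (rotate i w)) / length (rotate i w) else 0) =
        (\<Sum>w\<in>words n. if i < length w then \<phi> (hd w) / length w else 0)"
      using sum.reindex_bij_betw[OF bij_betw_rotate_words[of i n],
          of "\<lambda>w. if i < length w then \<phi> (hd w) / length w else 0"] by simp
  qed simp
  also have "\<dots> = (\<Sum>w\<in>words n. \<phi> (hd w))"
  proof (subst sum.swap, rule sum.cong)
    fix w assume "w \<in> words n"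
    then show "(\<Sum>i<n. if i < length w then \<phi> (hd w) / length w else 0) = \<phi> (hd w)"
      using len[of w] by (subst restrict) auto
  qed simp
  finally show ?thesis .
qed

text \<open>These words are proper powers, and they are the only nonempty words for which the
  weights \<open>1 / length w\<close> and \<open>1 / card (rotations w)\<close> differ.\<close>

definition num_powers :: "nat \<Rightarrow> nat" where
  "num_powers n = card {w \<in> words n - {[]}. card (rotations w) \<noteq> length w}"

lemma num_powers_le:
  assumes "0 < n"
  shows "num_powers n \<le> (\<Sum>r = 2..n. num_words (n div r))"
proof -
  have "{w \<in> words n - {[]}. card (rotations w) \<noteq> length w} \<subseteq>
      (\<Union>r\<in>{2..n}. (\<lambda>u. concat (replicate r u)) ` words (n div r))"
  proof
    fix w assume w: "w \<in> {w \<in> words n - {[]}. card (rotations w) \<noteq> length w}"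
    then have "w \<noteq> []" by simp
    then obtain r u where r: "2 \<le> r" and ru: "w = concat (replicate r u)"
      using card_rotations_less_imp_power w by blast
    have n: "n = r * word_cost u"
      using w word_cost_power ru by (auto simp: words_def)
    moreover have "set u \<subseteq> set w" using r by (auto simp: ru)
    ultimately have "u \<in> words (n div r)"
      using w r by (auto simp: words_def)
    moreover have "r \<le> n" using n assms by (cases "word_cost u") auto
    ultimately show "w \<in> (\<Union>r\<in>{2..n}. (\<lambda>u. concat (replicate r u)) ` words (n div r))"
      using r ru by auto
  qed
  then have "num_powers n \<le> card (\<Union>r\<in>{2..n}. (\<lambda>u. concat (replicate r u)) ` words (n div r))"
    unfolding num_powers_def by (intro card_mono) auto
  also have "\<dots> \<le> (\<Sum>r = 2..n. card ((\<lambda>u. concat (replicate r u)) ` words (n div r)))"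
    by (rule card_UN_le) simp
  also have "\<dots> \<le> (\<Sum>r = 2..n. num_words (n div r))"
    unfolding num_words_def by (intro sum_mono card_image_le) simp
  finally show ?thesis .
qed

end

section \<open>Renewal theory for the letter costs\<close>

text \<open>At \<open>\<rho>\<close> the letter series takes the value 1, so
  \<open>num_letters j * \<rho> ^ j\<close> is a probability distribution on costs, with mean
  \<open>\<mu>\<close>.\<close>

locale critical_alphabet = weighted_alphabet +
  fixes \<rho> \<mu> :: real
  assumes rho: "0 < \<rho>" "\<rho> < 1"
    and prob: "(\<lambda>j. num_letters j * \<rho> ^ j) sums 1"
    and mean: "(\<lambda>j. j * (num_letters j * \<rho> ^ j)) sums \<mu>"
begin

definition letter_prob :: "nat \<Rightarrow> real" where "letter_prob j = num_letters j * \<rho> ^ j"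
text \<open>The probability that the partial sums of independent random costs hit
  \<open>n\<close>.\<close>

definition word_prob :: "nat \<Rightarrow> real" where "word_prob n = num_words n * \<rho> ^ n"

lemma letter_prob_nonneg: "0 \<le> letter_prob j" and word_prob_nonneg: "0 \<le> word_prob n"
  using rho by (simp_all add: letter_prob_def word_prob_def)

lemma letter_prob_0 [simp]: "letter_prob 0 = 0" and word_prob_0 [simp]: "word_prob 0 = 1"
  by (simp_all add: letter_prob_def word_prob_def)

lemma letter_prob_sums: "letter_prob sums 1" and mean_sums: "(\<lambda>j. j * letter_prob j) sums \<mu>"
  using prob mean by (simp_all add: letter_prob_def [abs_def])

lemma word_prob_rec:
  assumes "0 < n"
  shows "word_prob n = (\<Sum>j\<le>n. letter_prob j * word_prob (n - j))"
proof -
  have "num_letters j * num_words (n - j) * \<rho> ^ n = letter_prob j * word_prob (n - j)" if "j \<le> n" for j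
  proof -
    have "\<rho> ^ n = \<rho> ^ j * \<rho> ^ (n - j)" using that by (simp add: power_add [symmetric])
    then show ?thesis by (simp add: letter_prob_def word_prob_def)
  qed
  then show ?thesis
    unfolding word_prob_def [of n] num_words_rec[OF assms] by (simp add: sum_distrib_right)
qed

definition tail :: "nat \<Rightarrow> real" where "tail n = 1 - (\<Sum>j\<le>n. letter_prob j)"

lemma tail_nonneg: "0 \<le> tail n"
  using sum_le_suminf[of letter_prob "{..n}"] letter_prob_sums letter_prob_nonneg by (simp add: tail_def sums_iff)

text \<open>\<open>tail k\<close> is the probability of a cost above \<open>k\<close>. The summands
  are the probabilities that the last partial sum not exceeding \<open>n\<close> is
  \<open>i\<close>, so they add up to 1.\<close>

lemma renewal_identity: "(\<Sum>i\<le>n. word_prob i * tail (n - i)) = 1"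
proof (induction n)
  case 0
  then show ?case by (simp add: tail_def)
next
  case (Suc n)
  have "(\<Sum>i\<le>Suc n. word_prob i * tail (Suc n - i)) = (\<Sum>i\<le>n. word_prob i * tail (Suc (n - i))) + word_prob (Suc n)"
    by (simp add: tail_def Suc_diff_le)
  also have "(\<Sum>i\<le>n. word_prob i * tail (Suc (n - i))) = (\<Sum>i\<le>n. word_prob i * tail (n - i)) - (\<Sum>i\<le>n. word_prob i * letter_prob (Suc n - i))"
    by (simp add: tail_def algebra_simps sum_subtractf [symmetric] sum.distrib [symmetric] Suc_diff_le)
  also have "(\<Sum>i\<le>n. word_prob i * letter_prob (Suc n - i)) = (\<Sum>i\<le>Suc n. word_prob i * letter_prob (Suc n - i))"
    by simp
  also have "\<dots> = (\<Sum>j\<le>Suc n. letter_prob j * word_prob (Suc n - j))"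
    by (rule sum.reindex_bij_witness[where i = "\<lambda>j. Suc n - j" and j = "\<lambda>j. Suc n - j"]) auto
  also have "\<dots> = word_prob (Suc n)"
    by (rule word_prob_rec [symmetric]) simp
  finally show ?case using Suc by simp
qed

lemma word_prob_le_1: "word_prob n \<le> 1"
proof -
  have "word_prob n * tail (n - n) \<le> (\<Sum>i\<le>n. word_prob i * tail (n - i))"
    by (rule member_le_sum) (auto simp: word_prob_nonneg tail_nonneg)
  then show ?thesis using renewal_identity[of n] by (simp add: tail_def)
qed

text \<open>The usual formula for a mean: a cost \<open>j\<close> is counted in
  \<open>tail i\<close> for every \<open>i < j\<close>.\<close>

lemma sum_tail_le: "(\<Sum>i\<le>n. tail i) \<le> \<mu>"
proof -
  have tail_sums: "(\<lambda>j. if i < j then letter_prob j else 0) sums tail i" for i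
  proof -
    have "(\<lambda>j. letter_prob j - (if j \<in> {..i} then letter_prob j else 0)) sums (1 - (\<Sum>j\<le>i. letter_prob j))"
      by (intro sums_diff letter_prob_sums sums_If_finite_set) simp
    moreover have "(\<lambda>j. letter_prob j - (if j \<in> {..i} then letter_prob j else 0)) = (\<lambda>j. if i < j then letter_prob j else 0)"
      by auto
    ultimately show ?thesis by (simp add: tail_def)
  qed
  have total: "(\<lambda>j. \<Sum>i\<le>n. if i < j then letter_prob j else 0) sums (\<Sum>i\<le>n. tail i)"
    by (intro sums_sum tail_sums)
  have le: "(\<Sum>i\<le>n. if i < j then letter_prob j else 0) \<le> j * letter_prob j" for j
  proof -
    have "(\<Sum>i\<le>n. if i < j then letter_prob j else 0) = card ({..n} \<inter> {i. i < j}) * letter_prob j"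
      by (simp add: sum.If_cases)
    also have "card ({..n} \<inter> {i. i < j}) \<le> card {..<j}"
      by (intro card_mono) auto
    then have "card ({..n} \<inter> {i. i < j}) * letter_prob j \<le> j * letter_prob j"
      using letter_prob_nonneg[of j] by (intro mult_right_mono) auto
    finally show ?thesis .
  qed
  show ?thesis
    by (rule sums_le[OF le total mean_sums])
qed

lemma mean_nonneg: "0 \<le> \<mu>"
  using sum_tail_le[of 0] tail_nonneg[of 0] by simp

text \<open>Divide the renewal identity by \<open>n\<close> and use \<open>1 / n \<le> 1 / i\<close>
  in the terms with \<open>1 \<le> i \<le> n\<close>. Convolution with \<open>tail\<close>
  multiplies a sum by at most \<open>\<mu>\<close>, so a finite sum \<open>U\<close> would bound the
  harmonic sums by \<open>\<mu> + U * \<mu>\<close>; the first \<open>\<mu>\<close> comes from the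
  term \<open>i = 0\<close>.\<close>

lemma not_summable_word_prob_over_n: "\<not> summable (\<lambda>n. word_prob n / n)"
proof
  assume S: "summable (\<lambda>n. word_prob n / n)"
  define U where "U = (\<Sum>n. word_prob n / n)"
  have U: "(\<Sum>i = 1..n. word_prob i / i) \<le> U" for n
    unfolding U_def using S by (intro sum_le_suminf) (auto simp: word_prob_nonneg)
  have "summable (\<lambda>n. inverse (real n))"
  proof (rule summableI_nonneg_bounded)
    fix N :: nat
    have "(\<Sum>n<N. inverse (real n)) \<le> (\<Sum>n = 1..N. inverse (real n))"
    proof -
      have "(\<Sum>n<N. inverse (real n)) \<le> (\<Sum>n\<in>insert 0 {1..N}. inverse (real n))"
        by (rule sum_mono2) auto
      then show ?thesis by simp
    qed
    also have "\<dots> \<le> (\<Sum>n = 1..N. tail n + (\<Sum>i = 1..n. word_prob i / i * tail (n - i)))"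
    proof (rule sum_mono)
      fix n assume n: "n \<in> {1..N}"
      have "inverse (real n) = (\<Sum>i\<le>n. word_prob i * tail (n - i)) / n"
        by (simp add: renewal_identity field_simps)
      also have "\<dots> = (\<Sum>i\<in>insert 0 {1..n}. word_prob i / n * tail (n - i))"
      proof -
        have "{..n} = insert 0 {1..n}" by auto
        then show ?thesis by (simp add: sum_divide_distrib add_divide_distrib)
      qed
      also have "\<dots> = tail n / n + (\<Sum>i = 1..n. word_prob i / n * tail (n - i))"
        by simp
      also have "\<dots> \<le> tail n + (\<Sum>i = 1..n. word_prob i / i * tail (n - i))"
      proof (rule add_mono)
        show "tail n / n \<le> tail n"
          using n tail_nonneg[of n] by (simp add: divide_le_eq mult_le_cancel_left1)
        show "(\<Sum>i = 1..n. word_prob i / n * tail (n - i)) \<le> (\<Sum>i = 1..n. word_prob i / i * tail (n - i))"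
          by (intro sum_mono mult_right_mono divide_left_mono) (auto simp: word_prob_nonneg tail_nonneg)
      qed
      finally show "inverse (real n) \<le> tail n + (\<Sum>i = 1..n. word_prob i / i * tail (n - i))" .
    qed
    also have "\<dots> = (\<Sum>n = 1..N. tail n) + (\<Sum>n = 1..N. \<Sum>i = 1..n. word_prob i / i * tail (n - i))"
      by (rule sum.distrib)
    also have "(\<Sum>n = 1..N. tail n) \<le> (\<Sum>n\<le>N. tail n)"
      by (intro sum_mono2) (auto simp: tail_nonneg)
    also have "(\<Sum>n\<le>N. tail n) \<le> \<mu>" by (rule sum_tail_le)
    also have "(\<Sum>n = 1..N. \<Sum>i = 1..n. word_prob i / i * tail (n - i)) =
        (\<Sum>i = 1..N. \<Sum>n = i..N. word_prob i / i * tail (n - i))"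
      by (subst (1 2) sum.Sigma, simp, simp, simp, simp)
        (rule sum.reindex_bij_witness[where i = "\<lambda>(a, b). (b, a)" and j = "\<lambda>(a, b). (b, a)"]; auto)
    also have "\<dots> \<le> (\<Sum>i = 1..N. word_prob i / i * \<mu>)"
    proof (rule sum_mono)
      fix i assume i: "i \<in> {1..N}"
      have "(\<Sum>n = i..N. tail (n - i)) = (\<Sum>n\<le>N - i. tail n)"
        using i by (intro sum.reindex_bij_witness[where i = "\<lambda>n. n + i" and j = "\<lambda>n. n - i"]) auto
      then have "(\<Sum>n = i..N. tail (n - i)) \<le> \<mu>" by (simp add: sum_tail_le)
      then have "word_prob i / i * (\<Sum>n = i..N. tail (n - i)) \<le> word_prob i / i * \<mu>"
        by (intro mult_left_mono) (simp_all add: word_prob_nonneg)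
      then show "(\<Sum>n = i..N. word_prob i / i * tail (n - i)) \<le> word_prob i / i * \<mu>"
        by (simp add: sum_distrib_left)
    qed
    also have "\<dots> \<le> U * \<mu>"
      unfolding sum_distrib_right [symmetric] by (intro mult_right_mono U mean_nonneg)
    finally show "(\<Sum>n<N. inverse (real n)) \<le> \<mu> + U * \<mu>" by simp
  qed simp
  then show False using not_summable_harmonic[where 'a = real] by simp
qed

text \<open>The coefficient of \<open>- ln (1 - F)\<close>, where \<open>F\<close> is the letter
  series: the words of length \<open>k\<close> contribute \<open>F ^ k / k\<close>.\<close>

definition weighted_count :: "nat \<Rightarrow> real" where
  "weighted_count n = (\<Sum>w\<in>words n - {[]}. 1 / length w)"

lemma weighted_count_0 [simp]: "weighted_count 0 = 0"
  by (simp add: weighted_count_def words_0)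

lemma words_minus_Nil: "0 < n \<Longrightarrow> words n - {[]} = words n"
  by (auto simp: words_def)

lemma num_words_le_weighted_count:
  assumes "0 < n"
  shows "num_words n / n \<le> weighted_count n"
proof -
  have "num_words n / n = (\<Sum>w\<in>words n. 1 / real n)"
    by (simp add: num_words_def)
  also have "\<dots> \<le> (\<Sum>w\<in>words n. 1 / length w)"
  proof (rule sum_mono)
    fix w assume "w \<in> words n"
    then have "length w \<le> n" "0 < length w"
      using length_le_word_cost[of w] assms by (auto simp: words_def)
    then show "1 / real n \<le> 1 / length w"
      by (intro frac_le) auto
  qed
  finally show ?thesis by (simp add: weighted_count_def words_minus_Nil[OF assms])
qed

text \<open>In a word of cost \<open>n\<close> the letters have mean cost \<open>n\<close> divided by the length.\<close>

lemma weighted_count_upper: "n * (weighted_count n * \<rho> ^ n) \<le> \<mu>"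
proof (cases "n = 0")
  case True
  then show ?thesis using mean_nonneg by simp
next
  case False
  then have n: "0 < n" by simp
  have "n * weighted_count n = (\<Sum>w\<in>words n. sum_list (map (\<lambda>a. real (cost a)) w) / length w)"
    unfolding weighted_count_def words_minus_Nil[OF n] sum_distrib_left
  proof (rule sum.cong)
    fix w assume "w \<in> words n"
    then have "real n = sum_list (map (\<lambda>a. real (cost a)) w)"
      by (induction w arbitrary: n) (auto simp: words_def word_cost_def)
    then show "n * (1 / length w) = sum_list (map (\<lambda>a. real (cost a)) w) / length w" by simp
  qed simp
  also have "\<dots> = (\<Sum>j\<le>n. (\<Sum>a | a \<in> A \<and> cost a = j. real (cost a)) * num_words (n - j))"
    unfolding sum_mean_over_letters[OF n] by (rule sum_over_first_letter[OF n])
  also have "\<dots> = (\<Sum>j\<le>n. real j * num_letters j * num_words (n - j))"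
    by (intro sum.cong) (simp_all add: num_letters_def)
  finally have "n * (weighted_count n * \<rho> ^ n) = (\<Sum>j\<le>n. real j * num_letters j * num_words (n - j)) * \<rho> ^ n"
    by (simp only: mult.assoc [symmetric])
  also have "\<dots> = (\<Sum>j\<le>n. j * letter_prob j * word_prob (n - j))"
    unfolding sum_distrib_right
  proof (rule sum.cong)
    fix j assume "j \<in> {..n}"
    then have "\<rho> ^ n = \<rho> ^ j * \<rho> ^ (n - j)" by (simp add: power_add [symmetric])
    then show "real j * num_letters j * num_words (n - j) * \<rho> ^ n = j * letter_prob j * word_prob (n - j)"
      by (simp add: letter_prob_def word_prob_def)
  qed simp
  also have "\<dots> \<le> (\<Sum>j\<le>n. j * letter_prob j)"
    by (intro sum_mono mult_left_le) (auto simp: word_prob_le_1 letter_prob_nonneg)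
  also have "\<dots> \<le> \<mu>"
    using sum_le_suminf[of "\<lambda>j. j * letter_prob j" "{..n}"] mean_sums letter_prob_nonneg by (simp add: sums_iff)
  finally show ?thesis .
qed

text \<open>The rotations of one word contribute 1 together, so this is the number of cyclic words
  of cost \<open>n\<close>.\<close>

definition cyclic_count :: "nat \<Rightarrow> real" where
  "cyclic_count n = (\<Sum>w\<in>words n - {[]}. 1 / card (rotations w))"

lemma inverse_length_le:
  "w \<noteq> [] \<Longrightarrow> 1 / real (length w) \<le> 1 / card (rotations w)"
  using card_rotations_le[of w] card_rotations_pos[of w] by (intro frac_le) simp_all

lemma cyclic_count_0 [simp]: "cyclic_count 0 = 0"
  by (simp add: cyclic_count_def words_0)

lemma cyclic_count_nonneg: "0 \<le> cyclic_count n"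
  unfolding cyclic_count_def by (intro sum_nonneg) simp

lemma weighted_count_le_cyclic_count: "weighted_count n \<le> cyclic_count n"
  unfolding weighted_count_def cyclic_count_def by (intro sum_mono inverse_length_le) auto

text \<open>The two weights agree except on proper powers, where the whole term, at most
  \<open>K\<close>, is put into the error.\<close>

lemma sum_rotation_defect_le:
  fixes \<psi> :: "'a list \<Rightarrow> real" and K :: real
  assumes "\<And>w. w \<in> words n \<Longrightarrow> 0 \<le> \<psi> w \<and> \<psi> w \<le> K"
  shows "(\<Sum>w\<in>words n - {[]}. \<psi> w / card (rotations w)) \<le>
    (\<Sum>w\<in>words n - {[]}. \<psi> w / length w) + K * num_powers n"
proof -
  have "(\<Sum>w\<in>words n - {[]}. \<psi> w / card (rotations w)) \<le>
      (\<Sum>w\<in>words n - {[]}. \<psi> w / length w + (if card (rotations w) \<noteq> length w then K else 0))"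
  proof (rule sum_mono)
    fix w assume w: "w \<in> words n - {[]}"
    have "\<psi> w / card (rotations w) \<le> \<psi> w / 1"
      using assms[of w] w card_rotations_pos[of w] by (intro divide_left_mono) auto
    moreover have "0 \<le> \<psi> w / length w" using assms[of w] w by simp
    moreover have "\<psi> w \<le> K" using assms[of w] w by simp
    ultimately show "\<psi> w / card (rotations w) \<le>
        \<psi> w / length w + (if card (rotations w) \<noteq> length w then K else 0)"
      by simp
  qed
  also have "\<dots> = (\<Sum>w\<in>words n - {[]}. \<psi> w / length w) +
      (\<Sum>w\<in>words n - {[]}. if card (rotations w) \<noteq> length w then K else 0)"
    by (rule sum.distrib)
  also have "(\<Sum>w\<in>words n - {[]}. if card (rotations w) \<noteq> length w then K else 0) =
      K * card {w \<in> words n - {[]}. card (rotations w) \<noteq> length w}"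
    by (simp add: sum.If_cases Collect_conj_eq [symmetric] Int_def)
  finally show ?thesis by (simp add: num_powers_def)
qed

text \<open>A proper power is determined by \<open>r\<close> and its base, whose cost
  \<open>k\<close> is at most \<open>n / 2\<close>. Since
  \<open>num_words k * \<rho> ^ k \<le> 1\<close>, each \<open>r\<close> contributes at most
  \<open>\<rho> ^ (n - k) \<le> sqrt \<rho> ^ n\<close>.\<close>

lemma num_powers_bound:
  assumes "0 < n"
  shows "num_powers n * \<rho> ^ n \<le> n * sqrt \<rho> ^ n"
proof -
  define \<sigma> where "\<sigma> = sqrt \<rho>"
  have \<sigma>: "0 < \<sigma>" "\<sigma> < 1" "\<rho> = \<sigma> ^ 2"
    using rho by (auto simp: \<sigma>_def)
  have le: "num_words (n div r) * \<rho> ^ n \<le> \<sigma> ^ n" if "r \<in> {2..n}" for r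
  proof -
    define k where "k = n div r"
    have "k * 2 \<le> k * r" using that by simp
    also have "\<dots> \<le> n" by (simp add: k_def)
    finally have k: "2 * k \<le> n" by simp
    then have "\<rho> ^ n = \<rho> ^ k * \<rho> ^ (n - k)" by (simp add: power_add [symmetric])
    then have "num_words k * \<rho> ^ n = word_prob k * \<rho> ^ (n - k)" by (simp add: word_prob_def)
    also have "\<dots> \<le> 1 * \<rho> ^ (n - k)"
      using rho word_prob_le_1 by (intro mult_right_mono) auto
    also have "\<dots> = \<sigma> ^ (2 * (n - k))" by (simp add: \<sigma>(3) power_mult)
    also have "\<dots> \<le> \<sigma> ^ n" using k \<sigma> by (intro power_decreasing) auto
    finally show ?thesis by (simp add: k_def)
  qed
  have "num_powers n * \<rho> ^ n \<le> real (\<Sum>r = 2..n. num_words (n div r)) * \<rho> ^ n"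
    using num_powers_le[OF assms] rho by (intro mult_right_mono) (simp_all only: of_nat_le_iff, simp)
  also have "\<dots> = (\<Sum>r = 2..n. num_words (n div r) * \<rho> ^ n)"
    by (simp add: sum_distrib_right)
  also have "\<dots> \<le> (\<Sum>r = 2..n. \<sigma> ^ n)"
    by (intro sum_mono le)
  also have "\<dots> = real (n - 1) * \<sigma> ^ n"
    using assms by simp
  also have "\<dots> \<le> n * \<sigma> ^ n"
    using \<sigma> by (intro mult_right_mono) auto
  finally show ?thesis by (simp add: \<sigma>_def)
qed

lemma cyclic_count_upper:
  obtains C where "0 \<le> C" "\<And>n. n * (cyclic_count n * \<rho> ^ n) \<le> C"
proof -
  have \<sigma>: "0 \<le> sqrt \<rho>" "sqrt \<rho> < 1" using rho by auto
  obtain B where B: "0 \<le> B" "\<And>n. real n ^ 2 * sqrt \<rho> ^ n \<le> B"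
    using bounded_power_times_geometric[OF \<sigma>, of 2] by blast
  have "n * (cyclic_count n * \<rho> ^ n) \<le> \<mu> + B" for n
  proof (cases "n = 0")
    case True
    then show ?thesis using B mean_nonneg by simp
  next
    case False
    have "cyclic_count n \<le> weighted_count n + num_powers n"
      using sum_rotation_defect_le[of n "\<lambda>_. 1" 1] by (simp add: cyclic_count_def weighted_count_def)
    then have "n * (cyclic_count n * \<rho> ^ n) \<le> n * ((weighted_count n + num_powers n) * \<rho> ^ n)"
      using rho by (intro mult_left_mono mult_right_mono) auto
    also have "\<dots> = n * (weighted_count n * \<rho> ^ n) + n * (num_powers n * \<rho> ^ n)"
      by (simp add: algebra_simps)
    also have "\<dots> \<le> \<mu> + n * (n * sqrt \<rho> ^ n)"
      using False by (intro add_mono weighted_count_upper mult_left_mono num_powers_bound) auto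
    also have "\<dots> \<le> \<mu> + B"
      using B(2)[of n] by (simp add: power2_eq_square mult_ac)
    finally show ?thesis .
  qed
  with B mean_nonneg that[of "\<mu> + B"] show ?thesis by simp
qed

text \<open>The factor \<open>2 * (n - i)\<close> will bound the number of central exponents outside
  the window that raise a word of cost \<open>i\<close> to length \<open>n\<close>. After scaling by
  powers of \<open>\<rho>\<close> it is a geometrically decaying kernel, and convolution with such a
  kernel preserves decay of order \<open>1 / n\<close>.\<close>

lemma cyclic_count_convolution_upper:
  obtains C where "\<And>n. n * ((\<Sum>i<n. real (2 * (n - i)) * cyclic_count i) * \<rho> ^ n) \<le> C"
proof -
  have \<sigma>: "0 \<le> sqrt \<rho>" "sqrt \<rho> < 1" using rho by auto
  obtain B where B: "0 \<le> B" "\<And>n. real n ^ 2 * sqrt \<rho> ^ n \<le> B"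
    using bounded_power_times_geometric[OF \<sigma>, of 2] by blast
  obtain C where C: "0 \<le> C" "\<And>n. n * (cyclic_count n * \<rho> ^ n) \<le> C"
    using cyclic_count_upper by blast
  have term_le: "n * (real (2 * (n - i)) * cyclic_count i * \<rho> ^ n) \<le> 4 * B * C * sqrt \<rho> ^ (n - i)"
    if "i < n" for i n
  proof (cases "i = 0")
    case True
    then show ?thesis using B C \<sigma> by simp
  next
    case False
    define k where "k = n - i"
    have n: "n = k + i" "0 < k" using that by (auto simp: k_def)
    \<comment> \<open>Trades the factor \<open>n\<close> for \<open>i\<close>, absorbed by the bound
      on \<open>cyclic_count i\<close>, times \<open>2 * k\<close>, absorbed by
      \<open>\<rho> ^ k\<close>.\<close>
    have "n \<le> (1 + k) * i" using False n(1) by simp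
    also have "(1 + k) * i \<le> (2 * k) * i" using n(2) by simp
    finally have "n \<le> (2 * k) * i" .
    then have le: "real n \<le> real ((2 * k) * i)" by (simp only: of_nat_le_iff)
    have "n * (real (2 * k) * cyclic_count i * \<rho> ^ n) \<le>
        real ((2 * k) * i) * (real (2 * k) * cyclic_count i * \<rho> ^ n)"
      using rho cyclic_count_nonneg by (intro mult_right_mono le) auto
    also have "\<dots> = 4 * (i * (cyclic_count i * \<rho> ^ i)) * (real k ^ 2 * \<rho> ^ k)"
      by (simp add: n(1) power_add power2_eq_square)
    also have "\<dots> \<le> 4 * C * (B * sqrt \<rho> ^ k)"
    proof (rule mult_mono)
      show "4 * (i * (cyclic_count i * \<rho> ^ i)) \<le> 4 * C"
        using C(2)[of i] by simp
      have "\<rho> ^ k = sqrt \<rho> ^ k * sqrt \<rho> ^ k"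
        using rho by (simp add: power_mult_distrib [symmetric])
      then have "real k ^ 2 * \<rho> ^ k = (real k ^ 2 * sqrt \<rho> ^ k) * sqrt \<rho> ^ k" by simp
      also have "\<dots> \<le> B * sqrt \<rho> ^ k"
        using B(2) \<sigma> by (intro mult_right_mono) auto
      finally show "real k ^ 2 * \<rho> ^ k \<le> B * sqrt \<rho> ^ k" .
    qed (use C rho in auto)
    finally show ?thesis by (simp add: k_def mult_ac)
  qed
  have "n * ((\<Sum>i<n. real (2 * (n - i)) * cyclic_count i) * \<rho> ^ n) \<le> 4 * B * C * (1 / (1 - sqrt \<rho>))" for n
  proof -
    have "n * ((\<Sum>i<n. real (2 * (n - i)) * cyclic_count i) * \<rho> ^ n) =
        (\<Sum>i<n. n * (real (2 * (n - i)) * cyclic_count i * \<rho> ^ n))"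
      by (simp only: sum_distrib_left sum_distrib_right)
    also have "\<dots> \<le> (\<Sum>i<n. 4 * B * C * sqrt \<rho> ^ (n - i))"
      by (intro sum_mono term_le) simp
    also have "\<dots> = 4 * B * C * (\<Sum>i<n. sqrt \<rho> ^ (n - i))"
      by (simp only: sum_distrib_left)
    also have "(\<Sum>i<n. sqrt \<rho> ^ (n - i)) = (\<Sum>k\<in>{1..n}. sqrt \<rho> ^ k)"
      by (rule sum.reindex_bij_witness[where i = "\<lambda>k. n - k" and j = "\<lambda>k. n - k"]) auto
    also have "\<dots> \<le> (\<Sum>k. sqrt \<rho> ^ k)"
      using \<sigma> by (intro sum_le_suminf summable_geometric) auto
    also have "\<dots> = 1 / (1 - sqrt \<rho>)"
      using \<sigma> by (intro suminf_geometric) auto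
    finally show ?thesis using B C by (simp add: mult_left_mono)
  qed
  with that show ?thesis by blast
qed

lemma num_words_series:
  "fps_to_fls (Abs_fps (\<lambda>n. of_nat (num_words n) :: rat)) =
    inverse (1 - fps_to_fls (Abs_fps (\<lambda>n. of_nat (num_letters n))))"
proof -
  let ?W = "Abs_fps (\<lambda>n. of_nat (num_words n) :: rat)"
  let ?F = "Abs_fps (\<lambda>n. of_nat (num_letters n) :: rat)"
  have "?W = 1 + ?F * ?W"
  proof (rule fps_ext)
    fix n
    show "fps_nth ?W n = fps_nth (1 + ?F * ?W) n"
    proof (cases "n = 0")
      case False
      then have "num_words n = (\<Sum>j\<le>n. num_letters j * num_words (n - j))"
        using num_words_rec[of n] by (simp only: of_nat_eq_iff)
      then have "(of_nat (num_words n) :: rat) = of_nat (\<Sum>j\<le>n. num_letters j * num_words (n - j))"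
        by (simp only:)
      then show ?thesis using False by (simp add: fps_mult_nth atLeast0AtMost)
    qed (simp add: fps_mult_nth)
  qed
  then have "(1 - ?F) * ?W = 1" by (simp add: algebra_simps)
  then have "fps_to_fls (1 - ?F) * fps_to_fls ?W = 1"
    by (simp only: fls_times_fps_to_fls [symmetric] fps_one_to_fls)
  then have "inverse (fps_to_fls (1 - ?F)) = fps_to_fls ?W"
    by (rule inverse_unique)
  then show ?thesis by simp
qed

text \<open>With weight \<open>1 / length w\<close>, the additive part
  \<open>sum_list (map h w)\<close> is a rotation average and sums to the total mark of first
  letters. This is \<open>M\<close>, whose series \<open>H / (1 - F)\<close> is rational. Replacing
  \<open>length w\<close> by \<open>card (rotations w)\<close> changes only the terms of proper
  powers. Hence \<open>c n - M n\<close> is at least \<open>cyclic_count n\<close>, and all that it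
  contains beyond that stays bounded after multiplication by \<open>n * \<rho> ^ n\<close>.\<close>

theorem transcendental_series_of_cyclic_words:
  fixes h :: "'a \<Rightarrow> nat" and c :: "nat \<Rightarrow> nat"
  assumes h: "\<And>a. a \<in> A \<Longrightarrow> h a \<le> 2"
    and letters: "fps_to_fls (Abs_fps (\<lambda>j. of_nat (num_letters j))) \<in> rational_functions"
    and marks: "fps_to_fls (Abs_fps (\<lambda>j. of_nat (\<Sum>a | a \<in> A \<and> cost a = j. h a))) \<in> rational_functions"
    and lower: "\<And>n. (\<Sum>w\<in>words n - {[]}. real (sum_list (map h w) + 1) / card (rotations w)) \<le> real (c n)"
    and upper: "\<And>n. real (c n) \<le> (\<Sum>w\<in>words n - {[]}. real (sum_list (map h w) + 1) / card (rotations w)) +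
      (\<Sum>i<n. real (2 * (n - i)) * cyclic_count i) + 2 * (2 * real n + 1) ^ 2"
  shows "transcendental_series (Abs_fps (\<lambda>n. of_nat (c n)))"
proof -
  define H where "H j = (\<Sum>a | a \<in> A \<and> cost a = j. h a)" for j
  have H0: "H 0 = 0"
  proof -
    have "{a \<in> A. cost a = 0} = {}" using cost_pos by fastforce
    then show ?thesis unfolding H_def by (simp only: sum.empty)
  qed
  define M where "M n = (\<Sum>j\<le>n. H j * num_words (n - j))" for n
  have M: "real (M n) = (\<Sum>w\<in>words n - {[]}. real (sum_list (map h w)) / length w)" for n
  proof (cases "n = 0")
    case True
    then show ?thesis by (simp add: M_def H0 words_0)
  next
    case False
    then have n: "0 < n" by simp
    have "(\<Sum>w\<in>words n. sum_list (map (\<lambda>a. real (h a)) w) / length w) = real (M n)"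
      unfolding sum_mean_over_letters[OF n]
      by (subst sum_over_first_letter[OF n]) (simp add: M_def H_def)
    moreover have "real (sum_list (map h w)) = (\<Sum>a\<leftarrow>w. real (h a))" for w
      by (induction w) simp_all
    ultimately show ?thesis
      unfolding words_minus_Nil[OF n] by simp
  qed
  define g :: "rat fps" where "g = Abs_fps (\<lambda>n. of_nat (c n) - of_nat (M n))"
  have g: "real_of_rat (fps_nth g n) = real (c n) - real (M n)" for n
    by (simp add: g_def of_rat_diff)
  have cyc: "(\<Sum>w\<in>words n - {[]}. real (sum_list (map h w) + 1) / card (rotations w)) =
      (\<Sum>w\<in>words n - {[]}. real (sum_list (map h w)) / card (rotations w)) + cyclic_count n" for n
    by (simp add: cyclic_count_def sum.distrib [symmetric] add_divide_distrib add.commute)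
  have g_lower: "cyclic_count n \<le> real_of_rat (fps_nth g n)" for n
  proof -
    have "real (M n) \<le> (\<Sum>w\<in>words n - {[]}. real (sum_list (map h w)) / card (rotations w))"
      unfolding M
    proof (rule sum_mono)
      fix w assume "w \<in> words n - {[]}"
      then show "real (sum_list (map h w)) / length w \<le> real (sum_list (map h w)) / card (rotations w)"
        using card_rotations_le[of w] card_rotations_pos[of w] by (intro frac_le) auto
    qed
    then show ?thesis using lower[of n] cyc[of n] by (simp add: g)
  qed
  have h_le: "sum_list (map h w) \<le> 2 * n" if "w \<in> words n" for w n
  proof -
    have "sum_list (map h w) \<le> 2 * length w"
      using that h by (induction w arbitrary: n) (force simp: words_def)+
    with length_le_word_cost[of w] that show ?thesis by (auto simp: words_def)
  qed
  have g_upper: "real_of_rat (fps_nth g n) \<le> 2 * real n * num_powers n + cyclic_count n +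
      (\<Sum>i<n. real (2 * (n - i)) * cyclic_count i) + 2 * (2 * real n + 1) ^ 2" for n
  proof -
    have "(\<Sum>w\<in>words n - {[]}. real (sum_list (map h w)) / card (rotations w)) \<le>
        real (M n) + real (2 * n) * num_powers n"
      unfolding M by (intro sum_rotation_defect_le) (auto simp: h_le simp del: of_nat_mult)
    then show ?thesis using upper[of n] cyc[of n] by (simp add: g)
  qed
  have \<sigma>: "0 \<le> sqrt \<rho>" "sqrt \<rho> < 1" using rho by auto
  obtain B where B: "0 \<le> B" "\<And>n. real n ^ 3 * sqrt \<rho> ^ n \<le> B"
    using bounded_power_times_geometric[OF \<sigma>, of 3] by blast
  obtain B' where B': "0 \<le> B'" "\<And>n. real n ^ 3 * \<rho> ^ n \<le> B'"
    using bounded_power_times_geometric[of \<rho> 3] rho by auto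
  obtain C where C: "\<And>n. n * (cyclic_count n * \<rho> ^ n) \<le> C"
    using cyclic_count_upper by blast
  obtain C' where C': "\<And>n. n * ((\<Sum>i<n. real (2 * (n - i)) * cyclic_count i) * \<rho> ^ n) \<le> C'"
    using cyclic_count_convolution_upper by blast
  have "0 \<le> C" "0 \<le> C'" using C[of 0] C'[of 0] by auto
  show ?thesis
  proof (rule transcendental_series_rational_plus_logarithmic)
    let ?H = "Abs_fps (\<lambda>n. of_nat (H n) :: rat)" and ?W = "Abs_fps (\<lambda>n. of_nat (num_words n) :: rat)"
    have "Abs_fps (\<lambda>n. of_nat (c n)) = ?H * ?W + g"
      by (rule fps_ext) (simp add: fps_mult_nth g_def M_def atLeast0AtMost)
    then show "fps_to_fls (Abs_fps (\<lambda>n. of_nat (c n))) = fps_to_fls ?H * fps_to_fls ?W + fps_to_fls g"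
      by (simp add: fls_times_fps_to_fls)
    have "- 1 \<in> rational_functions" "1 \<in> rational_functions"
      unfolding rational_functions_def
      by (rule CollectI, rule exI[of _ "-1"], rule exI[of _ 1], simp add: fps_of_poly_uminus)
        (rule CollectI, rule exI[of _ 1], rule exI[of _ 1], simp)
    then have "1 + (-1) * fps_to_fls (Abs_fps (\<lambda>j. of_nat (num_letters j))) \<in> rational_functions"
      using letters by (intro rational_functions_add rational_functions_mult)
    then have "fps_to_fls ?W \<in> rational_functions"
      unfolding num_words_series by (intro rational_functions_inverse) simp
    then show "fps_to_fls ?H * fps_to_fls ?W \<in> rational_functions"
      using marks by (intro rational_functions_mult) (simp_all add: H_def)
    show "0 < \<rho>" by (rule rho)
    show "0 \<le> fps_nth g n" for n
    proof -
      have "0 \<le> real_of_rat (fps_nth g n)"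
        using g_lower[of n] cyclic_count_nonneg[of n] by linarith
      then show ?thesis by (simp only: zero_le_of_rat_iff)
    qed
    \<comment> \<open>\<open>2 * B\<close> is for the proper powers, each with at most
      \<open>2 * n\<close> marks; 18 comes from
      \<open>2 * (2 * n + 1) ^ 2 \<le> 2 * (3 * n) ^ 2\<close> for \<open>n \<ge> 1\<close>.\<close>
    show "real n * (real_of_rat (fps_nth g n) * \<rho> ^ n) \<le> 2 * B + C + C' + 18 * B'" for n
    proof (cases "n = 0")
      case True
      then show ?thesis using B B' \<open>0 \<le> C\<close> \<open>0 \<le> C'\<close> by simp
    next
      case False
      have "real n * (real_of_rat (fps_nth g n) * \<rho> ^ n) \<le> real n *
          ((2 * real n * num_powers n + cyclic_count n +
          (\<Sum>i<n. real (2 * (n - i)) * cyclic_count i) + 2 * (2 * real n + 1) ^ 2) * \<rho> ^ n)"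
        using g_upper[of n] rho by (intro mult_left_mono mult_right_mono) auto
      also have "\<dots> = 2 * real n ^ 2 * (num_powers n * \<rho> ^ n) + n * (cyclic_count n * \<rho> ^ n) +
          n * ((\<Sum>i<n. real (2 * (n - i)) * cyclic_count i) * \<rho> ^ n) +
          2 * (real n * (2 * real n + 1) ^ 2) * \<rho> ^ n"
        by (simp only: distrib_left distrib_right power2_eq_square mult_ac)
      also have "\<dots> \<le> 2 * B + C + C' + 18 * B'"
      proof (intro add_mono C C')
        have "2 * real n ^ 2 * (num_powers n * \<rho> ^ n) \<le> 2 * real n ^ 2 * (n * sqrt \<rho> ^ n)"
          using False by (intro mult_left_mono num_powers_bound) auto
        also have "\<dots> = 2 * (real n ^ 3 * sqrt \<rho> ^ n)"
          by (simp add: power2_eq_square power3_eq_cube)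
        also have "\<dots> \<le> 2 * B" using B(2)[of n] by simp
        finally show "2 * real n ^ 2 * (num_powers n * \<rho> ^ n) \<le> 2 * B" .
        have "(2 * real n + 1) ^ 2 \<le> (3 * real n) ^ 2"
          using False by (intro power_mono) auto
        then have "2 * (real n * (2 * real n + 1) ^ 2) * \<rho> ^ n \<le> 2 * (real n * (3 * real n) ^ 2) * \<rho> ^ n"
          using rho by (intro mult_right_mono mult_left_mono) auto
        also have "\<dots> = 18 * (real n ^ 3 * \<rho> ^ n)"
          by (simp add: power2_eq_square power3_eq_cube)
        also have "\<dots> \<le> 18 * B'" using B'(2)[of n] by simp
        finally show "2 * (real n * (2 * real n + 1) ^ 2) * \<rho> ^ n \<le> 18 * B'" .
      qed
      finally show ?thesis .
    qed
    show "\<not> summable (\<lambda>n. real_of_rat (fps_nth g n) * \<rho> ^ n)"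
    proof
      assume S: "summable (\<lambda>n. real_of_rat (fps_nth g n) * \<rho> ^ n)"
      have "summable (\<lambda>n. word_prob n / n)"
      proof (rule summable_comparison_test'[OF S])
        fix n :: nat
        show "norm (word_prob n / n) \<le> real_of_rat (fps_nth g n) * \<rho> ^ n"
        proof (cases "n = 0")
          case True
          have "0 \<le> real_of_rat (fps_nth g n)"
            using g_lower[of n] cyclic_count_nonneg[of n] by linarith
          then show ?thesis using True by simp
        next
          case False
          have "norm (word_prob n / n) = num_words n / n * \<rho> ^ n"
            using rho by (simp add: word_prob_def)
          also have "\<dots> \<le> real_of_rat (fps_nth g n) * \<rho> ^ n"
            using num_words_le_weighted_count[of n] weighted_count_le_cyclic_count[of n] g_lower[of n] False rho
            by (intro mult_right_mono) auto
          finally show ?thesis .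
        qed
      qed
      then show False using not_summable_word_prob_over_n by simp
    qed
  qed
qed

end

text \<open>Bounded letter counts make the letter series converge on \<open>[0, 1)\<close>, and two
  letters of cost 2 push it to at least 1 at \<open>sqrt (1 / 2)\<close>. So it takes the value 1 at
  some \<open>\<rho> < 1\<close>, where the mean is finite too.\<close>

lemma (in weighted_alphabet) critical_alphabet_exists:
  assumes bounded: "\<And>j. num_letters j \<le> K" and two: "2 \<le> num_letters 2"
  obtains \<rho> \<mu> where "critical_alphabet A cost \<rho> \<mu>"
proof -
  define a where "a j = real (num_letters j)" for j
  define F where "F = Abs_fps a"
  have rad: "ereal 1 \<le> fps_conv_radius F"
    unfolding F_def using bounded by (intro fps_conv_radius_ge_of_bound[where C = "real K"]) (auto simp: a_def)
  have lt_rad: "ereal (norm x) < fps_conv_radius F" if "0 \<le> x" "x < 1" for x :: real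
    using that by (intro less_le_trans[OF _ rad]) simp
  have sm: "summable (\<lambda>j. a j * x ^ j)" if "0 \<le> x" "x < 1" for x :: real
    using summable_fps[OF lt_rad[OF that]] by (simp add: F_def)
  define z :: real where "z = sqrt (1 / 2)"
  have z: "0 < z" "z < 1" "z ^ 2 = 1 / 2"
    by (auto simp: z_def real_sqrt_lt_1_iff)
  have "1 \<le> a 2 * z ^ 2" using two unfolding z(3) by (simp add: a_def)
  also have "\<dots> = (\<Sum>j\<in>{2}. a j * z ^ j)" by simp
  also have "\<dots> \<le> (\<Sum>j. a j * z ^ j)"
    using z sm by (intro sum_le_suminf) (auto simp: a_def)
  finally have "1 \<le> eval_fps F z" by (simp add: eval_fps_def F_def)
  moreover have "eval_fps F 0 = 0"
    by (simp add: eval_fps_at_0 F_def a_def)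
  moreover have "continuous_on {0..z} (eval_fps F)"
  proof (rule continuous_on_subset[OF continuous_on_eval_fps])
    show "{0..z} \<subseteq> eball 0 (fps_conv_radius F)"
    proof
      fix x assume "x \<in> {0..z}"
      then show "x \<in> eball 0 (fps_conv_radius F)"
        using lt_rad[of x] z by simp
    qed
  qed
  ultimately obtain \<rho> where \<rho>: "0 \<le> \<rho>" "\<rho> \<le> z" "eval_fps F \<rho> = 1"
    using IVT'[of "eval_fps F" 0 1 z] z by auto
  have "\<rho> \<noteq> 0" using \<rho>(3) \<open>eval_fps F 0 = 0\<close> by auto
  have lt: "\<rho> < 1" using \<rho> z by simp
  have "sqrt \<rho> < 1" "0 \<le> sqrt \<rho>" using lt \<rho> by auto
  then obtain B where B: "0 \<le> B" "\<And>n. real n ^ 1 * sqrt \<rho> ^ n \<le> B"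
    using bounded_power_times_geometric[of "sqrt \<rho>" 1] by blast
  have "(\<lambda>j. a j * \<rho> ^ j) sums 1"
    using sums_eval_fps[OF lt_rad[OF \<rho>(1) lt]] \<rho>(3) by (simp add: F_def)
  moreover have "summable (\<lambda>j. j * (a j * \<rho> ^ j))"
  proof (rule summable_comparison_test')
    show "summable (\<lambda>j. K * B * sqrt \<rho> ^ j)"
      using lt \<rho> by (intro summable_mult summable_geometric) auto
    fix j :: nat assume "0 \<le> j"
    have "norm (j * (a j * \<rho> ^ j)) = a j * (real j ^ 1 * sqrt \<rho> ^ j * sqrt \<rho> ^ j)"
      using \<rho> by (simp add: a_def power_mult_distrib [symmetric])
    also have "\<dots> \<le> K * (B * sqrt \<rho> ^ j)"
      using bounded[of j] \<rho> B by (intro mult_mono mult_right_mono) (auto simp: a_def)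
    finally show "norm (j * (a j * \<rho> ^ j)) \<le> K * B * sqrt \<rho> ^ j" by simp
  qed
  ultimately have "critical_alphabet A cost \<rho> (\<Sum>j. j * (a j * \<rho> ^ j))"
    using \<rho>(1) \<open>\<rho> \<noteq> 0\<close> lt by unfold_locales (auto simp: a_def summable_sums)
  then show ?thesis by (rule that)
qed

text \<open>Such a series is a polynomial plus \<open>c / (1 - z)\<close>.\<close>

lemma rational_functions_eventually_constant:
  fixes f :: "nat \<Rightarrow> rat"
  assumes "\<And>j. J \<le> j \<Longrightarrow> f j = c"
  shows "fps_to_fls (Abs_fps f) \<in> rational_functions"
proof -
  have poly_series: "poly_series P \<in> rational_functions" for P
    unfolding rational_functions_def by (rule CollectI, rule exI[of _ P], rule exI[of _ 1]) simp
  define P where "P = (\<Sum>j<J. monom (f j - c) j)"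
  have P: "coeff P j = (if j < J then f j - c else 0)" for j
    by (simp add: P_def coeff_sum)
  have "Abs_fps f = fps_of_poly P + fps_of_poly [:c:] * Abs_fps (\<lambda>_. 1)"
    using assms by (intro fps_ext) (auto simp: P fps_of_poly_const)
  moreover have "fps_to_fls (Abs_fps (\<lambda>_. 1 :: rat)) \<in> rational_functions"
  proof -
    have "fps_of_poly [:1, -1:] * Abs_fps (\<lambda>_. 1 :: rat) = 1"
    proof -
      have "fps_of_poly [:1, -1:] = (1 - fps_X :: rat fps)"
        by (simp add: fps_of_poly_pCons)
      moreover have "(1 - fps_X) * Abs_fps (\<lambda>_. 1 :: rat) = 1"
        by (rule fps_ext) (simp add: left_diff_distrib)
      ultimately show ?thesis by (simp only:)
    qed
    then have "poly_series [:1, -1:] * fps_to_fls (Abs_fps (\<lambda>_. 1 :: rat)) = 1"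
      by (simp only: fls_times_fps_to_fls [symmetric] fps_one_to_fls)
    then have "inverse (poly_series [:1, -1:]) = fps_to_fls (Abs_fps (\<lambda>_. 1 :: rat))"
      by (rule inverse_unique)
    then show ?thesis
      using rational_functions_inverse[OF poly_series[of "[:1, -1:]"]] by simp
  qed
  ultimately show ?thesis
    using poly_series by (simp add: fls_times_fps_to_fls rational_functions_add rational_functions_mult)
qed

section \<open>Normal forms in central amalgams of cyclic groups\<close>

definition starts_with :: "bool \<Rightarrow> (bool \<times> int) list \<Rightarrow> bool" where
  "starts_with T L \<longleftrightarrow> L \<noteq> [] \<and> fst (hd L) = T"

text \<open>A syllable \<open>(T, e)\<close> stands for the \<open>e\<close>-th power of the
  generator \<open>T\<close>. \<open>N T = 0\<close> encodes infinite order modulo the central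
  element: as \<open>e mod 0 = e\<close> and \<open>e div 0 = 0\<close>, the same formulas then
  admit every nonzero exponent and never split off a central power.\<close>

definition reduced :: "(bool \<Rightarrow> int) \<Rightarrow> (bool \<times> int) list \<Rightarrow> bool" where
  "reduced N L \<longleftrightarrow> (\<forall>(T, e)\<in>set L. e \<noteq> 0 \<and> e mod N T = e) \<and> successively (\<lambda>x y. fst x \<noteq> fst y) L"

definition lead_exponent :: "bool \<Rightarrow> (bool \<times> int) list \<Rightarrow> int" where
  "lead_exponent T L = (if starts_with T L then snd (hd L) else 0)"

definition drop_lead :: "bool \<Rightarrow> (bool \<times> int) list \<Rightarrow> (bool \<times> int) list" where
  "drop_lead T L = (if starts_with T L then tl L else L)"

definition syllable_Cons :: "bool \<Rightarrow> int \<Rightarrow> (bool \<times> int) list \<Rightarrow> (bool \<times> int) list" where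
  "syllable_Cons T e L = (if e = 0 then L else (T, e) # L)"

text \<open>Left multiplication by the \<open>e\<close>-th power of the generator \<open>T\<close>
  on a normal form \<open>(c, L)\<close>, which means \<open>D ^ c\<close> times the syllables of
  \<open>L\<close>: the exponent merges with a leading syllable of type \<open>T\<close>, and the
  quotient by \<open>N T\<close> moves into the central power.\<close>

fun act :: "(bool \<Rightarrow> int) \<Rightarrow> bool \<Rightarrow> int \<Rightarrow> int \<times> (bool \<times> int) list \<Rightarrow> int \<times> (bool \<times> int) list" where
  "act N T e (c, L) =
     (c + (e + lead_exponent T L) div N T,
      syllable_Cons T ((e + lead_exponent T L) mod N T) (drop_lead T L))"

lemma reduced_Nil [simp]: "reduced N []"
  by (simp add: reduced_def)

lemma reduced_Cons:
  "reduced N ((T, e) # L) \<longleftrightarrow> e \<noteq> 0 \<and> e mod N T = e \<and> \<not> starts_with T L \<and> reduced N L"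
  by (cases L) (auto simp: reduced_def starts_with_def)

lemma div_eq_0_of_mod_eq: "(e :: int) mod n = e \<Longrightarrow> e div n = 0"
  by (metis div_by_0 mod_div_trivial)

lemma drop_lead_reduced:
  assumes "reduced N L"
  shows "reduced N (drop_lead T L)" "\<not> starts_with T (drop_lead T L)"
    "syllable_Cons T (lead_exponent T L) (drop_lead T L) = L"
    "lead_exponent T L mod N T = lead_exponent T L"
proof -
  have "reduced N (drop_lead T L) \<and> \<not> starts_with T (drop_lead T L) \<and>
    syllable_Cons T (lead_exponent T L) (drop_lead T L) = L \<and>
    lead_exponent T L mod N T = lead_exponent T L"
  proof (cases L)
    case Nil
    then show ?thesis by (simp add: drop_lead_def lead_exponent_def starts_with_def syllable_Cons_def)
  next
    case (Cons s L')
    obtain S e where s: "s = (S, e)" by (cases s)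
    show ?thesis
      using assms unfolding Cons s
      by (auto simp: reduced_Cons drop_lead_def lead_exponent_def starts_with_def syllable_Cons_def)
  qed
  then show "reduced N (drop_lead T L)" "\<not> starts_with T (drop_lead T L)"
    "syllable_Cons T (lead_exponent T L) (drop_lead T L) = L"
    "lead_exponent T L mod N T = lead_exponent T L" by blast+
qed

lemma reduced_syllable_Cons:
  "reduced N L \<Longrightarrow> \<not> starts_with T L \<Longrightarrow> reduced N (syllable_Cons T (e mod N T) L)"
  by (simp add: syllable_Cons_def reduced_Cons)

lemma lead_syllable_Cons:
  assumes "\<not> starts_with T L"
  shows "lead_exponent T (syllable_Cons T e L) = e" "drop_lead T (syllable_Cons T e L) = L"
  using assms by (auto simp: syllable_Cons_def lead_exponent_def drop_lead_def starts_with_def)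

lemma act_reduced: "reduced N (snd s) \<Longrightarrow> reduced N (snd (act N T e s))"
  by (cases s) (simp add: reduced_syllable_Cons drop_lead_reduced)

text \<open>Reducing in between or only at the end leaves the same residue, and the carries into the
  central exponent add up.\<close>

lemma act_add:
  assumes "reduced N (snd s)"
  shows "act N T e (act N T f s) = act N T (e + f) s"
proof -
  obtain c L where s: "s = (c, L)" by (cases s)
  define i where "i = f + lead_exponent T L"
  have "(e + i mod N T) mod N T = (e + i) mod N T" by (simp add: mod_simps)
  moreover have "i div N T + (e + i mod N T) div N T = (e + i) div N T"
  proof (cases "N T = 0")
    case False
    have "(e + i mod N T + i div N T * N T) div N T = i div N T + (e + i mod N T) div N T"
      using False by (rule div_mult_self1)
    then show ?thesis by (simp add: add.assoc)
  qed simp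
  ultimately show ?thesis
    using assms unfolding s
    by (simp add: lead_syllable_Cons drop_lead_reduced i_def [symmetric] add.assoc)
qed

lemma act_0: "reduced N (snd s) \<Longrightarrow> act N T 0 s = s"
  by (cases s) (simp add: drop_lead_reduced div_eq_0_of_mod_eq)

lemma act_multiple:
  assumes "reduced N L" "N T \<noteq> 0"
  shows "act N T (N T * k) (c, L) = (c + k, L)"
proof -
  let ?f = "lead_exponent T L"
  have "(N T * k + ?f) div N T = k + ?f div N T" "(N T * k + ?f) mod N T = ?f mod N T"
    using assms(2) by simp_all
  then show ?thesis
    using assms drop_lead_reduced(4)[OF assms(1), of T]
    by (simp add: drop_lead_reduced div_eq_0_of_mod_eq)
qed

lemma act_shift: "act N T e (c + d, L) = (d + fst (act N T e (c, L)), snd (act N T e (c, L)))"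
  by simp

text \<open>\<open>rep\<close> is an action of \<open>G\<close> on reduced normal forms in which the
  generators act by \<open>act\<close>. It separates elements with different normal forms; a
  concrete group has to supply it.\<close>

locale central_amalgam = group G for G (structure) +
  fixes gen :: "bool \<Rightarrow> 'a" and D :: 'a and N :: "bool \<Rightarrow> int"
    and rep :: "'a \<Rightarrow> int \<times> (bool \<times> int) list \<Rightarrow> int \<times> (bool \<times> int) list"
  assumes gen_closed [simp]: "gen T \<in> carrier G"
    and N_True: "N True = 0 \<or> 2 \<le> N True" and N_False: "2 \<le> N False"
    and gen_D: "gen T \<otimes> D = D \<otimes> gen T"
    and gen_pow_N: "N T \<noteq> 0 \<Longrightarrow> gen T [^] N T = D"
    and gens: "generate G (range gen) = carrier G"
    and rep_mult: "\<lbrakk>g \<in> carrier G; h \<in> carrier G; reduced N (snd s)\<rbrakk> \<Longrightarrow> rep (g \<otimes> h) s = rep g (rep h s)"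
    and rep_one: "reduced N (snd s) \<Longrightarrow> rep \<one> s = s"
    and rep_gen: "reduced N (snd s) \<Longrightarrow> rep (gen T) s = act N T 1 s"
begin

lemma D_closed [simp]: "D \<in> carrier G"
  using gen_pow_N[of False] N_False int_pow_closed[OF gen_closed, of False "N False"] by simp

lemma commute_int_pow:
  assumes "g \<in> carrier G" "h \<in> carrier G" "g \<otimes> h = h \<otimes> g"
  shows "g \<otimes> h [^] (k :: int) = h [^] k \<otimes> g"
proof -
  have nat: "g \<otimes> h [^] (n :: nat) = h [^] n \<otimes> g" for n
    using assms by (induction n) (simp_all add: m_assoc [symmetric], simp_all add: m_assoc)
  show ?thesis
  proof (cases k rule: int_cases2)
    case (nonneg n)
    then show ?thesis using nat[of n] by (simp add: int_pow_int)
  next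
    case (nonpos n)
    define x where "x = h [^] n"
    have x: "x \<in> carrier G" "g \<otimes> x = x \<otimes> g" using assms nat by (simp_all add: x_def)
    have "inv x \<otimes> g = inv x \<otimes> (g \<otimes> x) \<otimes> inv x"
      using x(1) assms(1) by (simp add: m_assoc)
    also have "\<dots> = inv x \<otimes> (x \<otimes> g) \<otimes> inv x"
      by (simp only: x(2))
    also have "\<dots> = g \<otimes> inv x"
      using x(1) assms(1) by (simp add: m_assoc [symmetric])
    finally have "g \<otimes> inv x = inv x \<otimes> g" by simp
    then show ?thesis using assms(2) by (simp add: nonpos int_pow_neg_int x_def)
  qed
qed

lemma gen_pow_D_pow: "gen T [^] (e :: int) \<otimes> D [^] (c :: int) = D [^] c \<otimes> gen T [^] e"
proof -
  have "gen T \<otimes> D [^] c = D [^] c \<otimes> gen T"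
    by (rule commute_int_pow) (simp_all add: gen_D)
  then have "D [^] c \<otimes> gen T [^] e = gen T [^] e \<otimes> D [^] c"
    by (intro commute_int_pow) simp_all
  then show ?thesis by simp
qed

definition el :: "(bool \<times> int) list \<Rightarrow> 'a" where
  "el L = foldr (\<lambda>(T, e) g. gen T [^] e \<otimes> g) L \<one>"

lemma el_Nil [simp]: "el [] = \<one>" and el_Cons [simp]: "el ((T, e) # L) = gen T [^] e \<otimes> el L"
  by (simp_all add: el_def)

lemma el_closed [simp]: "el L \<in> carrier G"
  by (induction L) auto

lemma el_append: "el (L @ M) = el L \<otimes> el M"
  by (induction L) (auto simp: m_assoc)

lemma D_pow_el: "el L \<otimes> D [^] (c :: int) = D [^] c \<otimes> el L"
proof (induction L)
  case (Cons s L)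
  obtain T e where s: "s = (T, e)" by (cases s)
  have "gen T [^] e \<otimes> el L \<otimes> D [^] c = gen T [^] e \<otimes> D [^] c \<otimes> el L"
    using Cons by (simp add: m_assoc)
  then show ?case by (simp add: s gen_pow_D_pow m_assoc)
qed simp

lemma gen_pow_div_mod: "gen T [^] (e :: int) = D [^] (e div N T) \<otimes> gen T [^] (e mod N T)"
proof (cases "N T = 0")
  case False
  have "gen T [^] e = gen T [^] (N T * (e div N T) + e mod N T)" by simp
  also have "\<dots> = gen T [^] (N T * (e div N T)) \<otimes> gen T [^] (e mod N T)"
    by (simp only: int_pow_mult gen_closed)
  also have "gen T [^] (N T * (e div N T)) = (gen T [^] N T) [^] (e div N T)"
    by (simp add: int_pow_pow)
  finally show ?thesis by (simp add: gen_pow_N False)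
qed simp

lemma el_syllable_Cons: "el (syllable_Cons T e L) = gen T [^] e \<otimes> el L"
  by (simp add: syllable_Cons_def)

lemma gen_pow_el:
  assumes "reduced N L"
  shows "gen T [^] e \<otimes> el L = D [^] fst (act N T e (0, L)) \<otimes> el (snd (act N T e (0, L)))"
proof -
  let ?f = "lead_exponent T L" and ?L = "drop_lead T L"
  have "gen T [^] e \<otimes> el L = gen T [^] e \<otimes> el (syllable_Cons T ?f ?L)"
    using assms by (simp add: drop_lead_reduced)
  also have "\<dots> = gen T [^] (e + ?f) \<otimes> el ?L"
    by (simp add: el_syllable_Cons m_assoc [symmetric] int_pow_mult)
  also have "\<dots> = D [^] ((e + ?f) div N T) \<otimes> gen T [^] ((e + ?f) mod N T) \<otimes> el ?L"
    by (subst gen_pow_div_mod) simp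
  finally show ?thesis by (simp add: el_syllable_Cons m_assoc)
qed

lemma length_act_le: "length (snd (act N T e (c, L))) \<le> Suc (length L)"
  by (auto simp add: syllable_Cons_def drop_lead_def)

text \<open>The length bound matters later: a product in which two syllables merge has a strictly
  shorter normal form.\<close>

lemma normal_form_exists: "\<exists>d r. reduced N r \<and> length r \<le> length L \<and> el L = D [^] (d :: int) \<otimes> el r"
proof (induction L)
  case Nil
  show ?case by (rule exI[of _ 0], rule exI[of _ "[]"]) simp
next
  case (Cons s L)
  obtain T e where s: "s = (T, e)" by (cases s)
  obtain d r where r: "reduced N r" "length r \<le> length L" "el L = D [^] (d :: int) \<otimes> el r"
    using Cons.IH by blast
  let ?a = "act N T e (0, r)"
  have "el (s # L) = D [^] d \<otimes> (gen T [^] e \<otimes> el r)"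
    by (simp add: s r(3) m_assoc [symmetric] gen_pow_D_pow)
  also have "\<dots> = D [^] d \<otimes> (D [^] fst ?a \<otimes> el (snd ?a))"
    by (simp only: gen_pow_el[OF r(1)])
  also have "\<dots> = D [^] (d + fst ?a) \<otimes> el (snd ?a)"
    by (simp add: m_assoc [symmetric] int_pow_mult del: act.simps)
  finally have "el (s # L) = D [^] (d + fst ?a) \<otimes> el (snd ?a)" .
  moreover have "reduced N (snd ?a)" using r(1) by (intro act_reduced) simp
  moreover have "length (snd ?a) \<le> length (s # L)"
    using length_act_le[of T e 0 r] r(2) by (simp del: act.simps)
  ultimately show ?case by blast
qed

lemma carrier_eq_el: "g \<in> carrier G \<Longrightarrow> \<exists>L. g = el L"
  unfolding gens [symmetric]
proof (induction rule: generate.induct)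
  case one
  then show ?case by (metis el_Nil)
next
  case (incl h)
  then obtain T where "h = el [(T, 1)]" by auto
  then show ?case by blast
next
  case (inv h)
  then obtain T where "inv h = el [(T, -1)]" by (auto simp: int_pow_neg)
  then show ?case by blast
next
  case (eng h1 h2)
  then show ?case by (metis el_append)
qed

lemma normal_formE:
  assumes "g \<in> carrier G"
  obtains d r where "reduced N r" "g = D [^] (d :: int) \<otimes> el r"
  using carrier_eq_el[OF assms] normal_form_exists by blast

lemma D_pow_central: "g \<in> carrier G \<Longrightarrow> g \<otimes> D [^] (c :: int) = D [^] c \<otimes> g"
  using carrier_eq_el D_pow_el by blast

lemma rep_inv:
  assumes "g \<in> carrier G" "reduced N (snd s)" "reduced N (snd t)" "rep g t = s"
  shows "rep (inv g) s = t"
proof -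
  have "rep (inv g) (rep g t) = rep (inv g \<otimes> g) t"
    using assms by (simp only: rep_mult inv_closed)
  with assms show ?thesis by (simp add: rep_one)
qed

lemma rep_gen_pow:
  assumes "reduced N (snd s)"
  shows "rep (gen T [^] (e :: int)) s = act N T e s"
proof -
  have nat: "rep (gen T [^] n) t = act N T (int n) t" if "reduced N (snd t)" for t and n :: nat
  proof (induction n)
    case 0
    then show ?case using that by (simp add: rep_one act_0)
  next
    case (Suc n)
    have "gen T [^] Suc n = gen T \<otimes> gen T [^] n"
      by (metis gen_closed nat_pow_Suc2)
    then show ?case
      using that Suc by (simp add: rep_mult rep_gen act_reduced act_add)
  qed
  show ?thesis
  proof (cases e rule: int_cases2)
    case (nonneg n)
    then show ?thesis using nat[OF assms, of n] by (simp add: int_pow_int)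
  next
    case (nonpos n)
    have "rep (gen T [^] n) (act N T e s) = act N T (int n) (act N T e s)"
      using assms by (intro nat act_reduced)
    also have "\<dots> = act N T (int n + e) s"
      using assms by (rule act_add)
    also have "\<dots> = s" using assms nonpos by (simp add: act_0)
    finally have "rep (inv (gen T [^] n)) s = act N T e s"
      using assms by (intro rep_inv) (simp_all add: act_reduced)
    then show ?thesis by (simp add: nonpos int_pow_neg_int)
  qed
qed

lemma rep_D_pow:
  assumes "reduced N L"
  shows "rep (D [^] (k :: int)) (c, L) = (c + k, L)"
proof -
  have "D [^] k = gen False [^] (N False * k)"
    using gen_pow_N[of False] N_False int_pow_pow[OF gen_closed, of False "N False" k] by simp
  then show ?thesis
    using act_multiple[OF assms, of False k c] N_False assms by (simp add: rep_gen_pow del: act.simps)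
qed

text \<open>Acting on the trivial normal form reads off the reduced list, so an element determines
  its normal form.\<close>

lemma rep_el: "reduced N L \<Longrightarrow> rep (el L) (0, []) = (0, L)"
proof (induction L)
  case Nil
  then show ?case by (simp add: rep_one)
next
  case (Cons s L)
  obtain T e where s: "s = (T, e)" by (cases s)
  have L: "reduced N L" "\<not> starts_with T L" "e \<noteq> 0" "e mod N T = e"
    using Cons.prems by (simp_all add: s reduced_Cons)
  have "rep (el (s # L)) (0, []) = act N T e (0, L)"
    using L Cons.IH by (simp add: s rep_mult rep_gen_pow del: act.simps)
  also have "\<dots> = (0, s # L)"
    using L by (simp add: lead_exponent_def drop_lead_def syllable_Cons_def s div_eq_0_of_mod_eq)
  finally show ?case .
qed

lemma normal_form_unique:
  assumes "D [^] (c :: int) \<otimes> el L = D [^] (c' :: int) \<otimes> el L'" "reduced N L" "reduced N L'"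
  shows "c = c'" "L = L'"
proof -
  have "rep (D [^] k \<otimes> el M) (0, []) = (k, M)" if "reduced N M" for k :: int and M
    using that by (simp add: rep_mult rep_el rep_D_pow)
  from this[OF assms(2), of c] this[OF assms(3), of c']
  have "(c, L) = (c', L')" by (simp only: assms(1))
  then show "c = c'" "L = L'" by simp_all
qed

end

section \<open>Conjugacy and the length of conjugacy classes\<close>

text \<open>If \<open>p\<close> is at least as long as a nonempty \<open>w'\<close>, it starts with
  \<open>w'\<close> and can be shortened; if it is shorter, then \<open>w' = p @ s\<close> and
  \<open>w = s @ p\<close>.\<close>

lemma append_eq_append_imp_rotate:
  assumes "p @ w = w' @ p"
  shows "\<exists>n. w' = rotate n w"
  using assms
proof (induction "length p" arbitrary: p rule: less_induct)
  case less
  show ?case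
  proof (cases "length w' \<le> length p \<and> w' \<noteq> []")
    case True
    then obtain p1 where p1: "p = w' @ p1"
      using less.prems by (metis append_eq_append_conv_if append_take_drop_id)
    then have "p1 @ w = w' @ p1" using less.prems by simp
    moreover have "length p1 < length p" using True p1 by simp
    ultimately show ?thesis using less.hyps by blast
  next
    case False
    show ?thesis
    proof (cases "w' = []")
      case True
      then show ?thesis using less.prems by (metis append_Nil append_self_conv rotate_is_Nil_conv)
    next
      case nonempty: False
      with False have "length p < length w'" by simp
      then obtain s where s: "w' = p @ s"
        using less.prems by (metis append_eq_append_conv_if append_take_drop_id less_imp_le)
      then have "w = s @ p" using less.prems by simp
      then have "w' = rotate (length s) w" using s by (simp add: rotate_append)
      then show ?thesis by blast
    qed
  qed
qed

lemma reduced_append: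
  "reduced N (p @ q) \<longleftrightarrow> reduced N p \<and> reduced N q \<and> (p = [] \<or> q = [] \<or> fst (last p) \<noteq> fst (hd q))"
  by (auto simp: reduced_def successively_append_iff)

text \<open>A block \<open>(a, b)\<close> is the product \<open>u^a v^b\<close>. A nonempty list of
  blocks starts with type \<open>True\<close> and ends with type \<open>False\<close>, so its
  syllables alternate cyclically.\<close>

definition flat :: "(int \<times> int) list \<Rightarrow> (bool \<times> int) list" where
  "flat bs = concat (map (\<lambda>(a, b). [(True, a), (False, b)]) bs)"

lemma flat_simps [simp]:
  "flat [] = []" "flat ((a, b) # bs) = (True, a) # (False, b) # flat bs" "flat (bs @ C) = flat bs @ flat C"
  by (simp_all add: flat_def)

lemma length_flat [simp]: "length (flat bs) = 2 * length bs"
  by (induction bs) auto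

lemma flat_eq_iff: "flat bs = flat C \<longleftrightarrow> bs = C"
proof
  assume "flat bs = flat C"
  then show "bs = C"
  proof (induction bs arbitrary: C)
    case Nil
    then show ?case by (cases C) auto
  next
    case (Cons x bs)
    then show ?case by (cases x; cases C) auto
  qed
qed simp

lemma flat_eq_Nil_iff [simp]: "flat bs = [] \<longleftrightarrow> bs = []"
  by (cases bs) auto

lemma hd_flat: "bs \<noteq> [] \<Longrightarrow> fst (hd (flat bs)) = True"
  by (cases bs) auto

lemma last_flat: "bs \<noteq> [] \<Longrightarrow> fst (last (flat bs)) = False"
  by (cases bs rule: rev_cases) auto

lemma rotate_flat: "rotate (2 * k) (flat bs) = flat (rotate k bs)"
proof (induction k)
  case (Suc k)
  have "rotate1 (rotate1 (flat C)) = flat (rotate1 C)" for C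
    by (cases C) auto
  with Suc show ?case by simp
qed simp

text \<open>An odd rotation would start with a syllable of type \<open>False\<close>, so only
  rotations by whole blocks occur.\<close>

lemma flat_eq_rotate_flat:
  assumes "flat bs' = rotate n (flat bs)" "bs \<noteq> []"
  shows "\<exists>k. bs' = rotate k bs"
proof (cases "even n")
  case True
  then obtain k where "n = 2 * k" by (elim evenE)
  with assms show ?thesis by (auto simp: rotate_flat flat_eq_iff)
next
  case False
  then obtain k where k: "n = Suc (2 * k)" by (metis oddE Suc_eq_plus1)
  define C where "C = rotate k bs"
  have "flat bs' = rotate1 (flat C)"
    using assms(1) by (simp add: k rotate_flat C_def)
  moreover have "C \<noteq> []" using assms(2) by (simp add: C_def)
  ultimately show ?thesis by (cases C; cases bs') auto
qed

section \<open>Costs of exponents and windows of central exponents\<close>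

text \<open>For \<open>l \<le> h\<close>, the distance from \<open>q\<close> to the interval from
  \<open>l\<close> to \<open>h\<close>.\<close>

definition gap :: "int \<Rightarrow> int \<Rightarrow> int \<Rightarrow> int" where
  "gap l h q = max 0 (max (l - q) (q - h))"

lemma gap_nonneg: "0 \<le> gap l h q"
  and gap_add: "gap (l1 + l2) (h1 + h2) (q1 + q2) \<le> gap l1 h1 q1 + gap l2 h2 q2"
  and gap_shift: "gap l h (c + q) \<le> gap l h c + \<bar>q\<bar>"
  by (auto simp: gap_def)

text \<open>For a residue \<open>r\<close>, the smallest absolute value of an exponent
  \<open>e\<close> with \<open>e mod n = r\<close>.\<close>

definition syllable_cost :: "int \<Rightarrow> int \<Rightarrow> int" where
  "syllable_cost n r = (if n = 0 then \<bar>r\<bar> else min r (n - r))"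

text \<open>Together with \<open>window_high\<close>, the quotients \<open>q\<close> for which
  \<open>n * q + r\<close> has the smallest absolute value in its residue class: 0 if
  \<open>2 * r < n\<close>, -1 if \<open>2 * r > n\<close>, and both at a tie
  \<open>2 * r = n\<close>. For \<open>n = 0\<close>, where nothing splits off, only 0 is
  allowed.\<close>

definition window_low :: "int \<Rightarrow> int \<Rightarrow> int" where
  "window_low n r = (if 0 < n \<and> n \<le> 2 * r then -1 else 0)"

definition window_high :: "int \<Rightarrow> int \<Rightarrow> int" where
  "window_high n r = (if 0 < n \<and> n < 2 * r then -1 else 0)"

text \<open>The first step of the quotient out of the window raises the absolute value of
  \<open>e\<close> by at least 1, every further one by \<open>n \<ge> 2\<close>.\<close>

lemma syllable_cost_gap_le:
  assumes "n = 0 \<or> 2 \<le> n"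
  shows "syllable_cost n (e mod n) + gap (window_low n (e mod n)) (window_high n (e mod n)) (e div n) \<le> \<bar>e\<bar>"
proof (cases "n = 0")
  case True
  then show ?thesis by (simp add: syllable_cost_def window_low_def window_high_def gap_def)
next
  case False
  with assms have n: "2 \<le> n" by simp
  define q r where "q = e div n" and "r = e mod n"
  have e: "e = n * q + r" and r: "0 \<le> r" "r < n"
    using n by (simp_all add: q_def r_def)
  consider "1 \<le> q" | "q = 0" | "q = -1" | "q \<le> -2" by linarith
  then have "syllable_cost n r + gap (window_low n r) (window_high n r) q \<le> \<bar>e\<bar>"
  proof cases
    case 1
    \<comment> \<open>Supplies a linear lower bound for the product \<open>n * q\<close>, after
      which the case is linear arithmetic.\<close>
    have "(n - 2) * (q - 1) \<ge> 0" using 1 n by simp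
    then have "n * q \<ge> n + 2 * q - 2" by (simp add: algebra_simps)
    then show ?thesis using 1 n r
      unfolding e syllable_cost_def window_low_def window_high_def gap_def by auto
  next
    case 2
    then show ?thesis using n r
      unfolding e syllable_cost_def window_low_def window_high_def gap_def by auto
  next
    case 3
    then show ?thesis using n r
      unfolding e syllable_cost_def window_low_def window_high_def gap_def by auto
  next
    case 4
    have "(n - 2) * (- q - 2) \<ge> 0" using 4 n by (intro mult_nonneg_nonneg) auto
    then have "n * q \<le> - 2 * n + 2 * q + 4" by (simp add: algebra_simps)
    then show ?thesis using 4 n r
      unfolding e syllable_cost_def window_low_def window_high_def gap_def by auto
  qed
  then show ?thesis by (simp add: q_def r_def)
qed

lemma syllable_cost_attained:
  assumes "n = 0 \<or> 2 \<le> n" "r mod n = r" "window_low n r \<le> q" "q \<le> window_high n r"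
  shows "\<bar>n * q + r\<bar> = syllable_cost n r"
proof (cases "n = 0")
  case False
  with assms have n: "2 \<le> n" by simp
  then have r: "0 \<le> r" "r < n"
    using assms(2) pos_mod_bound[of n r] pos_mod_sign[of n r] by auto
  have "q = 0 \<or> q = -1"
    using assms(3,4) by (auto simp: window_low_def window_high_def split: if_splits)
  then show ?thesis
    using assms(3,4) n r by (auto simp: window_low_def window_high_def syllable_cost_def split: if_splits)
qed (simp add: syllable_cost_def)

context central_amalgam
begin

lemma N_cases: "N T = 0 \<or> 2 \<le> N T"
  using N_True N_False by (cases T) auto

text \<open>Either nothing merges at the junction, and then the concatenation is itself the normal
  form, or two syllables become one, and the normal form is strictly shorter.\<close>

lemma el_mult_normal_form:
  assumes "reduced N p" "reduced N q"
  shows "\<exists>d r. el p \<otimes> el q = D [^] (d :: int) \<otimes> el r \<and> reduced N r \<and> length r \<le> length p + length q \<and>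
    (length r = length p + length q \<longrightarrow> d = 0 \<and> r = p @ q)"
proof (cases "p = [] \<or> q = [] \<or> fst (last p) \<noteq> fst (hd q)")
  case True
  then have "reduced N (p @ q)" using assms by (auto simp: reduced_append)
  moreover have "el p \<otimes> el q = D [^] (0 :: int) \<otimes> el (p @ q)" by (simp add: el_append)
  ultimately show ?thesis by (intro exI[of _ "0 :: int"] exI[of _ "p @ q"]) simp
next
  case False
  then obtain p0 x where p: "p = p0 @ [x]" by (metis rev_exhaust)
  obtain y q0 where q: "q = y # q0" using False by (cases q) auto
  obtain T e f where xy: "x = (T, e)" "y = (T, f)"
    using False by (cases x; cases y) (auto simp: p q)
  have "el p \<otimes> el q = el (p0 @ (T, e + f) # q0)"
    by (simp add: p q xy el_append int_pow_mult m_assoc)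
  moreover obtain d r where "reduced N r" "length r \<le> length (p0 @ (T, e + f) # q0)"
    "el (p0 @ (T, e + f) # q0) = D [^] (d :: int) \<otimes> el r"
    using normal_form_exists by blast
  ultimately show ?thesis by (intro exI[of _ d] exI[of _ r]) (auto simp: p q)
qed

text \<open>\<open>p @ w\<close> is already reduced, while the other side has a normal form of at
  most \<open>length w' + length p\<close> syllables. Uniqueness forces equal lengths, so nothing
  merges there either and the equation holds between lists.\<close>

lemma conjugate_normal_form_left:
  assumes w: "reduced N w" "reduced N w'" "length w' \<le> length w"
    and p: "reduced N p" "p = [] \<or> w = [] \<or> fst (last p) \<noteq> fst (hd w)"
    and eq: "el p \<otimes> (D [^] (c :: int) \<otimes> el w) = D [^] (c' :: int) \<otimes> el w' \<otimes> el p"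
  shows "c = c' \<and> p @ w = w' @ p"
proof -
  obtain d r where r: "el w' \<otimes> el p = D [^] (d :: int) \<otimes> el r" "reduced N r"
    "length r \<le> length w' + length p" "length r = length w' + length p \<longrightarrow> d = 0 \<and> r = w' @ p"
    using el_mult_normal_form[OF w(2) p(1)] by blast
  have "D [^] c \<otimes> el (p @ w) = el p \<otimes> (D [^] c \<otimes> el w)"
    by (simp add: el_append m_assoc [symmetric] D_pow_el)
  also have "\<dots> = D [^] (c' + d) \<otimes> el r"
    unfolding eq by (simp add: m_assoc r(1) int_pow_mult)
  finally have "D [^] c \<otimes> el (p @ w) = D [^] (c' + d) \<otimes> el r" .
  moreover have "reduced N (p @ w)" using w p by (auto simp: reduced_append)
  ultimately have "c = c' + d" "p @ w = r" using r(2) by (blast dest: normal_form_unique)+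
  moreover have "length (p @ w) = length p + length w" by simp
  ultimately show ?thesis using r(3,4) w(3) by force
qed

text \<open>The mirror image, applied with the inverse of the conjugator.\<close>

lemma conjugate_normal_form_right:
  assumes w: "reduced N w" "reduced N w'" "length w' \<le> length w"
    and p: "reduced N p" "p = [] \<or> w = [] \<or> fst (last w) \<noteq> fst (hd p)"
    and eq: "D [^] (c :: int) \<otimes> el w \<otimes> el p = el p \<otimes> (D [^] (c' :: int) \<otimes> el w')"
  shows "c = c' \<and> w @ p = p @ w'"
proof -
  obtain d r where r: "el p \<otimes> el w' = D [^] (d :: int) \<otimes> el r" "reduced N r"
    "length r \<le> length p + length w'" "length r = length p + length w' \<longrightarrow> d = 0 \<and> r = p @ w'"
    using el_mult_normal_form[OF p(1) w(2)] by blast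
  have "D [^] c \<otimes> el (w @ p) = D [^] c \<otimes> el w \<otimes> el p"
    by (simp add: el_append m_assoc)
  also have "\<dots> = D [^] c' \<otimes> (el p \<otimes> el w')"
    unfolding eq by (simp add: m_assoc [symmetric] D_pow_el)
  also have "\<dots> = D [^] (c' + d) \<otimes> el r"
    by (simp add: r(1) int_pow_mult m_assoc)
  finally have "D [^] c \<otimes> el (w @ p) = D [^] (c' + d) \<otimes> el r" .
  moreover have "reduced N (w @ p)" using w p by (auto simp: reduced_append)
  ultimately have "c = c' + d" "w @ p = r" using r(2) by (blast dest: normal_form_unique)+
  moreover have "length (w @ p) = length w + length p" by simp
  ultimately show ?thesis using r(3,4) w(3) by force
qed

definition conjugate :: "'a \<Rightarrow> 'a \<Rightarrow> bool" where
  "conjugate g h \<longleftrightarrow> (\<exists>z\<in>carrier G. z \<otimes> g = h \<otimes> z)"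

lemma conjugate_refl [simp]: "g \<in> carrier G \<Longrightarrow> conjugate g g"
  unfolding conjugate_def by (rule bexI[of _ \<one>]) simp_all

lemma conjugate_sym: "conjugate g h \<Longrightarrow> g \<in> carrier G \<Longrightarrow> h \<in> carrier G \<Longrightarrow> conjugate h g"
proof -
  assume gh: "g \<in> carrier G" "h \<in> carrier G" and "conjugate g h"
  then obtain z where z: "z \<in> carrier G" "z \<otimes> g = h \<otimes> z" by (auto simp: conjugate_def)
  have "inv z \<otimes> h = inv z \<otimes> (h \<otimes> z) \<otimes> inv z" using z(1) gh by (simp add: m_assoc)
  also have "\<dots> = inv z \<otimes> (z \<otimes> g) \<otimes> inv z" by (simp only: z(2))
  also have "\<dots> = g \<otimes> inv z" using z(1) gh by (simp add: m_assoc [symmetric])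
  finally show "conjugate h g" using z(1) by (auto simp: conjugate_def)
qed

lemma conjugate_trans:
  assumes "conjugate g h" "conjugate h k" "g \<in> carrier G" "h \<in> carrier G" "k \<in> carrier G"
  shows "conjugate g k"
proof -
  obtain y z where y: "y \<in> carrier G" "y \<otimes> g = h \<otimes> y" and z: "z \<in> carrier G" "z \<otimes> h = k \<otimes> z"
    using assms by (auto simp: conjugate_def)
  have "z \<otimes> y \<otimes> g = z \<otimes> (h \<otimes> y)" using y z assms by (simp add: m_assoc)
  also have "\<dots> = k \<otimes> (z \<otimes> y)" using y z assms by (simp add: m_assoc [symmetric])
  finally show ?thesis using y z by (auto simp: conjugate_def)
qed

lemma conjugate_mult_commute: "g \<in> carrier G \<Longrightarrow> h \<in> carrier G \<Longrightarrow> conjugate (g \<otimes> h) (h \<otimes> g)"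
  unfolding conjugate_def by (rule bexI[of _ h]) (simp_all add: m_assoc)

lemma conjugate_D_pow_mult:
  assumes "conjugate g h" "g \<in> carrier G" "h \<in> carrier G"
  shows "conjugate (D [^] (c :: int) \<otimes> g) (D [^] c \<otimes> h)"
proof -
  obtain z where z: "z \<in> carrier G" "z \<otimes> g = h \<otimes> z" using assms by (auto simp: conjugate_def)
  have "z \<otimes> (D [^] c \<otimes> g) = D [^] c \<otimes> (z \<otimes> g)"
    using z(1) assms by (simp add: m_assoc [symmetric] D_pow_central)
  also have "\<dots> = D [^] c \<otimes> h \<otimes> z"
    using z assms by (simp add: m_assoc)
  finally show ?thesis using z(1) by (auto simp: conjugate_def)
qed

lemma conjugator_mod_D:
  assumes "D [^] (d :: int) \<otimes> y \<otimes> g = h \<otimes> (D [^] d \<otimes> y)"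
    "y \<in> carrier G" "g \<in> carrier G" "h \<in> carrier G"
  shows "y \<otimes> g = h \<otimes> y"
proof -
  have "D [^] d \<otimes> (y \<otimes> g) = D [^] d \<otimes> y \<otimes> g"
    using assms(2-4) by (simp add: m_assoc)
  also have "\<dots> = h \<otimes> D [^] d \<otimes> y"
    using assms by (simp add: m_assoc)
  also have "\<dots> = D [^] d \<otimes> (h \<otimes> y)"
    using assms(2-4) by (simp only: D_pow_central m_assoc int_pow_closed D_closed)
  finally show ?thesis
    using assms(2-4) by (simp only: l_cancel int_pow_closed D_closed m_closed)
qed

text \<open>If the conjugator ends in a syllable of the type that \<open>w\<close> starts with, then its inverse
  starts with a syllable of a type different from the last one of \<open>w\<close>.\<close>

lemma conjugate_cyclically_reduced:
  assumes w: "reduced N w" "w \<noteq> []" "fst (hd w) \<noteq> fst (last w)"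
    and w': "reduced N w'" "length w' \<le> length w"
    and conjugate: "conjugate (D [^] (c :: int) \<otimes> el w) (D [^] (c' :: int) \<otimes> el w')"
  shows "c = c'" "\<exists>n. w' = rotate n w"
proof -
  let ?g = "D [^] c \<otimes> el w" and ?h = "D [^] c' \<otimes> el w'"
  obtain z where z: "z \<in> carrier G" "z \<otimes> ?g = ?h \<otimes> z"
    using conjugate by (auto simp: conjugate_def)
  obtain d p where p: "reduced N p" "z = D [^] (d :: int) \<otimes> el p"
    using normal_formE[OF z(1)] by blast
  have eq: "el p \<otimes> ?g = ?h \<otimes> el p"
    using z(2) unfolding p(2) by (rule conjugator_mod_D) simp_all
  have "c = c' \<and> (\<exists>n. w' = rotate n w)"
  proof (cases "p = [] \<or> fst (last p) \<noteq> fst (hd w)")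
    case True
    then have "c = c' \<and> p @ w = w' @ p"
      using conjugate_normal_form_left[OF w(1) w' p(1) _ eq] by blast
    then show ?thesis using append_eq_append_imp_rotate by blast
  next
    case False
    obtain e p' where p': "reduced N p'" "inv (el p) = D [^] (e :: int) \<otimes> el p'"
      using normal_formE[OF inv_closed[OF el_closed]] by blast
    have "p' \<noteq> [] \<and> fst (hd p') = fst (last p)"
    proof (rule ccontr)
      assume "\<not> ?thesis"
      then have red: "reduced N (p @ p')" using p(1) p'(1) by (auto simp: reduced_append)
      have "D [^] e \<otimes> el (p @ p') = el p \<otimes> (D [^] e \<otimes> el p')"
        by (simp add: el_append m_assoc [symmetric] D_pow_el)
      also have "\<dots> = \<one>"
        by (simp add: p'(2) [symmetric])
      finally have "D [^] e \<otimes> el (p @ p') = D [^] (0 :: int) \<otimes> el []" by simp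
      from normal_form_unique(2)[OF this red] False show False by simp
    qed
    with False w(3) have junction: "fst (last w) \<noteq> fst (hd p')" by simp
    have "inv (el p) \<otimes> (?h \<otimes> el p) \<otimes> inv (el p) = inv (el p) \<otimes> (el p \<otimes> ?g) \<otimes> inv (el p)"
      by (simp only: eq)
    then have "inv (el p) \<otimes> ?h = ?g \<otimes> inv (el p)"
      by (simp add: m_assoc) (simp add: m_assoc [symmetric])
    then have "el p' \<otimes> ?h = ?g \<otimes> el p'"
      unfolding p'(2) by (rule conjugator_mod_D) simp_all
    then have "?g \<otimes> el p' = el p' \<otimes> ?h" by simp
    then have "c = c' \<and> w @ p' = p' @ w'"
      using conjugate_normal_form_right[OF w(1) w' p'(1)] junction by blast
    then have "c = c'" "p' @ w' = w @ p'" by auto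
    moreover obtain n where "w = rotate n w'"
      using append_eq_append_imp_rotate \<open>p' @ w' = w @ p'\<close> by blast
    then have "rotate (length w' - n mod length w') w = w'"
    proof -
      have "w' \<noteq> []" using \<open>w = rotate n w'\<close> w(2) by auto
      then have "(length w' - n mod length w' + n) mod length w' = 0"
        by (metis add.commute le_add_diff_inverse mod_add_left_eq mod_le_divisor mod_self length_greater_0_conv)
      then show ?thesis by (simp add: \<open>w = rotate n w'\<close> rotate_rotate)
    qed
    ultimately show ?thesis by metis
  qed
  then show "c = c'" "\<exists>n. w' = rotate n w" by blast+
qed

end

section \<open>Word length in terms of blocks\<close>

definition raw_cost :: "(int \<times> int) list \<Rightarrow> int" where
  "raw_cost bs = (\<Sum>(a, b)\<leftarrow>bs. \<bar>a\<bar> + \<bar>b\<bar>)"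

lemma raw_cost_simps [simp]:
  "raw_cost [] = 0" "raw_cost ((a, b) # bs) = \<bar>a\<bar> + \<bar>b\<bar> + raw_cost bs"
  "raw_cost (bs @ cs) = raw_cost bs + raw_cost cs"
  by (simp_all add: raw_cost_def)

lemma raw_cost_nonneg [simp]: "0 \<le> raw_cost bs"
  by (induction bs) auto

context central_amalgam
begin

abbreviation letters :: "'a set" where
  "letters \<equiv> range gen \<union> (\<lambda>x. inv x) ` range gen"

abbreviation word_val :: "'a list \<Rightarrow> 'a" where
  "word_val w \<equiv> foldr (\<lambda>h k. h \<otimes> k) w \<one>"

lemma letters_closed: "letters \<subseteq> carrier G"
  by auto

lemma word_val_closed: "set w \<subseteq> letters \<Longrightarrow> word_val w \<in> carrier G"
  by (induction w) auto

lemma word_val_append: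
  "set u \<subseteq> letters \<Longrightarrow> set w \<subseteq> letters \<Longrightarrow> word_val (u @ w) = word_val u \<otimes> word_val w"
proof (induction u)
  case Nil
  then show ?case using word_val_closed[of w] by simp
next
  case (Cons x u)
  have "x \<in> carrier G" using Cons.prems(1) letters_closed by auto
  moreover have "word_val u \<in> carrier G" using Cons.prems(1) by (intro word_val_closed) simp
  moreover have "word_val w \<in> carrier G" using Cons.prems(2) by (rule word_val_closed)
  moreover have "word_val (u @ w) = word_val u \<otimes> word_val w" using Cons by simp
  ultimately show ?case by (simp add: m_assoc)
qed

lemma word_of_gen_pow:
  "\<exists>w. int (length w) = \<bar>e\<bar> \<and> set w \<subseteq> letters \<and> word_val w = gen T [^] (e :: int)"
proof -
  have rep: "((\<otimes>) x ^^ n) \<one> = x [^] n" if "x \<in> carrier G" for x and n :: nat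
  proof (induction n)
    case (Suc n)
    have "x [^] Suc n = x \<otimes> x [^] n" using that by (rule nat_pow_Suc2)
    with Suc show ?case by simp
  qed simp
  show ?thesis
  proof (cases e rule: int_cases2)
    case (nonneg n)
    then show ?thesis
      by (intro exI[of _ "replicate n (gen T)"]) (auto simp: rep int_pow_int)
  next
    case (nonpos n)
    have "inv (gen T) [^] n = inv (gen T [^] n)" by (simp add: nat_pow_inv)
    then show ?thesis
      using nonpos by (intro exI[of _ "replicate n (inv (gen T))"]) (auto simp: rep int_pow_neg_int)
  qed
qed

lemma word_of_blocks:
  "\<exists>w. int (length w) = raw_cost bs \<and> set w \<subseteq> letters \<and> word_val w = el (flat bs)"
proof (induction bs)
  case Nil
  show ?case by (rule exI[of _ "[]"]) simp
next
  case (Cons x bs)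
  obtain a b where x: "x = (a, b)" by (cases x)
  obtain u v w where
    u: "int (length u) = \<bar>a\<bar>" "set u \<subseteq> letters" "word_val u = gen True [^] a" and
    v: "int (length v) = \<bar>b\<bar>" "set v \<subseteq> letters" "word_val v = gen False [^] b" and
    w: "int (length w) = raw_cost bs" "set w \<subseteq> letters" "word_val w = el (flat bs)"
    using word_of_gen_pow Cons.IH by meson
  have "word_val (u @ v @ w) = el (flat (x # bs))"
    using u v w by (simp only: word_val_append set_append Un_subset_iff simp_thms)
      (simp add: x)
  then show ?case using u v w by (intro exI[of _ "u @ v @ w"]) (auto simp: x)
qed

text \<open>A single letter becomes a block whose other exponent is 0. Such blocks are far from
  reduced; \<open>cyclic_reduction\<close> takes care of them.\<close>

lemma blocks_of_word:
  "set w \<subseteq> letters \<Longrightarrow> \<exists>bs. raw_cost bs = int (length w) \<and> el (flat bs) = word_val w"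
proof (induction w)
  case Nil
  show ?case by (rule exI[of _ "[]"]) simp
next
  case (Cons x w)
  then obtain bs where bs: "raw_cost bs = int (length w)" "el (flat bs) = word_val w" by auto
  from Cons.prems obtain T where "x = gen T \<or> x = inv (gen T)" by auto
  then have "x = gen T [^] (1 :: int) \<or> x = gen T [^] (-1 :: int)"
    by (auto simp: int_pow_neg)
  then obtain s where s: "s = 1 \<or> s = -1" "x = gen T [^] (s :: int)"
    by blast
  have val: "el (flat bs) \<in> carrier G" by simp
  show ?case
  proof (cases T)
    case True
    then show ?thesis using s bs val
      by (intro exI[of _ "(s, 0) # bs"]) auto
  next
    case False
    then show ?thesis using s bs val
      by (intro exI[of _ "(0, s) # bs"]) auto
  qed
qed

lemma word_length_le: "int (word_length G (range gen) (el (flat bs))) \<le> raw_cost bs"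
proof -
  obtain w where "int (length w) = raw_cost bs" "set w \<subseteq> letters" "word_val w = el (flat bs)"
    using word_of_blocks by blast
  then show ?thesis
    unfolding word_length_def by (metis (mono_tags, lifting) Least_le of_nat_le_iff)
qed

lemma carrier_eq_flat: "g \<in> carrier G \<Longrightarrow> \<exists>bs. g = el (flat bs)"
proof -
  assume "g \<in> carrier G"
  then obtain L where L: "g = el L" using carrier_eq_el by blast
  have "\<exists>bs. el L = el (flat bs)"
  proof (induction L)
    case Nil
    show ?case by (rule exI[of _ "[]"]) simp
  next
    case (Cons x L)
    then obtain bs where bs: "el L = el (flat bs)" by blast
    obtain T e where "x = (T, e)" by (cases x)
    then show ?case
      using bs by (intro exI[of _ "(if T then (e, 0) else (0, e)) # bs"]) auto
  qed
  with L show ?thesis by blast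
qed

lemma word_length_attained:
  assumes "g \<in> carrier G"
  obtains bs where "g = el (flat bs)" "raw_cost bs = int (word_length G (range gen) g)"
proof -
  obtain cs where "g = el (flat cs)" using carrier_eq_flat[OF assms] by blast
  then obtain w where "set w \<subseteq> letters" "word_val w = g" using word_of_blocks[of cs] by auto
  then have "\<exists>n w. length w = n \<and> set w \<subseteq> letters \<and> word_val w = g" by blast
  then have "\<exists>w. length w = word_length G (range gen) g \<and> set w \<subseteq> letters \<and> word_val w = g"
    unfolding word_length_def by (rule LeastI_ex)
  then obtain w where w: "length w = word_length G (range gen) g" "set w \<subseteq> letters" "word_val w = g" by blast
  with blocks_of_word[OF w(2)] that show ?thesis by metis
qed

definition blocks :: "(int \<times> int) set" where
  "blocks = {(a, b). a \<noteq> 0 \<and> a mod N True = a \<and> b \<noteq> 0 \<and> b mod N False = b}"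

definition block_cost :: "int \<times> int \<Rightarrow> int" where
  "block_cost = (\<lambda>(a, b). syllable_cost (N True) a + syllable_cost (N False) b)"

definition block_low :: "int \<times> int \<Rightarrow> int" where
  "block_low = (\<lambda>(a, b). window_low (N True) a + window_low (N False) b)"

definition block_high :: "int \<times> int \<Rightarrow> int" where
  "block_high = (\<lambda>(a, b). window_high (N True) a + window_high (N False) b)"

definition list_cost :: "(int \<times> int) list \<Rightarrow> int" where "list_cost bs = sum_list (map block_cost bs)"
definition low :: "(int \<times> int) list \<Rightarrow> int" where "low bs = sum_list (map block_low bs)"
definition high :: "(int \<times> int) list \<Rightarrow> int" where "high bs = sum_list (map block_high bs)"

lemma list_simps [simp]:
  "list_cost [] = 0" "list_cost (x # bs) = block_cost x + list_cost bs"
  "low [] = 0" "low (x # bs) = block_low x + low bs"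
  "high [] = 0" "high (x # bs) = block_high x + high bs"
  by (simp_all add: list_cost_def low_def high_def)

lemma list_rotate [simp]:
  "list_cost (rotate n bs) = list_cost bs" "low (rotate n bs) = low bs" "high (rotate n bs) = high bs"
proof -
  have "sum_list (map f (rotate n bs)) = sum_list (map f bs)" for f :: "int \<times> int \<Rightarrow> int"
  proof (induction n)
    case (Suc n)
    have "sum_list (map f (rotate1 cs)) = sum_list (map f cs)" for cs by (cases cs) auto
    with Suc show ?case by simp
  qed simp
  then show "list_cost (rotate n bs) = list_cost bs" "low (rotate n bs) = low bs"
    "high (rotate n bs) = high bs" by (simp_all add: list_cost_def low_def high_def)
qed

lemma reduced_flat: "bs \<in> lists blocks \<Longrightarrow> reduced N (flat bs)"
proof (induction bs)
  case (Cons x bs)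
  obtain a b where x: "x = (a, b)" by (cases x)
  have "\<not> starts_with False (flat bs)"
    by (cases bs) (auto simp: starts_with_def)
  then show ?case using Cons by (simp add: x blocks_def reduced_Cons starts_with_def)
qed simp

text \<open>\<open>conjugate_cyclically_reduced\<close> requires the second list to be no longer. In
  the other case symmetry would make \<open>flat bs\<close> a rotation of the longer
  \<open>flat cs\<close>.\<close>

lemma cyclically_reduced_flat:
  assumes "bs \<in> lists blocks" "cs \<in> lists blocks" "bs \<noteq> []"
    and "conjugate (D [^] (c :: int) \<otimes> el (flat bs)) (D [^] (c' :: int) \<otimes> el (flat cs))"
  shows "c = c' \<and> cs \<in> rotations bs"
proof (cases "length cs \<le> length bs")
  case True
  have "c = c'" "\<exists>n. flat cs = rotate n (flat bs)"
    using assms True reduced_flat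
    by (auto intro!: conjugate_cyclically_reduced[where c = c and c' = c' and w = "flat bs" and w' = "flat cs"]
        simp: hd_flat last_flat)
  then show ?thesis
    using flat_eq_rotate_flat[OF _ assms(3)] unfolding rotations_def by blast
next
  case False
  then have "cs \<noteq> []" by auto
  have "conjugate (D [^] c' \<otimes> el (flat cs)) (D [^] c \<otimes> el (flat bs))"
    using assms(4) by (rule conjugate_sym) simp_all
  then have "\<exists>n. flat bs = rotate n (flat cs)"
    using assms False reduced_flat \<open>cs \<noteq> []\<close>
    by (auto intro!: conjugate_cyclically_reduced(2)[where c = c' and c' = c and w = "flat cs" and w' = "flat bs"]
        simp: hd_flat last_flat)
  then have "length (flat bs) = length (flat cs)" by (metis length_rotate)
  with False show ?thesis by simp
qed

lemma block_mult:
  assumes "gen True [^] (a' :: int) = D [^] (p :: int) \<otimes> gen True [^] (a :: int)"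
    and "gen False [^] (b' :: int) = D [^] (q :: int) \<otimes> gen False [^] (b :: int)"
    and "x = D [^] (c :: int) \<otimes> y" "y \<in> carrier G"
  shows "gen True [^] a' \<otimes> (gen False [^] b' \<otimes> x) =
    D [^] (p + q + c) \<otimes> (gen True [^] a \<otimes> (gen False [^] b \<otimes> y))"
proof -
  have "gen True [^] a' \<otimes> (gen False [^] b' \<otimes> x) =
      D [^] p \<otimes> (gen True [^] a \<otimes> D [^] q) \<otimes> (gen False [^] b \<otimes> D [^] c) \<otimes> y"
    using assms(4) by (simp add: assms(1-3) m_assoc)
  also have "\<dots> = D [^] p \<otimes> (D [^] q \<otimes> gen True [^] a) \<otimes> (D [^] c \<otimes> gen False [^] b) \<otimes> y"
    by (simp only: gen_pow_D_pow)
  also have "\<dots> = D [^] p \<otimes> D [^] q \<otimes> (gen True [^] a \<otimes> D [^] c) \<otimes> gen False [^] b \<otimes> y"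
    using assms(4) by (simp add: m_assoc)
  also have "\<dots> = D [^] p \<otimes> D [^] q \<otimes> (D [^] c \<otimes> gen True [^] a) \<otimes> gen False [^] b \<otimes> y"
    by (simp only: gen_pow_D_pow)
  also have "\<dots> = D [^] (p + q + c) \<otimes> (gen True [^] a \<otimes> (gen False [^] b \<otimes> y))"
    using assms(4) by (simp add: m_assoc int_pow_mult)
  finally show ?thesis .
qed

text \<open>Every exponent is replaced by its residue and the quotients are collected in
  \<open>c\<close>; the bounds of the syllables add up because \<open>gap\<close> is subadditive
  under sums of intervals.\<close>

lemma flat_mod:
  assumes "\<forall>(a, b)\<in>set bs. a mod N True \<noteq> 0 \<and> b mod N False \<noteq> 0"
  shows "\<exists>c cs. cs \<in> lists blocks \<and> length cs = length bs \<and> el (flat bs) = D [^] (c :: int) \<otimes> el (flat cs) \<and>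
    list_cost cs + gap (low cs) (high cs) c \<le> raw_cost bs"
  using assms
proof (induction bs)
  case Nil
  show ?case by (rule exI[of _ 0], rule exI[of _ "[]"]) (simp add: gap_def)
next
  case (Cons x bs)
  obtain a b where x: "x = (a, b)" by (cases x)
  obtain c cs where cs: "cs \<in> lists blocks" "length cs = length bs" "el (flat bs) = D [^] (c :: int) \<otimes> el (flat cs)"
    "list_cost cs + gap (low cs) (high cs) c \<le> raw_cost bs"
    using Cons.IH Cons.prems by auto
  let ?a = "a mod N True" and ?b = "b mod N False" and ?p = "a div N True" and ?q = "b div N False"
  have "(?a, ?b) \<in> blocks" using Cons.prems by (simp add: blocks_def x)
  moreover have "el (flat (x # bs)) = D [^] (?p + ?q + c) \<otimes> el (flat ((?a, ?b) # cs))"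
    unfolding x flat_simps el_Cons
    by (rule block_mult) (simp_all only: gen_pow_div_mod [symmetric] cs(3) el_closed)
  moreover have "list_cost ((?a, ?b) # cs) +
      gap (low ((?a, ?b) # cs)) (high ((?a, ?b) # cs)) (?p + ?q + c) \<le> raw_cost (x # bs)"
    using syllable_cost_gap_le[OF N_cases, of True a] syllable_cost_gap_le[OF N_cases, of False b] cs(4)
    gap_add[of "window_low (N True) ?a" "window_low (N False) ?b" "window_high (N True) ?a" "window_high (N False) ?b" ?p ?q]
    gap_add[of "block_low (?a, ?b)" "low cs" "block_high (?a, ?b)" "high cs" "?p + ?q" c]
    by (simp add: x block_cost_def block_low_def block_high_def)
  ultimately show ?case
    using cs(1,2) by (intro exI[of _ "?p + ?q + c"] exI[of _ "(?a, ?b) # cs"]) simp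
qed

lemma window_le: "window_low n r \<le> window_high n r"
  by (simp add: window_low_def window_high_def)

lemma low_le_high: "low bs \<le> high bs"
proof (induction bs)
  case (Cons x bs)
  then show ?case
    using window_le[of "N True" "fst x"] window_le[of "N False" "snd x"]
    by (simp add: block_low_def block_high_def split_def)
qed simp

lemma gen_pow_residue:
  assumes "r mod N T = r" "window_low (N T) r \<le> q" "q \<le> window_high (N T) r"
  shows "gen T [^] (N T * q + r) = D [^] q \<otimes> gen T [^] r"
proof (cases "N T = 0")
  case True
  then show ?thesis using assms(2,3) by (simp add: window_low_def window_high_def)
next
  case False
  have "(N T * q + r) div N T = q" "(N T * q + r) mod N T = r"
    using False assms(1) by (simp_all add: div_eq_0_of_mod_eq)
  then show ?thesis using gen_pow_div_mod[of T "N T * q + r"] by simp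
qed

text \<open>Lets a central exponent in the window of a list be distributed over the windows of its
  syllables.\<close>

lemma interval_sum_split:
  fixes c :: int
  assumes "l1 \<le> h1" "l2 \<le> h2" "l1 + l2 \<le> c" "c \<le> h1 + h2"
  obtains c1 c2 where "c = c1 + c2" "l1 \<le> c1" "c1 \<le> h1" "l2 \<le> c2" "c2 \<le> h2"
  using that[of "max l1 (c - h2)" "c - max l1 (c - h2)"] assms by auto

lemma blocks_attained:
  assumes "bs \<in> lists blocks" "low bs \<le> c" "c \<le> high bs"
  shows "\<exists>cs. el (flat cs) = D [^] c \<otimes> el (flat bs) \<and> raw_cost cs = list_cost bs"
  using assms
proof (induction bs arbitrary: c rule: list.induct)
  case Nil
  then show ?case by (intro exI[of _ "[]"]) simp
next
  case (Cons x bs)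
  obtain a b where x: "x = (a, b)" by (cases x)
  have ab: "a mod N True = a" "b mod N False = b" using Cons.prems(1) by (simp_all add: x blocks_def)
  have "block_low x \<le> block_high x"
    using window_le[of "N True" a] window_le[of "N False" b] by (simp add: x block_low_def block_high_def)
  then obtain k c2 where k: "c = k + c2" "block_low x \<le> k" "k \<le> block_high x" "low bs \<le> c2" "c2 \<le> high bs"
    using interval_sum_split[of "block_low x" "block_high x" "low bs" "high bs" c] low_le_high[of bs] Cons.prems(2,3)
    by auto
  obtain p q where pq: "k = p + q" "window_low (N True) a \<le> p" "p \<le> window_high (N True) a"
    "window_low (N False) b \<le> q" "q \<le> window_high (N False) b"
    using interval_sum_split[of "window_low (N True) a" "window_high (N True) a"
        "window_low (N False) b" "window_high (N False) b" k] window_le k(2,3)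
    by (auto simp: x block_low_def block_high_def)
  obtain cs where cs: "el (flat cs) = D [^] c2 \<otimes> el (flat bs)" "raw_cost cs = list_cost bs"
    using Cons.IH[of c2] k Cons.prems(1) by auto
  let ?y = "(N True * p + a, N False * q + b)"
  have "el (flat (?y # cs)) = D [^] (p + q + c2) \<otimes> el (flat (x # bs))"
    unfolding x flat_simps el_Cons
    by (rule block_mult) (simp_all only: gen_pow_residue ab pq cs el_closed)
  moreover have "raw_cost (?y # cs) = list_cost (x # bs)"
    using syllable_cost_attained[OF N_cases ab(1) pq(2,3)] syllable_cost_attained[OF N_cases ab(2) pq(4,5)] cs(2)
    by (simp add: x block_cost_def)
  ultimately show ?case using k(1) pq(1) by metis
qed

text \<open>A block with an exponent divisible by the corresponding \<open>N T\<close> is merged into a neighbour;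
  the central power that splits off costs no more than the letters that disappear.\<close>

lemma cyclic_reduction:
  "\<exists>c. (\<exists>cs. cs \<noteq> [] \<and> cs \<in> lists blocks \<and> conjugate (el (flat bs)) (D [^] (c :: int) \<otimes> el (flat cs)) \<and>
        list_cost cs + gap (low cs) (high cs) c \<le> raw_cost bs) \<or>
     (\<exists>T e. conjugate (el (flat bs)) (D [^] c \<otimes> gen T [^] (e :: int)) \<and> \<bar>c\<bar> \<le> raw_cost bs \<and> \<bar>e\<bar> \<le> raw_cost bs)"
proof (induction "length bs" arbitrary: bs rule: less_induct)
  case less
  \<comment> \<open>One reduction step: fewer blocks, and the letters saved pay for the central
    power \<open>q\<close>, since adding \<open>q\<close> to the exponent moves it away from the
    window by at most \<open>\<bar>q\<bar>\<close>.\<close>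
  have split_off: ?case
    if conjugate: "conjugate (el (flat bs)) (D [^] (q :: int) \<otimes> el (flat ds))" and len: "length ds < length bs"
      and cost: "raw_cost ds + \<bar>q\<bar> \<le> raw_cost bs" for q ds
  proof -
    have step: "conjugate (el (flat bs)) (D [^] (q + c) \<otimes> g)"
      if "conjugate (el (flat ds)) (D [^] c \<otimes> g)" "g \<in> carrier G" for c :: int and g
    proof -
      have "conjugate (D [^] q \<otimes> el (flat ds)) (D [^] q \<otimes> (D [^] c \<otimes> g))"
        using that by (intro conjugate_D_pow_mult) simp_all
      then have "conjugate (D [^] q \<otimes> el (flat ds)) (D [^] (q + c) \<otimes> g)"
        using that(2) by (simp add: int_pow_mult m_assoc)
      then show ?thesis using that(2) by (intro conjugate_trans[OF conjugate]) simp_all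
    qed
    obtain c where "(\<exists>cs. cs \<noteq> [] \<and> cs \<in> lists blocks \<and> conjugate (el (flat ds)) (D [^] (c :: int) \<otimes> el (flat cs)) \<and>
        list_cost cs + gap (low cs) (high cs) c \<le> raw_cost ds) \<or>
     (\<exists>T e. conjugate (el (flat ds)) (D [^] c \<otimes> gen T [^] (e :: int)) \<and> \<bar>c\<bar> \<le> raw_cost ds \<and> \<bar>e\<bar> \<le> raw_cost ds)"
      using less.hyps[OF len] by blast
    then show ?thesis
    proof (elim disjE exE conjE)
      fix cs assume cs: "cs \<noteq> []" "cs \<in> lists blocks" "conjugate (el (flat ds)) (D [^] c \<otimes> el (flat cs))"
        "list_cost cs + gap (low cs) (high cs) c \<le> raw_cost ds"
      have "gap (low cs) (high cs) (q + c) \<le> gap (low cs) (high cs) c + \<bar>q\<bar>"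
        using gap_shift[of "low cs" "high cs" c q] by (simp add: add.commute)
      then have "list_cost cs + gap (low cs) (high cs) (q + c) \<le> raw_cost bs"
        using cs(4) cost by linarith
      with cs step[OF cs(3)] show ?thesis by (intro exI[of _ "q + c"]) auto
    next
      fix T and e :: int assume e: "conjugate (el (flat ds)) (D [^] c \<otimes> gen T [^] e)" "\<bar>c\<bar> \<le> raw_cost ds" "\<bar>e\<bar> \<le> raw_cost ds"
      have "\<bar>q + c\<bar> \<le> raw_cost bs" "\<bar>e\<bar> \<le> raw_cost bs" using e(2,3) cost by linarith+
      with step[OF e(1)] show ?thesis by (intro exI[of _ "q + c"]) auto
    qed
  qed
  show ?case
  proof (cases "\<forall>(a, b)\<in>set bs. a mod N True \<noteq> 0 \<and> b mod N False \<noteq> 0")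
    case True
    from flat_mod[OF True] obtain c cs where cs: "cs \<in> lists blocks" "length cs = length bs"
      "el (flat bs) = D [^] (c :: int) \<otimes> el (flat cs)" "list_cost cs + gap (low cs) (high cs) c \<le> raw_cost bs"
      by blast
    show ?thesis
    proof (cases "bs = []")
      case True
      then show ?thesis by (intro exI[of _ 0] disjI2 exI[of _ True] exI[of _ 0]) simp
    next
      case False
      then have "cs \<noteq> []" using cs(2) by auto
      then show ?thesis using cs by (intro exI[of _ c] disjI1 exI[of _ cs]) simp
    qed
  next
    case False
    then have "\<exists>x\<in>set bs. fst x mod N True = 0 \<or> snd x mod N False = 0"
      unfolding split_def by meson
    then obtain a b where ab: "(a, b) \<in> set bs" and bad: "a mod N True = 0 \<or> b mod N False = 0"
      by (metis prod.collapse)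
    obtain P Q where bs: "bs = P @ (a, b) # Q" using split_list[OF ab] by blast
    \<comment> \<open>Conjugation rotates the offending block to the front.\<close>
    define R where "R = Q @ P"
    have rot: "conjugate (el (flat bs)) (el (flat ((a, b) # R)))"
      using conjugate_mult_commute[of "el (flat P)" "el (flat ((a, b) # Q))"]
      by (simp add: bs R_def el_append m_assoc)
    have cost: "raw_cost bs = \<bar>a\<bar> + \<bar>b\<bar> + raw_cost R" and len: "length bs = Suc (length R)"
      by (simp_all add: bs R_def)
    have div_le: "\<bar>e div N T\<bar> \<le> \<bar>e\<bar>" "gen T [^] e = D [^] (e div N T)" if "e mod N T = 0" for e T
    proof -
      show "gen T [^] e = D [^] (e div N T)" using gen_pow_div_mod[of T e] that by simp
      have "e = N T * (e div N T)" using that by (metis add.right_neutral mult_div_mod_eq)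
      then have "\<bar>e\<bar> = \<bar>N T\<bar> * \<bar>e div N T\<bar>" by (metis abs_mult)
      moreover have "N T = 0 \<or> 1 * \<bar>e div N T\<bar> \<le> \<bar>N T\<bar> * \<bar>e div N T\<bar>"
        using N_cases[of T] mult_right_mono[of 1 "\<bar>N T\<bar>" "\<bar>e div N T\<bar>"] by linarith
      ultimately show "\<bar>e div N T\<bar> \<le> \<bar>e\<bar>" by auto
    qed
    show ?thesis
    proof (cases "R = []")
      case True
      from bad show ?thesis
      proof
        assume a: "a mod N True = 0"
        have "el (flat ((a, b) # R)) = D [^] (a div N True) \<otimes> gen False [^] b"
          using True div_le(2)[OF a] by simp
        then have "conjugate (el (flat bs)) (D [^] (a div N True) \<otimes> gen False [^] b) \<and>
            \<bar>a div N True\<bar> \<le> raw_cost bs \<and> \<bar>b\<bar> \<le> raw_cost bs"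
          using rot div_le(1)[OF a] cost raw_cost_nonneg[of R] by (simp del: raw_cost_nonneg)
        then show ?thesis by blast
      next
        assume b: "b mod N False = 0"
        have "el (flat ((a, b) # R)) = D [^] (b div N False) \<otimes> gen True [^] a"
          using True div_le(2)[OF b] by (simp add: gen_pow_D_pow)
        then have "conjugate (el (flat bs)) (D [^] (b div N False) \<otimes> gen True [^] a) \<and>
            \<bar>b div N False\<bar> \<le> raw_cost bs \<and> \<bar>a\<bar> \<le> raw_cost bs"
          using rot div_le(1)[OF b] cost raw_cost_nonneg[of R] by (simp del: raw_cost_nonneg)
        then show ?thesis by blast
      qed
    next
      case False
      from bad show ?thesis
      proof
        assume b: "b mod N False = 0"
        obtain a2 b2 R' where R: "R = (a2, b2) # R'" using False by (cases R) auto
        have "el (flat ((a, b) # R)) = gen True [^] a \<otimes> D [^] (b div N False) \<otimes> el (flat R)"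
          using div_le(2)[OF b] by (simp add: m_assoc)
        also have "\<dots> = D [^] (b div N False) \<otimes> el (flat ((a + a2, b2) # R'))"
          by (simp add: gen_pow_D_pow) (simp add: R int_pow_mult m_assoc)
        finally have "conjugate (el (flat bs)) (D [^] (b div N False) \<otimes> el (flat ((a + a2, b2) # R')))"
          using rot by simp
        then show ?thesis
          by (rule split_off) (use div_le(1)[OF b] cost len abs_triangle_ineq[of a a2] in \<open>auto simp: R\<close>)
      next
        assume a: "a mod N True = 0"
        \<comment> \<open>Once the first exponent has become central, the power of
          \<open>gen False\<close> stands at the front; cyclically it follows the last block and
          joins its second exponent.\<close>
        obtain a2 b2 R' where R: "R = R' @ [(a2, b2)]" using False by (metis rev_exhaust surj_pair)
        have "el (flat ((a, b) # R)) = D [^] (a div N True) \<otimes> (gen False [^] b \<otimes> el (flat R))"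
          using div_le(2)[OF a] by simp
        moreover have "conjugate (gen False [^] b \<otimes> el (flat R)) (el (flat R) \<otimes> gen False [^] b)"
          by (rule conjugate_mult_commute) simp_all
        moreover have "el (flat R) \<otimes> gen False [^] b = el (flat (R' @ [(a2, b2 + b)]))"
          by (simp add: R el_append int_pow_mult m_assoc)
        ultimately have "conjugate (el (flat ((a, b) # R))) (D [^] (a div N True) \<otimes> el (flat (R' @ [(a2, b2 + b)])))"
          by (simp only: conjugate_D_pow_mult m_closed int_pow_closed gen_closed el_closed)
        then have "conjugate (el (flat bs)) (D [^] (a div N True) \<otimes> el (flat (R' @ [(a2, b2 + b)])))"
          by (intro conjugate_trans[OF rot]) simp_all
        then show ?thesis
          by (rule split_off) (use div_le(1)[OF a] cost len abs_triangle_ineq[of b2 b] in \<open>auto simp: R\<close>)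
      qed
    qed
  qed
qed

end

section \<open>Counting conjugacy classes\<close>

text \<open>Each fibre contributes 1 in total.\<close>

lemma card_image_eq_sum_inverse_card_fibres:
  assumes "finite P"
  shows "real (card (f ` P)) = (\<Sum>p\<in>P. 1 / real (card {q \<in> P. f q = f p}))"
proof -
  have "(\<Sum>p\<in>P. 1 / real (card {q \<in> P. f q = f p})) =
      (\<Sum>y\<in>f ` P. \<Sum>p\<in>{p \<in> P. f p = y}. 1 / real (card {q \<in> P. f q = f p}))"
    using assms by (rule sum.image_gen)
  also have "\<dots> = (\<Sum>y\<in>f ` P. 1)"
  proof (rule sum.cong)
    fix y assume "y \<in> f ` P"
    then have "{p \<in> P. f p = y} \<noteq> {}" by auto
    then have "0 < card {p \<in> P. f p = y}" using assms by (simp add: card_gt_0_iff)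
    moreover have "(\<Sum>p\<in>{p \<in> P. f p = y}. 1 / real (card {q \<in> P. f q = f p})) =
        (\<Sum>p\<in>{p \<in> P. f p = y}. 1 / real (card {q \<in> P. f q = y}))"
      by (rule sum.cong) auto
    ultimately show "(\<Sum>p\<in>{p \<in> P. f p = y}. 1 / real (card {q \<in> P. f q = f p})) = 1" by simp
  qed simp
  finally show ?thesis by simp
qed

context central_amalgam
begin

definition conj_class :: "'a \<Rightarrow> 'a set" where
  "conj_class g = {h \<in> carrier G. conjugate g h}"

lemma conj_class_eq_iff:
  assumes "g \<in> carrier G" "h \<in> carrier G"
  shows "conj_class g = conj_class h \<longleftrightarrow> conjugate g h"
proof
  assume "conj_class g = conj_class h"
  moreover have "h \<in> conj_class h" using assms by (simp add: conj_class_def)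
  ultimately have "h \<in> conj_class g" by simp
  then show "conjugate g h" by (simp add: conj_class_def)
next
  assume gh: "conjugate g h"
  then have hg: "conjugate h g" using assms by (rule conjugate_sym)
  show "conj_class g = conj_class h"
  proof (rule Set.set_eqI)
    fix k
    show "k \<in> conj_class g \<longleftrightarrow> k \<in> conj_class h"
      using conjugate_trans[OF hg, of k] conjugate_trans[OF gh, of k] assms unfolding conj_class_def by blast
  qed
qed

lemma conjugacy_classes_eq: "conjugacy_classes G = conj_class ` carrier G"
proof -
  have "orbit G (\<lambda>g. \<lambda>h\<in>carrier G. g \<otimes> h \<otimes> inv g) x = conj_class x" if x: "x \<in> carrier G" for x
  proof -
    have "z \<otimes> x = h \<otimes> z \<longleftrightarrow> h = z \<otimes> x \<otimes> inv z" if "z \<in> carrier G" "h \<in> carrier G" for z h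
      using that x by (metis inv_solve_right m_closed)
    then show ?thesis
      using x by (auto simp: orbit_def conj_class_def conjugate_def)
  qed
  then show ?thesis by (auto simp: conjugacy_classes_def orbits_def)
qed

abbreviation class_length :: "'a \<Rightarrow> nat" where
  "class_length g \<equiv> conjugacy_length G (range gen) (conj_class g)"

lemma class_length_attained:
  assumes "g \<in> carrier G"
  obtains h where "h \<in> carrier G" "conjugate g h" "word_length G (range gen) h = class_length g"
proof -
  have "g \<in> conj_class g" using assms by (simp add: conj_class_def)
  then have "(INF h\<in>conj_class g. word_length G (range gen) h) \<in> word_length G (range gen) ` conj_class g"
    by (intro Inf_nat_def1) blast
  with that show ?thesis by (auto simp: conjugacy_length_def conj_class_def)
qed

lemma class_length_le: "g \<in> carrier G \<Longrightarrow> class_length g \<le> word_length G (range gen) g"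
  unfolding conjugacy_length_def by (intro cINF_lower) (auto simp: conj_class_def)

abbreviation elem :: "int \<Rightarrow> (int \<times> int) list \<Rightarrow> 'a" where
  "elem c w \<equiv> D [^] c \<otimes> el (flat w)"

text \<open>The left element has a normal form with at most one syllable. A nonempty list of blocks
  has at least two and is cyclically reduced, so a conjugate normal form that is no longer would be
  a rotation of it.\<close>

lemma gen_pow_conj_elem:
  assumes "w \<in> lists blocks" "conjugate (D [^] (c :: int) \<otimes> gen T [^] (e :: int)) (elem c' w)"
  shows "w = []"
proof (rule ccontr)
  assume w: "w \<noteq> []"
  obtain d r where r: "reduced N r" "length r \<le> length [(T, e)]" "el [(T, e)] = D [^] (d :: int) \<otimes> el r"
    using normal_form_exists[of "[(T, e)]"] by blast
  then have "D [^] c \<otimes> gen T [^] e = D [^] (c + d) \<otimes> el r"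
    by (simp add: int_pow_mult m_assoc)
  then have "conjugate (elem c' w) (D [^] (c + d) \<otimes> el r)"
    using assms(2) conjugate_sym by simp
  moreover have "length r \<le> length (flat w)" using r(2) w by (cases w) auto
  ultimately obtain n where "r = rotate n (flat w)"
    using conjugate_cyclically_reduced(2)[where w = "flat w" and w' = r] r(1) assms(1) w
    by (auto simp: reduced_flat hd_flat last_flat)
  then have "length r = 2 * length w" by simp
  with r(2) w show False by (cases w) auto
qed

text \<open>Cyclically reducing a shortest representative must return the same exponent
  \<open>c\<close> and a rotation of \<open>w\<close>, so the cost bound of
  \<open>cyclic_reduction\<close> applies to \<open>w\<close> itself.\<close>

lemma class_length_elem_ge:
  assumes "w \<in> lists blocks" "w \<noteq> []"
  shows "list_cost w + gap (low w) (high w) c \<le> int (class_length (elem c w))"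
proof -
  obtain h where h: "h \<in> carrier G" "conjugate (elem c w) h"
    "word_length G (range gen) h = class_length (elem c w)"
    using class_length_attained[of "elem c w"] by auto
  obtain bs where bs: "h = el (flat bs)" "raw_cost bs = int (word_length G (range gen) h)"
    using word_length_attained[OF h(1)] by blast
  from cyclic_reduction[of bs] show ?thesis
  proof (elim exE disjE conjE)
    fix c' :: int and cs
    assume cs: "cs \<noteq> []" "cs \<in> lists blocks" "conjugate (el (flat bs)) (elem c' cs)"
      "list_cost cs + gap (low cs) (high cs) c' \<le> raw_cost bs"
    have "conjugate (elem c w) (elem c' cs)"
      using h(2) cs(3) unfolding bs(1) by (rule conjugate_trans) simp_all
    then have "c = c'" "cs \<in> rotations w"
      using cyclically_reduced_flat[OF assms(1) cs(2) assms(2)] by blast+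
    with cs(4) show ?thesis by (auto simp: rotations_def bs(2) h(3))
  next
    fix c' e :: int and T
    assume "conjugate (el (flat bs)) (D [^] c' \<otimes> gen T [^] e)"
    with h(2) have "conjugate (elem c w) (D [^] c' \<otimes> gen T [^] e)"
      unfolding bs(1) by (rule conjugate_trans) simp_all
    then have "conjugate (D [^] c' \<otimes> gen T [^] e) (elem c w)"
      by (rule conjugate_sym) simp_all
    with assms show ?thesis using gen_pow_conj_elem by blast
  qed
qed

lemma class_length_elem_le:
  assumes "w \<in> lists blocks" "low w \<le> c" "c \<le> high w"
  shows "int (class_length (elem c w)) \<le> list_cost w"
proof -
  obtain cs where cs: "el (flat cs) = elem c w" "raw_cost cs = list_cost w"
    using blocks_attained[OF assms] by blast
  have "class_length (elem c w) \<le> word_length G (range gen) (elem c w)"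
    by (rule class_length_le) simp
  then show ?thesis using word_length_le[of cs] cs by simp
qed

text \<open>In the exceptional case both exponents are bounded by the length, which leaves only
  polynomially many such classes of each length.\<close>

lemma conj_class_elem_or_gen_pow:
  assumes "g \<in> carrier G"
  shows "(\<exists>c w. w \<noteq> [] \<and> w \<in> lists blocks \<and> conj_class g = conj_class (elem c w)) \<or>
    (\<exists>c T e. \<bar>c\<bar> \<le> int (class_length g) \<and> \<bar>e\<bar> \<le> int (class_length g) \<and>
      conj_class g = conj_class (D [^] (c :: int) \<otimes> gen T [^] (e :: int)))"
proof -
  obtain h where h: "h \<in> carrier G" "conjugate g h" "word_length G (range gen) h = class_length g"
    using class_length_attained[OF assms] by auto
  obtain bs where bs: "h = el (flat bs)" "raw_cost bs = int (word_length G (range gen) h)"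
    using word_length_attained[OF h(1)] by blast
  have eq: "conj_class g = conj_class k" if "conjugate (el (flat bs)) k" "k \<in> carrier G" for k
    using conjugate_trans[OF h(2), of k] that h(1) assms by (simp add: conj_class_eq_iff bs(1))
  from cyclic_reduction[of bs] show ?thesis
  proof (elim exE disjE conjE)
    fix c' :: int and cs
    assume "cs \<noteq> []" "cs \<in> lists blocks" "conjugate (el (flat bs)) (elem c' cs)"
    then show ?thesis using eq[of "elem c' cs"] by auto
  next
    fix c' e :: int and T
    assume "conjugate (el (flat bs)) (D [^] c' \<otimes> gen T [^] e)" "\<bar>c'\<bar> \<le> raw_cost bs" "\<bar>e\<bar> \<le> raw_cost bs"
    then show ?thesis using eq[of "D [^] c' \<otimes> gen T [^] e"] h(3) bs(2) by auto
  qed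
qed

lemma conj_class_elem_eq_iff:
  assumes "w \<in> lists blocks" "w \<noteq> []" "w' \<in> lists blocks"
  shows "conj_class (elem c' w') = conj_class (elem c w) \<longleftrightarrow> c' = c \<and> w' \<in> rotations w"
proof
  assume "conj_class (elem c' w') = conj_class (elem c w)"
  then have "conjugate (elem c w) (elem c' w')"
    using conj_class_eq_iff[of "elem c w" "elem c' w'"] by simp
  then show "c' = c \<and> w' \<in> rotations w"
    using cyclically_reduced_flat[OF assms(1,3,2)] by blast
next
  assume r: "c' = c \<and> w' \<in> rotations w"
  have "conjugate (el (flat w)) (el (flat (rotate i w)))" for i
  proof (induction i)
    case (Suc i)
    have "conjugate (el (flat v)) (el (flat (rotate1 v)))" for v
    proof (cases v)
      case (Cons x v')
      then show ?thesis
        using conjugate_mult_commute[of "el (flat [x])" "el (flat v')"]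
          el_append[of "flat [x]" "flat v'"] el_append[of "flat v'" "flat [x]"]
        by (simp flip: flat_simps(3))
    qed simp
    then show ?case using conjugate_trans[OF Suc] by simp
  qed simp
  then have "conjugate (el (flat w)) (el (flat w'))" using r by (auto simp: rotations_def)
  then have "conjugate (elem c w) (elem c w')" by (intro conjugate_D_pow_mult) simp_all
  then show "conj_class (elem c' w') = conj_class (elem c w)"
    using r by (simp add: conj_class_eq_iff conjugate_sym)
qed

definition block_weight :: "int \<times> int \<Rightarrow> nat" where
  "block_weight x = nat (block_cost x)"

text \<open>The number of ties in the block, since a tie widens the window by one.\<close>

definition block_marks :: "int \<times> int \<Rightarrow> nat" where
  "block_marks x = nat (block_high x - block_low x)"

lemma syllable_cost_pos: "r \<noteq> 0 \<Longrightarrow> r mod N T = r \<Longrightarrow> 0 < syllable_cost (N T) r"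
  using N_cases[of T] pos_mod_bound[of "N T" r] pos_mod_sign[of "N T" r]
  by (auto simp: syllable_cost_def)

lemma block_cost_pos: "x \<in> blocks \<Longrightarrow> 0 < block_cost x"
  using syllable_cost_pos[of "fst x" True] syllable_cost_pos[of "snd x" False]
  by (auto simp: blocks_def block_cost_def)

text \<open>Covers syllables of finite and of infinite type at once; it confines the blocks of a
  given cost to a finite box.\<close>

lemma residue_bound:
  assumes "r mod N T = r" "r \<noteq> 0"
  shows "\<bar>r\<bar> \<le> N T + syllable_cost (N T) r"
  using assms syllable_cost_pos[OF assms(2,1)] N_cases[of T] pos_mod_bound[of "N T" r] pos_mod_sign[of "N T" r]
  by (auto simp: syllable_cost_def)

sublocale weighted_alphabet blocks block_weight
proof
  show "0 < block_weight x" if "x \<in> blocks" for x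
    using block_cost_pos[OF that] by (simp add: block_weight_def)
  show "finite {x \<in> blocks. block_weight x = j}" for j
  proof (rule finite_subset)
    let ?K = "\<lambda>T. {- (N T + int j)..N T + int j}"
    show "{x \<in> blocks. block_weight x = j} \<subseteq> ?K True \<times> ?K False"
    proof
      fix x assume x: "x \<in> {x \<in> blocks. block_weight x = j}"
      obtain a b where ab: "x = (a, b)" by (cases x)
      have res: "a \<noteq> 0" "a mod N True = a" "b \<noteq> 0" "b mod N False = b"
        using x by (auto simp: ab blocks_def)
      have "syllable_cost (N True) a + syllable_cost (N False) b = int j"
        using x block_cost_pos[of x] by (auto simp: ab block_weight_def block_cost_def)
      then have "\<bar>a\<bar> \<le> N True + int j" "\<bar>b\<bar> \<le> N False + int j"
        using residue_bound[OF res(2,1)] residue_bound[OF res(4,3)]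
          syllable_cost_pos[OF res(1,2)] syllable_cost_pos[OF res(3,4)] by linarith+
      then show "x \<in> ?K True \<times> ?K False" by (auto simp: ab)
    qed
  qed simp
qed

lemma list_cost_eq: "w \<in> lists blocks \<Longrightarrow> list_cost w = int (word_cost w)"
proof (induction w)
  case (Cons x w)
  then have "int (block_weight x) = block_cost x"
    using block_cost_pos[of x] by (simp add: block_weight_def)
  with Cons show ?case by simp
qed simp

lemma marks_eq: "int (sum_list (map block_marks w)) = high w - low w"
proof (induction w)
  case (Cons x w)
  have "block_low x \<le> block_high x" using low_le_high[of "[x]"] by simp
  with Cons show ?case by (simp add: block_marks_def)
qed simp

definition central_powers :: "nat \<Rightarrow> (int \<times> int) list \<Rightarrow> int set" where
  "central_powers n w = {c. class_length (elem c w) = n}"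

lemma central_powers_eq:
  assumes "w \<in> words n - {[]}"
  shows "central_powers n w = {low w..high w}"
proof -
  have w: "w \<in> lists blocks" "w \<noteq> []" "list_cost w = int n"
    using assms list_cost_eq[of w] by (auto simp: words_def)
  have "class_length (elem c w) = n \<longleftrightarrow> low w \<le> c \<and> c \<le> high w" for c
  proof
    assume "class_length (elem c w) = n"
    then show "low w \<le> c \<and> c \<le> high w"
      using class_length_elem_ge[OF w(1,2), of c] w(3) by (simp add: gap_def)
  next
    assume c: "low w \<le> c \<and> c \<le> high w"
    then have "int (class_length (elem c w)) \<le> int n"
      using class_length_elem_le[OF w(1)] w(3) by simp
    then show "class_length (elem c w) = n"
      using class_length_elem_ge[OF w(1,2), of c] w(3) gap_nonneg[of "low w" "high w" c] by linarith
  qed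
  then have "{c. class_length (elem c w) = n} = {c. low w \<le> c \<and> c \<le> high w}"
    by (simp only:)
  also have "\<dots> = {low w..high w}" by auto
  finally show ?thesis by (simp only: central_powers_def)
qed

text \<open>The distance of \<open>c\<close> from the window adds to the cost \<open>i\<close> and
  the sum does not exceed \<open>n\<close>; inside the window the length would be at most
  \<open>i < n\<close>.\<close>

lemma central_powers_subset:
  assumes "w \<in> words i - {[]}" "i < n"
  shows "central_powers n w \<subseteq> {low w - int (n - i)..<low w} \<union> {high w<..high w + int (n - i)}"
proof
  fix c assume "c \<in> central_powers n w"
  then have c: "class_length (elem c w) = n" by (simp add: central_powers_def)
  have w: "w \<in> lists blocks" "w \<noteq> []" "list_cost w = int i"
    using assms list_cost_eq[of w] by (auto simp: words_def)
  have "\<not> (low w \<le> c \<and> c \<le> high w)"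
    using class_length_elem_le[OF w(1), of c] w(3) c assms(2) by auto
  moreover have "gap (low w) (high w) c \<le> int n - int i"
    using class_length_elem_ge[OF w(1,2), of c] w(3) c by simp
  ultimately show "c \<in> {low w - int (n - i)..<low w} \<union> {high w<..high w + int (n - i)}"
    using assms(2) by (auto simp: gap_def of_nat_diff)
qed

lemma card_central_powers_eq:
  "w \<in> words n - {[]} \<Longrightarrow> card (central_powers n w) = sum_list (map block_marks w) + 1"
  using marks_eq[of w] low_le_high[of w] by (simp add: central_powers_eq)

lemma card_central_powers_le:
  assumes "w \<in> words i - {[]}" "i < n"
  shows "card (central_powers n w) \<le> 2 * (n - i)"
proof -
  have "card (central_powers n w) \<le> card ({low w - int (n - i)..<low w} \<union> {high w<..high w + int (n - i)})"
    using central_powers_subset[OF assms] by (intro card_mono) auto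
  also have "\<dots> \<le> card {low w - int (n - i)..<low w} + card {high w<..high w + int (n - i)}"
    by (rule card_Un_le)
  finally show ?thesis by simp
qed

lemma finite_central_powers:
  assumes "w \<in> words i - {[]}" "i \<le> n"
  shows "finite (central_powers n w)"
proof (cases "i = n")
  case True
  then have "central_powers n w = {low w..high w}" using assms(1) central_powers_eq by simp
  then show ?thesis by simp
next
  case False
  with assms(2) have "i < n" by simp
  from finite_subset[OF central_powers_subset[OF assms(1) this]] show ?thesis by simp
qed

definition cyclic_classes :: "nat \<Rightarrow> 'a set set" where
  "cyclic_classes n = {C. \<exists>c w. w \<noteq> [] \<and> w \<in> lists blocks \<and> C = conj_class (elem c w) \<and>
    conjugacy_length G (range gen) C = n}"

text \<open>A class determines \<open>c\<close> and the rotation class of \<open>w\<close>, so the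
  fibre of \<open>(w, c)\<close> has \<open>card (rotations w)\<close> elements. Tagging pairs with
  the cost \<open>i \<le> n\<close> of \<open>w\<close> splits the finite index set into
  levels.\<close>

lemma card_cyclic_classes:
  "finite (cyclic_classes n)"
  "real (card (cyclic_classes n)) =
    (\<Sum>i\<le>n. \<Sum>w\<in>words i - {[]}. card (central_powers n w) / card (rotations w))"
proof -
  let ?f = "\<lambda>(w, c). conj_class (elem c w)"
  define P where "P = {(w, c). w \<noteq> [] \<and> w \<in> lists blocks \<and> class_length (elem c w) = n}"
  define S where "S = Sigma {..n} (\<lambda>i. Sigma (words i - {[]}) (central_powers n))"
  have PS: "P = snd ` S"
  proof (intro equalityI subsetI)
    fix p assume "p \<in> P"
    then obtain w c where p: "p = (w, c)" "w \<noteq> []" "w \<in> lists blocks" "class_length (elem c w) = n"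
      by (auto simp: P_def)
    have "list_cost w \<le> int n"
      using class_length_elem_ge[OF p(3,2), of c] p(4) gap_nonneg[of "low w" "high w" c] by linarith
    then have "(word_cost w, w, c) \<in> S"
      using p list_cost_eq[OF p(3)] by (auto simp: S_def words_def central_powers_def)
    then show "p \<in> snd ` S" using p(1) by force
  qed (auto simp: P_def S_def words_def central_powers_def)
  have inj: "inj_on snd S"
    by (auto simp: inj_on_def S_def words_def)
  have finite_level: "finite (Sigma (words i - {[]}) (central_powers n))" if "i \<le> n" for i
    using that by (intro finite_SigmaI finite_central_powers) auto
  then have finS: "finite S"
    unfolding S_def by (rule finite_SigmaI[rotated]) auto
  then have finP: "finite P" by (simp add: PS)
  have image: "cyclic_classes n = ?f ` P"
    by (auto simp: cyclic_classes_def P_def image_iff)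
  show "finite (cyclic_classes n)" using finP by (simp add: image)
  have fibre: "card {q \<in> P. ?f q = ?f p} = card (rotations (fst p))" if pP: "p \<in> P" for p
  proof -
    obtain w c where p: "p = (w, c)" "w \<noteq> []" "w \<in> lists blocks" "class_length (elem c w) = n"
      using pP by (auto simp: P_def)
    have "{q \<in> P. ?f q = ?f p} = (\<lambda>v. (v, c)) ` rotations w"
    proof (intro equalityI subsetI)
      fix q assume "q \<in> {q \<in> P. ?f q = ?f p}"
      then obtain v d where q: "q = (v, d)" "v \<in> lists blocks" "conj_class (elem d v) = conj_class (elem c w)"
        by (auto simp: P_def p(1))
      then show "q \<in> (\<lambda>v. (v, c)) ` rotations w"
        using conj_class_elem_eq_iff[OF p(3,2) q(2)] by auto
    next
      fix q assume "q \<in> (\<lambda>v. (v, c)) ` rotations w"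
      then obtain v where q: "q = (v, c)" "v \<in> rotations w" by auto
      then have v: "v \<in> lists blocks" "v \<noteq> []" using p(2,3) by (auto simp: rotations_def)
      then have "conj_class (elem c v) = conj_class (elem c w)"
        using conj_class_elem_eq_iff[OF p(3,2) v(1)] q(2) by simp
      then show "q \<in> {q \<in> P. ?f q = ?f p}" using v p by (simp add: P_def q(1))
    qed
    then show ?thesis by (simp add: card_image inj_on_def p(1))
  qed
  have "real (card (cyclic_classes n)) = (\<Sum>p\<in>P. 1 / card (rotations (fst p)))"
    unfolding image card_image_eq_sum_inverse_card_fibres[OF finP]
    by (intro sum.cong HOL.refl) (simp add: fibre)
  also have "\<dots> = (\<Sum>x\<in>S. 1 / card (rotations (fst (snd x))))"
    unfolding PS by (subst sum.reindex[OF inj]) simp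
  also have "\<dots> = (\<Sum>i\<le>n. \<Sum>q\<in>Sigma (words i - {[]}) (central_powers n). 1 / card (rotations (fst q)))"
    unfolding S_def by (subst sum.Sigma) (auto simp: split_def finite_level)
  also have "\<dots> = (\<Sum>i\<le>n. \<Sum>w\<in>words i - {[]}. \<Sum>c\<in>central_powers n w. 1 / card (rotations w))"
    using finite_central_powers
    by (intro sum.cong HOL.refl, subst sum.Sigma) (auto simp: split_def)
  finally show "real (card (cyclic_classes n)) =
    (\<Sum>i\<le>n. \<Sum>w\<in>words i - {[]}. card (central_powers n w) / card (rotations w))"
    by simp
qed

text \<open>The exceptional classes are given by two exponents between \<open>-n\<close> and
  \<open>n\<close> and a choice of generator, hence the error
  \<open>2 * (2 * n + 1) ^ 2\<close>.\<close>

lemma conjugacy_growth_bounds: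
  "real (card (cyclic_classes n)) \<le> conjugacy_growth G (range gen) n"
  "conjugacy_growth G (range gen) n \<le> card (cyclic_classes n) + 2 * (2 * real n + 1) ^ 2"
proof -
  let ?C = "{C \<in> conjugacy_classes G. conjugacy_length G (range gen) C = n}"
  define Q where "Q = (\<lambda>(c, T, e). conj_class (D [^] c \<otimes> gen T [^] e)) `
    ({- int n..int n} \<times> (UNIV :: bool set) \<times> {- int n..int n})"
  have finQ: "finite Q" unfolding Q_def by simp
  have "?C \<subseteq> cyclic_classes n \<union> Q"
  proof
    fix C assume C: "C \<in> ?C"
    then obtain g where g: "g \<in> carrier G" "C = conj_class g" "class_length g = n"
      by (auto simp: conjugacy_classes_eq)
    from conj_class_elem_or_gen_pow[OF g(1)] show "C \<in> cyclic_classes n \<union> Q"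
    proof (elim disjE exE conjE)
      fix c :: int and w assume "w \<noteq> []" "w \<in> lists blocks" "conj_class g = conj_class (elem c w)"
      then have "C \<in> cyclic_classes n" using g by (auto simp: cyclic_classes_def)
      then show ?thesis by simp
    next
      fix c e :: int and T
      assume "\<bar>c\<bar> \<le> int (class_length g)" "\<bar>e\<bar> \<le> int (class_length g)"
        "conj_class g = conj_class (D [^] c \<otimes> gen T [^] e)"
      then have "C \<in> Q" using g unfolding Q_def
        by (intro image_eqI[of _ _ "(c, T, e)"]) auto
      then show ?thesis by simp
    qed
  qed
  then have "finite ?C" "card ?C \<le> card (cyclic_classes n \<union> Q)"
    using card_cyclic_classes(1)[of n] finQ finite_subset card_mono by (metis finite_UnI)+
  moreover have "card (cyclic_classes n \<union> Q) \<le> card (cyclic_classes n) + card Q" by (rule card_Un_le)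
  moreover have "card Q \<le> card ({- int n..int n} \<times> (UNIV :: bool set) \<times> {- int n..int n})"
    unfolding Q_def by (intro card_image_le) simp
  moreover have "card ({- int n..int n} \<times> (UNIV :: bool set) \<times> {- int n..int n}) = 2 * (2 * n + 1) ^ 2"
    by (simp add: card_cartesian_product power2_eq_square nat_add_distrib nat_mult_distrib algebra_simps)
  ultimately have "card ?C \<le> card (cyclic_classes n) + 2 * (2 * n + 1) ^ 2" by linarith
  then have "real (card ?C) \<le> real (card (cyclic_classes n) + 2 * (2 * n + 1) ^ 2)" by (simp only: of_nat_le_iff)
  then show "conjugacy_growth G (range gen) n \<le> card (cyclic_classes n) + 2 * (2 * real n + 1) ^ 2"
    by (simp add: conjugacy_growth_def add.commute)
  have "cyclic_classes n \<subseteq> ?C"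
    by (auto simp: cyclic_classes_def conjugacy_classes_eq)
  then have "card (cyclic_classes n) \<le> card ?C" using \<open>finite ?C\<close> by (intro card_mono)
  then show "real (card (cyclic_classes n)) \<le> conjugacy_growth G (range gen) n"
    by (simp add: conjugacy_growth_def)
qed

lemma block_marks_le: "block_marks x \<le> 2"
  by (auto simp: block_marks_def block_high_def block_low_def window_high_def window_low_def split_def)

text \<open>For large \<open>j\<close> the unrestricted exponent is determined by \<open>b\<close>
  up to sign, so the blocks of cost \<open>j\<close> are parametrised by a set independent of
  \<open>j\<close>.\<close>

lemma blocks_infinite_type_eq:
  assumes "N True = 0" "N False < int j"
  shows "{x \<in> blocks. block_weight x = j} =
    (\<lambda>(\<epsilon>, b). (\<epsilon> * (int j - syllable_cost (N False) b), b)) ` ({1, -1} \<times> {1..<N False})"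
    (is "?L = ?f ` ?R")
proof (intro equalityI subsetI)
  fix x assume x: "x \<in> ?L"
  obtain a b where ab: "x = (a, b)" by (cases x)
  have res: "a \<noteq> 0" "b \<noteq> 0" "b mod N False = b" using x by (auto simp: ab blocks_def)
  have b: "b \<in> {1..<N False}"
    using res(2,3) pos_mod_bound[of "N False" b] pos_mod_sign[of "N False" b] N_False by auto
  have "\<bar>a\<bar> + syllable_cost (N False) b = int j"
    using x block_cost_pos[of x] assms(1) by (auto simp: ab block_weight_def block_cost_def syllable_cost_def)
  then have "x = ?f (1, b) \<or> x = ?f (-1, b)" by (auto simp: ab abs_if split: if_splits)
  then show "x \<in> ?f ` ?R" using b by blast
next
  fix x assume "x \<in> ?f ` ?R"
  then obtain y where y: "x = ?f y" "y \<in> ?R" by blast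
  obtain \<epsilon> b where "y = (\<epsilon>, b)" by (cases y)
  with y have x: "x = (\<epsilon> * (int j - syllable_cost (N False) b), b)"
    and \<epsilon>: "\<epsilon> = 1 \<or> \<epsilon> = -1" and b: "1 \<le> b" "b < N False" by auto
  define k where "k = int j - syllable_cost (N False) b"
  have k: "0 < k" using b assms(2) N_False by (simp add: k_def syllable_cost_def)
  have "b mod N False = b" using b by simp
  then have "x \<in> blocks" using \<epsilon> k b assms(1) by (auto simp: x blocks_def k_def [symmetric])
  moreover have "block_cost x = int j"
    using \<epsilon> k assms(1) by (auto simp: x block_cost_def syllable_cost_def[of 0] k_def [symmetric]) (simp_all add: k_def)
  then have "block_weight x = j" by (simp add: block_weight_def)
  ultimately show "x \<in> ?L" by simp
qed

text \<open>If \<open>N True = 0\<close>, then \<open>\<phi>\<close> depends only on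
  \<open>b\<close> and the parametrising set of signs and residues no longer changes; otherwise
  block costs are bounded and the sum is eventually 0.\<close>

lemma eventually_constant_letter_sum:
  fixes \<phi> :: "int \<times> int \<Rightarrow> nat"
  assumes "\<And>a b. N True = 0 \<Longrightarrow> \<phi> (a, b) = \<phi> (0, b)"
  obtains J k where "\<And>j. J \<le> j \<Longrightarrow> (\<Sum>x | x \<in> blocks \<and> block_weight x = j. \<phi> x) = k"
proof (cases "N True = 0")
  case True
  have "(\<Sum>x | x \<in> blocks \<and> block_weight x = j. \<phi> x) = (\<Sum>(\<epsilon>, b)\<in>{1, -1 :: int} \<times> {1..<N False}. \<phi> (0, b))"
    if "nat (N False) + 1 \<le> j" for j
  proof -
    have j: "N False < int j" using that N_False by linarith
    have inj: "inj_on (\<lambda>(\<epsilon>, b). (\<epsilon> * (int j - syllable_cost (N False) b), b)) ({1, -1} \<times> {1..<N False})"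
      using j by (auto simp: inj_on_def syllable_cost_def)
    show ?thesis
      unfolding blocks_infinite_type_eq[OF True j] sum.reindex[OF inj]
    proof (rule sum.cong)
      fix p assume "p \<in> {1, -1 :: int} \<times> {1..<N False}"
      obtain \<epsilon> b where p: "p = (\<epsilon>, b)" by (cases p)
      have "\<phi> (\<epsilon> * (int j - syllable_cost (N False) b), b) = \<phi> (0, b)" by (rule assms[OF True])
      then show "(\<phi> \<circ> (\<lambda>(\<epsilon>, b). (\<epsilon> * (int j - syllable_cost (N False) b), b))) p = (case p of (\<epsilon>, b) \<Rightarrow> \<phi> (0, b))"
        by (simp add: p)
    qed simp
  qed
  then show ?thesis by (rule that)
next
  case False
  have "(\<Sum>x | x \<in> blocks \<and> block_weight x = j. \<phi> x) = 0" if "nat (N True + N False) + 1 \<le> j" for j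
  proof -
    have "x \<notin> blocks \<or> block_weight x \<noteq> j" for x
    proof (rule ccontr)
      assume "\<not> ?thesis"
      then have x: "x \<in> blocks" "block_weight x = j" by auto
      have "block_cost x \<le> N True + N False"
        using x(1) False N_cases[of True] N_False pos_mod_sign[of "N True" "fst x"] pos_mod_sign[of "N False" "snd x"]
          pos_mod_bound[of "N True" "fst x"] pos_mod_bound[of "N False" "snd x"]
        by (auto simp: block_cost_def blocks_def syllable_cost_def)
      with x(2) that block_cost_pos[OF x(1)] show False by (simp add: block_weight_def)
    qed
    then show ?thesis by (metis (mono_tags, lifting) sum.neutral mem_Collect_eq)
  qed
  then show ?thesis by (rule that)
qed

text \<open>Besides \<open>(1, 1)\<close> there is a block with an exponent -1, written as the
  residue \<open>N T - 1\<close> unless \<open>N T = 0\<close>. It is a different block once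
  \<open>N T \<noteq> 2\<close>; with both values equal to 2, \<open>(1, 1)\<close> would be the
  only block.\<close>

lemma two_le_num_letters_2:
  assumes "\<not> (N True = 2 \<and> N False = 2)"
  shows "2 \<le> num_letters 2"
proof -
  obtain y where y: "y \<in> blocks" "block_cost y = 2" "y \<noteq> (1, 1)"
  proof -
    consider "N True = 0" | "2 \<le> N True" "3 \<le> N False" | "3 \<le> N True"
      using N_cases[of True] N_False assms by linarith
    then show thesis
    proof cases
      case 1
      then show thesis using N_False
        by (intro that[of "(-1, 1)"]) (auto simp: blocks_def block_cost_def syllable_cost_def)
    next
      case 2
      then show thesis
        by (intro that[of "(1, N False - 1)"]) (auto simp: blocks_def block_cost_def syllable_cost_def zmod_minus1)
    next
      case 3
      then show thesis using N_False
        by (intro that[of "(N True - 1, 1)"]) (auto simp: blocks_def block_cost_def syllable_cost_def zmod_minus1)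
    qed
  qed
  have one: "(1, 1) \<in> blocks" "block_cost (1, 1) = 2"
    using N_cases[of True] N_False by (auto simp: blocks_def block_cost_def syllable_cost_def)
  have "card {(1, 1), y} \<le> card {x \<in> blocks. block_weight x = 2}"
    using y one finite_cost[of 2] by (intro card_mono) (auto simp: block_weight_def)
  then show ?thesis using y(3) by (simp add: num_letters_def)
qed

theorem transcendental_conjugacy_growth_series:
  assumes "\<not> (N True = 2 \<and> N False = 2)"
  shows "transcendental_series (conjugacy_growth_series G (range gen))"
proof -
  obtain J k where J: "\<And>j. J \<le> j \<Longrightarrow> (\<Sum>x | x \<in> blocks \<and> block_weight x = j. 1) = (k :: nat)"
    by (rule eventually_constant_letter_sum[of "\<lambda>_. 1"]) auto
  then have num: "num_letters j = k" if "J \<le> j" for j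
    using that by (simp add: num_letters_def)
  obtain J' k' where marks: "\<And>j. J' \<le> j \<Longrightarrow> (\<Sum>x | x \<in> blocks \<and> block_weight x = j. block_marks x) = k'"
    by (rule eventually_constant_letter_sum[of block_marks])
      (auto simp: block_marks_def block_high_def block_low_def window_high_def window_low_def)
  have "num_letters j \<le> (\<Sum>i\<le>J. num_letters i) + k" for j
    using member_le_sum[of j "{..J}" num_letters] num[of j] by (cases "j \<le> J") auto
  then obtain \<rho> \<mu> where "critical_alphabet blocks block_weight \<rho> \<mu>"
    using critical_alphabet_exists two_le_num_letters_2[OF assms] by blast
  then interpret C: critical_alphabet blocks block_weight \<rho> \<mu> .
  have level: "(\<Sum>w\<in>words n - {[]}. card (central_powers n w) / card (rotations w)) =
      (\<Sum>w\<in>words n - {[]}. real (sum_list (map block_marks w) + 1) / card (rotations w))" for n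
    by (intro sum.cong HOL.refl) (simp add: card_central_powers_eq)
  have split: "real (card (cyclic_classes n)) =
      (\<Sum>i<n. \<Sum>w\<in>words i - {[]}. card (central_powers n w) / card (rotations w)) +
      (\<Sum>w\<in>words n - {[]}. real (sum_list (map block_marks w) + 1) / card (rotations w))" for n
  proof -
    have "{..n} = insert n {..<n}" by auto
    then show ?thesis unfolding card_cyclic_classes(2) level [symmetric] by simp
  qed
  have "transcendental_series (Abs_fps (\<lambda>n. of_nat (conjugacy_growth G (range gen) n)))"
  proof (rule C.transcendental_series_of_cyclic_words[where h = block_marks])
    show "block_marks x \<le> 2" for x by (rule block_marks_le)
    show "fps_to_fls (Abs_fps (\<lambda>j. of_nat (num_letters j))) \<in> rational_functions"
      by (rule rational_functions_eventually_constant[of J _ "of_nat k"]) (simp add: num)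
    show "fps_to_fls (Abs_fps (\<lambda>j. of_nat (\<Sum>x | x \<in> blocks \<and> block_weight x = j. block_marks x))) \<in> rational_functions"
      by (rule rational_functions_eventually_constant[of J' _ "of_nat k'"]) (simp only: marks)
    show "(\<Sum>w\<in>words n - {[]}. real (sum_list (map block_marks w) + 1) / card (rotations w))
        \<le> real (conjugacy_growth G (range gen) n)" for n
    proof -
      have "0 \<le> (\<Sum>i<n. \<Sum>w\<in>words i - {[]}. real (card (central_powers n w)) / card (rotations w))"
        by (intro sum_nonneg) simp
      then show ?thesis using split[of n] conjugacy_growth_bounds(1)[of n] by linarith
    qed
    show "real (conjugacy_growth G (range gen) n) \<le>
        (\<Sum>w\<in>words n - {[]}. real (sum_list (map block_marks w) + 1) / card (rotations w)) +
        (\<Sum>i<n. real (2 * (n - i)) * C.cyclic_count i) + 2 * (2 * real n + 1) ^ 2" for n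
    proof -
      have "(\<Sum>w\<in>words i - {[]}. card (central_powers n w) / card (rotations w)) \<le> real (2 * (n - i)) * C.cyclic_count i"
        if "i < n" for i
        unfolding C.cyclic_count_def sum_distrib_left
      proof (rule sum_mono)
        fix w assume "w \<in> words i - {[]}"
        then have "real (card (central_powers n w)) \<le> real (2 * (n - i))"
          using card_central_powers_le[OF _ that] by (simp only: of_nat_le_iff)
        then show "card (central_powers n w) / card (rotations w) \<le> real (2 * (n - i)) * (1 / card (rotations w))"
          by (simp add: divide_right_mono)
      qed
      then have "(\<Sum>i<n. \<Sum>w\<in>words i - {[]}. card (central_powers n w) / card (rotations w)) \<le>
          (\<Sum>i<n. real (2 * (n - i)) * C.cyclic_count i)"
        by (intro sum_mono) simp
      then show ?thesis using split[of n] conjugacy_growth_bounds(2)[of n] by linarith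
    qed
  qed
  then show ?thesis by (simp add: conjugacy_growth_series_def)
qed

end

section \<open>Dihedral Artin groups as central amalgams\<close>

text \<open>With \<open>foldr\<close> the last letter acts first, as in left multiplication by a
  word.\<close>

definition run :: "('g \<times> bool \<Rightarrow> 's \<Rightarrow> 's) \<Rightarrow> 'g word \<Rightarrow> 's \<Rightarrow> 's" where
  "run \<phi> w s = foldr \<phi> w s"

lemma run_simps [simp]:
  "run \<phi> [] s = s" "run \<phi> (l # w) s = \<phi> l (run \<phi> w s)" "run \<phi> (u @ v) s = run \<phi> u (run \<phi> v s)"
  by (simp_all add: run_def)

lemma run_word_eq:
  assumes closed: "\<And>l s. P s \<Longrightarrow> P (\<phi> l s)"
    and cancel: "\<And>g e s. P s \<Longrightarrow> \<phi> (g, e) (\<phi> (g, \<not> e) s) = s"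
    and relations: "\<And>u v s. (u, v) \<in> R \<Longrightarrow> P s \<Longrightarrow> run \<phi> u s = run \<phi> v s"
    and "word_eq R u v" "P s"
  shows "run \<phi> u s = run \<phi> v s"
proof -
  have run_closed: "P (run \<phi> w s)" if "P s" for w s
    using that closed by (induction w) auto
  from \<open>word_eq R u v\<close> have "\<forall>s. P s \<longrightarrow> run \<phi> u s = run \<phi> v s"
    by (induction rule: word_eq.induct) (auto simp: relations cancel run_closed)
  with \<open>P s\<close> show ?thesis by blast
qed

text \<open>The choice of the representative does not matter on states where equal words act
  equally, which will be the reduced normal forms.\<close>

definition class_run :: "('g \<times> bool \<Rightarrow> 's \<Rightarrow> 's) \<Rightarrow> 'g word set \<Rightarrow> 's \<Rightarrow> 's" where
  "class_run \<phi> g s = run \<phi> (SOME u. u \<in> g) s"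

lemma class_run_word_class:
  assumes "\<And>u v. word_eq R u v \<Longrightarrow> run \<phi> u s = run \<phi> v s"
  shows "class_run \<phi> (word_class R u) s = run \<phi> u s"
proof -
  have "u \<in> word_class R u" by (simp add: word_class_def word_eq.refl)
  then have "(SOME v. v \<in> word_class R u) \<in> word_class R u" by (rule someI)
  then have "word_eq R u (SOME v. v \<in> word_class R u)" by (simp add: word_class_def)
  from assms[OF this] show ?thesis by (simp add: class_run_def)
qed

lemma alternating_even: "alternating (2 * k) s t = concat (replicate k [s, t])"
  by (induction k) auto

lemma alternating_odd: "alternating (Suc (2 * k)) s t = concat (replicate k [s, t]) @ [s]"
  by (induction k) auto

abbreviation (input) wA :: "artin_gen \<times> bool" where "wA \<equiv> (artin_gen.A, True)"
abbreviation (input) wB :: "artin_gen \<times> bool" where "wB \<equiv> (artin_gen.B, True)"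

text \<open>Orders modulo the central element: 2 and \<open>m\<close> from \<open>x^2 = y^m\<close>;
  for \<open>m = 2p\<close>, infinite order (coded as 0) for \<open>a\<close>, and \<open>p\<close>
  for \<open>ab\<close>.\<close>

definition artin_N :: "nat \<Rightarrow> bool \<Rightarrow> int" where
  "artin_N m T = (if odd m then (if T then 2 else int m) else (if T then 0 else int (m div 2)))"

text \<open>For both parities \<open>False\<close> is assigned the element \<open>ab\<close>, which
  has a central power.\<close>

definition artin_gen_elem :: "nat \<Rightarrow> bool \<Rightarrow> artin_gen word set" where
  "artin_gen_elem m T = (if T = odd m then artin_x m else artin_y m)"

text \<open>For odd \<open>m = 2q + 1\<close> one has \<open>a = y\<^sup>-\<^sup>q x\<close> and \<open>b = x\<^sup>-\<^sup>1 y\<^sup>q\<^sup>+\<^sup>1\<close>; for even \<open>m\<close> one has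
  \<open>a = y\<close> and \<open>b = y\<^sup>-\<^sup>1 x\<close>.\<close>

fun artin_act :: "nat \<Rightarrow> artin_gen \<times> bool \<Rightarrow> int \<times> (bool \<times> int) list \<Rightarrow> int \<times> (bool \<times> int) list" where
  "artin_act m (artin_gen.A, True) s = (if odd m
     then act (artin_N m) False (- int (m div 2)) (act (artin_N m) True 1 s)
     else act (artin_N m) True 1 s)"
| "artin_act m (artin_gen.A, False) s = (if odd m
     then act (artin_N m) True (-1) (act (artin_N m) False (int (m div 2)) s)
     else act (artin_N m) True (-1) s)"
| "artin_act m (artin_gen.B, True) s = (if odd m
     then act (artin_N m) True (-1) (act (artin_N m) False (int (m div 2) + 1) s)
     else act (artin_N m) True (-1) (act (artin_N m) False 1 s))"
| "artin_act m (artin_gen.B, False) s = (if odd m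
     then act (artin_N m) False (- (int (m div 2) + 1)) (act (artin_N m) True 1 s)
     else act (artin_N m) False (-1) (act (artin_N m) True 1 s))"

lemma artin_act_reduced:
  "reduced (artin_N m) (snd s) \<Longrightarrow> reduced (artin_N m) (snd (artin_act m l s))"
  by (cases "(m, l, s)" rule: artin_act.cases) (simp_all add: act_reduced del: act.simps)

lemma artin_act_cancel:
  "reduced (artin_N m) (snd s) \<Longrightarrow> artin_act m (g, e) (artin_act m (g, \<not> e) s) = s"
  by (cases g; cases e) (simp_all add: act_reduced act_add act_0 del: act.simps)

text \<open>In both parities the formulas for \<open>a\<close> and \<open>b\<close> multiply to the
  generator of type \<open>False\<close>.\<close>

lemma run_ab_power:
  assumes "reduced (artin_N m) (snd s)"
  shows "run (artin_act m) (concat (replicate k [wA, wB])) s = act (artin_N m) False (int k) s"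
  using assms
proof (induction k arbitrary: s)
  case 0
  then show ?case by (simp add: act_0 del: act.simps)
next
  case (Suc k)
  then show ?case by (simp add: act_reduced act_add act_0 add.commute del: act.simps)
qed

lemma act_N:
  assumes "reduced (artin_N m) (snd s)" "artin_N m T \<noteq> 0"
  shows "act (artin_N m) T (artin_N m T) s = (fst s + 1, snd s)"
  using act_multiple[of "artin_N m" "snd s" T 1 "fst s"] assms by (simp del: act.simps)

text \<open>For \<open>m = 2q + 1\<close> both sides act as \<open>x\<close>:
  \<open>(ab)^q a = y^q y^-q x\<close>, and
  \<open>b (ab)^q = x^-1 y^(q+1) y^q = x^-1 y^m = x^-1 x^2\<close>. For \<open>m = 2p\<close> the
  left side is the central shift, and cancelling \<open>a\<close> in
  \<open>a (ba)^p = (ab)^p a\<close> shows the same for the right side.\<close>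

lemma run_artin_relation:
  assumes "3 \<le> m" "reduced (artin_N m) (snd s)"
  shows "run (artin_act m) (alternating m wA wB) s = run (artin_act m) (alternating m wB wA) s"
proof (cases "odd m")
  case True
  then obtain q where q: "m = Suc (2 * q)" by (metis oddE Suc_eq_plus1)
  let ?N = "artin_N m"
  have red: "reduced ?N (snd (act ?N T e s))" for T e using assms(2) by (rule act_reduced)
  have "run (artin_act m) (alternating m wA wB) s = act ?N False (int q) (artin_act m wA s)"
    using artin_act_reduced[OF assms(2), of wA]
    by (simp only: q alternating_odd run_simps) (simp add: run_ab_power del: act.simps artin_act.simps)
  also have "\<dots> = act ?N True 1 s"
    using red assms(2) True by (simp add: q act_add act_0 del: act.simps)
  also have "\<dots> = act ?N True (-1) (act ?N True 2 s)"
    using assms(2) by (simp add: act_add del: act.simps)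
  also have "act ?N True 2 s = act ?N False (int m) s"
    using act_N[OF assms(2), of True] act_N[OF assms(2), of False] True assms(1)
    by (simp add: artin_N_def del: act.simps)
  also have "act ?N True (-1) (act ?N False (int m) s) = artin_act m wB (act ?N False (int q) s)"
    using assms(2) True by (simp add: q act_add add.commute del: act.simps)
  also have "\<dots> = run (artin_act m) (alternating m wB wA) s"
    using assms(2) by (simp add: q alternating_even run_ab_power del: act.simps artin_act.simps)
  finally show ?thesis .
next
  case False
  then have "even m" by simp
  then obtain p where p: "m = 2 * p" by (elim evenE)
  let ?N = "artin_N m"
  have N: "?N False = int p" "?N False \<noteq> 0" using p assms(1) by (auto simp: artin_N_def)
  have shift: "run (artin_act m) (alternating m wA wB) t = (fst t + 1, snd t)" if "reduced ?N (snd t)" for t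
    using run_ab_power[OF that, of p] act_N[OF that N(2)] N(1)
    by (simp add: p alternating_even del: act.simps)
  let ?r = "run (artin_act m) (alternating m wB wA) s"
  have "reduced ?N (snd (run (artin_act m) w s))" for w
    using assms(2) by (induction w) (simp_all add: artin_act_reduced)
  then have red: "reduced ?N (snd ?r)" .
  have "artin_act m wA ?r = run (artin_act m) (alternating (Suc m) wA wB) s" by simp
  also have "\<dots> = run (artin_act m) (alternating m wA wB) (artin_act m wA s)"
    by (simp only: p alternating_odd alternating_even run_simps)
  also have "\<dots> = artin_act m wA (fst s + 1, snd s)"
    using shift[of "artin_act m wA s"] artin_act_reduced[OF assms(2), of wA] act_shift[of ?N True 1 "fst s" 1 "snd s"] False
    by (simp del: act.simps add: add.commute)
  finally have "artin_act m (artin_gen.A, \<not> True) (artin_act m wA ?r) =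
      artin_act m (artin_gen.A, \<not> True) (artin_act m wA (fst s + 1, snd s))"
    by (rule arg_cong)
  then have "?r = (fst s + 1, snd s)"
    using artin_act_cancel[OF red, of artin_gen.A False] artin_act_cancel[of m "(fst s + 1, snd s)" artin_gen.A False] assms(2)
    by (simp del: act.simps artin_act.simps)
  then show ?thesis using shift[OF assms(2)] by simp
qed

lemma word_class_pow:
  "word_class R w [^]\<^bsub>presented_group R\<^esub> (k :: nat) = word_class R (concat (replicate k w))"
proof -
  interpret group "presented_group R" by (rule group_presented_group)
  have closed: "word_class R w \<in> carrier (presented_group R)" by (simp add: presented_group_def)
  show ?thesis
  proof (induction k)
    case 0
    then show ?case by (simp add: presented_group_def)
  next
    case (Suc k)
    then show ?case using nat_pow_Suc2[OF closed, of k] by (simp add: mult_word_class)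
  qed
qed

lemma artin_gen_elem_eq:
  "artin_gen_elem m True = word_class (artin_relations m) (if odd m then alternating m wA wB else [wA])"
  "artin_gen_elem m False = word_class (artin_relations m) [wA, wB]"
  by (auto simp: artin_gen_elem_def artin_x_def artin_y_def)

lemma range_artin_gen_elem: "range (artin_gen_elem m) = free_product_gens m"
proof -
  have "range (artin_gen_elem m) = {artin_gen_elem m True, artin_gen_elem m False}"
    by (simp add: UNIV_bool insert_commute)
  also have "\<dots> = free_product_gens m"
    by (cases "odd m") (auto simp: artin_gen_elem_def free_product_gens_def)
  finally show ?thesis .
qed

text \<open>For odd \<open>m\<close>, rewriting the second factor of \<open>x^2\<close> by the
  relation gives \<open>(ab)^q a b (ab)^q = (ab)^m\<close>. For even \<open>m\<close>,
  \<open>(ab)^p\<close> commutes with \<open>a\<close> because \<open>a (ba)^p = (ab)^p a\<close>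
  and the relation identifies \<open>(ba)^p\<close> with \<open>(ab)^p\<close>.\<close>

lemma central_amalgam_dihedral_artin:
  assumes "3 \<le> m"
  shows "central_amalgam (dihedral_artin m) (artin_gen_elem m)
    (artin_gen_elem m False [^]\<^bsub>dihedral_artin m\<^esub> artin_N m False) (artin_N m) (class_run (artin_act m))"
proof -
  let ?R = "artin_relations m"
  let ?G = "dihedral_artin m" and ?N = "artin_N m" and ?gen = "artin_gen_elem m"
  let ?D = "?gen False [^]\<^bsub>?G\<^esub> ?N False"
  interpret group ?G
    unfolding dihedral_artin_def by (rule group_presented_group)
  have mult: "word_class ?R u \<otimes>\<^bsub>?G\<^esub> word_class ?R v = word_class ?R (u @ v)" for u v
    unfolding dihedral_artin_def by (rule mult_word_class)
  have one: "\<one>\<^bsub>?G\<^esub> = word_class ?R []"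
    by (simp add: dihedral_artin_def presented_group_def)
  have carrier: "carrier ?G = range (word_class ?R)"
    by (simp add: dihedral_artin_def presented_group_def)
  have gen_closed: "?gen T \<in> carrier ?G" for T
    by (cases T) (auto simp: artin_gen_elem_eq carrier)
  have pow: "?gen False [^]\<^bsub>?G\<^esub> int k = word_class ?R (concat (replicate k [wA, wB]))" for k
    unfolding artin_gen_elem_eq dihedral_artin_def by (simp add: int_pow_int word_class_pow)
  have relation: "word_class ?R (alternating m wA wB) = word_class ?R (alternating m wB wA)"
    unfolding word_class_eq_iff by (rule word_eq.relation) (simp add: artin_relations_def)
  have D_cases: "(odd m \<longrightarrow> ?gen True [^]\<^bsub>?G\<^esub> (2 :: int) = ?D) \<and> ?gen True \<otimes>\<^bsub>?G\<^esub> ?D = ?D \<otimes>\<^bsub>?G\<^esub> ?gen True"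
  proof (cases "odd m")
    case True
    then obtain q where q: "m = Suc (2 * q)" by (metis oddE Suc_eq_plus1)
    have x: "?gen True = word_class ?R (alternating m wA wB)"
      using True by (simp add: artin_gen_elem_eq)
    have "?gen True [^]\<^bsub>?G\<^esub> (2 :: int) = ?gen True \<otimes>\<^bsub>?G\<^esub> ?gen True"
      using gen_closed[of True] int_pow_mult[of "?gen True" 1 1] by simp
    also have "\<dots> = word_class ?R (alternating m wA wB) \<otimes>\<^bsub>?G\<^esub> word_class ?R (alternating m wB wA)"
      using x relation by simp
    also have "\<dots> = word_class ?R (concat (replicate m [wA, wB]))"
    proof -
      have "alternating m wA wB @ alternating m wB wA =
          concat (replicate q [wA, wB]) @ [wA, wB] @ concat (replicate q [wA, wB])"
      proof -
        have "alternating m wA wB = concat (replicate q [wA, wB]) @ [wA]"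
          by (simp only: q alternating_odd)
        moreover have "alternating m wB wA = wB # concat (replicate q [wA, wB])"
          by (simp add: q alternating_even)
        ultimately show ?thesis by simp
      qed
      also have "\<dots> = concat (replicate (q + Suc q) [wA, wB])"
        by (simp only: replicate_add concat_append replicate_Suc concat.simps)
      also have "q + Suc q = m" by (simp add: q)
      finally show ?thesis by (simp only: mult)
    qed
    also have "\<dots> = ?D"
      using True pow[of m] by (simp add: artin_N_def)
    finally have sq: "?gen True [^]\<^bsub>?G\<^esub> (2 :: int) = ?D" .
    have "?gen True \<otimes>\<^bsub>?G\<^esub> ?gen True [^]\<^bsub>?G\<^esub> (2 :: int) = ?gen True [^]\<^bsub>?G\<^esub> (2 :: int) \<otimes>\<^bsub>?G\<^esub> ?gen True"
      using gen_closed[of True] int_pow_mult[of "?gen True" 1 2] int_pow_mult[of "?gen True" 2 1] by simp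
    with sq show ?thesis by simp
  next
    case False
    then have "even m" by simp
  then obtain p where p: "m = 2 * p" by (elim evenE)
    have D: "?D = word_class ?R (alternating m wA wB)"
      using False pow[of p] by (simp add: artin_N_def p alternating_even)
    have "?gen True \<otimes>\<^bsub>?G\<^esub> ?D = word_class ?R (wA # alternating m wB wA)"
      unfolding D relation using False by (simp add: artin_gen_elem_eq mult)
    also have "\<dots> = word_class ?R (alternating m wA wB @ [wA])"
      using alternating_odd[of p wA wB] alternating_even[of p wA wB] by (simp add: p)
    also have "\<dots> = ?D \<otimes>\<^bsub>?G\<^esub> ?gen True"
      unfolding D using False by (simp add: artin_gen_elem_eq mult)
    finally show ?thesis using False by simp
  qed
  have class_run: "class_run (artin_act m) (word_class ?R u) s = run (artin_act m) u s"
    if s: "reduced ?N (snd s)" for u s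
  proof (rule class_run_word_class)
    show "run (artin_act m) u s = run (artin_act m) v s" if "word_eq ?R u v" for u v
    proof (rule run_word_eq[where P = "\<lambda>s. reduced ?N (snd s)" and R = ?R])
      show "run (artin_act m) u s = run (artin_act m) v s"
        if "(u, v) \<in> ?R" "reduced ?N (snd s)" for u v s
        using that run_artin_relation[OF assms, of s] by (simp add: artin_relations_def)
    qed (use that s artin_act_reduced artin_act_cancel in auto)
  qed
  have run_closed: "reduced ?N (snd (run (artin_act m) w s))" if "reduced ?N (snd s)" for w s
    using that by (induction w) (simp_all add: artin_act_reduced)
  show ?thesis
  proof unfold_locales
    show "?gen T \<in> carrier ?G" for T by (rule gen_closed)
    show "?N True = 0 \<or> 2 \<le> ?N True" "2 \<le> ?N False"
      using assms by (auto simp: artin_N_def)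
    show "?gen T \<otimes>\<^bsub>?G\<^esub> ?D = ?D \<otimes>\<^bsub>?G\<^esub> ?gen T" for T
    proof (cases T)
      case False
      show ?thesis
        using gen_closed[of False] int_pow_mult[of "?gen False" 1 "?N False"] int_pow_mult[of "?gen False" "?N False" 1] False
        by (simp add: add.commute)
    qed (use D_cases in simp)
    show "?gen T [^]\<^bsub>?G\<^esub> ?N T = ?D" if "?N T \<noteq> 0" for T
      using that D_cases by (cases T) (auto simp: artin_N_def split: if_splits)
    show "generate ?G (range ?gen) = carrier ?G"
      unfolding range_artin_gen_elem by (rule free_product_gens_generate)
    show "class_run (artin_act m) \<one>\<^bsub>?G\<^esub> s = s" if "reduced ?N (snd s)" for s
      unfolding one class_run[OF that] by simp
    show "class_run (artin_act m) (g \<otimes>\<^bsub>?G\<^esub> h) s = class_run (artin_act m) g (class_run (artin_act m) h s)"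
      if gh: "g \<in> carrier ?G" "h \<in> carrier ?G" and s: "reduced ?N (snd s)" for g h s
    proof -
      obtain u v where "g = word_class ?R u" "h = word_class ?R v" using gh by (auto simp: carrier)
      then show ?thesis
        using s run_closed[OF s, of v] by (simp add: mult class_run)
    qed
    show "class_run (artin_act m) (?gen T) s = act ?N T 1 s" if s: "reduced ?N (snd s)" for T s
    proof (cases T)
      case False
      then show ?thesis
        using run_ab_power[OF s, of 1] by (simp add: artin_gen_elem_eq class_run[OF s] del: act.simps artin_act.simps)
    next
      case T: True
      show ?thesis
      proof (cases "odd m")
        case True
        then obtain q where q: "m = Suc (2 * q)" by (metis oddE Suc_eq_plus1)
        have "run (artin_act m) (alternating m wA wB) s = act ?N False (int q) (artin_act m wA s)"
          using artin_act_reduced[OF s, of wA]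
          by (simp only: q alternating_odd run_simps) (simp add: run_ab_power del: act.simps artin_act.simps)
        also have "\<dots> = act ?N True 1 s"
          using True s by (simp add: q act_add act_0 act_reduced del: act.simps)
        finally show ?thesis using T True by (simp add: artin_gen_elem_eq class_run[OF s] del: act.simps artin_act.simps)
      next
        case False
        then show ?thesis using T by (simp add: artin_gen_elem_eq class_run[OF s] del: act.simps)
      qed
    qed
  qed
qed

theorem theorem1p2:
  fixes m :: nat
  assumes "m \<ge> 3"
  shows "transcendental_series
    (conjugacy_growth_series (dihedral_artin m) (free_product_gens m))"
proof -
  interpret central_amalgam "dihedral_artin m" "artin_gen_elem m"
    "artin_gen_elem m False [^]\<^bsub>dihedral_artin m\<^esub> artin_N m False" "artin_N m" "class_run (artin_act m)"
    using assms by (rule central_amalgam_dihedral_artin)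
  \<comment> \<open>For odd \<open>m\<close> the value at \<open>False\<close> is
    \<open>m \<ge> 3\<close>; for even \<open>m\<close> the value at \<open>True\<close> is
    0.\<close>
  have "\<not> (artin_N m True = 2 \<and> artin_N m False = 2)"
    using assms by (auto simp: artin_N_def)
  from transcendental_conjugacy_growth_series[OF this] show ?thesis
    by (simp only: range_artin_gen_elem)
qed

end
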